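(* Let $P,\widehat P,Q\subset\mathbb{R}^n$ be as in the context: $\widehat P$ is analogous to $P$, and $Q$ is a codimension two truncation of $\widehat P$ along the (possibly empty) collection $\mathcal{F}=\{F_1,\dots,F_k\}$ of codimension two faces of $P$. Let $\Delta=\Delta(P,Q)\subset\mathbb{R}^{n+1}$ be the push-pull polytope, let $R_P$ and $R_\Delta$ be the Khovanskii--Pukhlikov rings of $P$ and $\Delta$ (defined using the lattices $L_P$ and $L_\Delta$ of the context), and let $\mathrm{vol}_{\mathcal{F}}$, $g_3,\dots,g_n$ be the polynomial functions on $L_P$ and $q(s,P')$ the polynomial on $\mathbb{R}\times L_P$ defined in the context. Suppose that there exist a homogeneous element $D_{\mathcal{F}}\in R_P$ of degree two and homogeneous elements $D_j\in R_P$ of degree $j$, $j=3,\dots,n$, such that $D_{\mathcal{F}}(\mathrm{vol}_P)=\mathrm{vol}_{\mathcal{F}}$ and $D_j(\mathrm{vol}_P)=g_j$ for $j=3,\dots,n$. Put $$c_1=\partial_{\widehat P}-\partial_P\in R_P,\qquad c_2=D_{\mathcal{F}}\in R_P.$$ Suppose moreover that, as functions of $(s,P')$, $$\left(\frac{\partial^2}{\partial s^2}-c_1\frac{\partial}{\partial s}+c_2\right)q\bigl(s,P'+s(\widehat P-P)\bigr)=\mathrm{vol}_{\mathcal{F}}\bigl(P'+s(\widehat P-P)\bigr),$$ where $c_1$ and $c_2$ act as differential operators in the variable $P'$ and the whole operator is applied to the function $(s,P')\mapsto q(s,P'+s(\widehat P-P))$. Then there is a ring isomorphism $$R_\Delta\simeq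 R_P[x]/(x^2-c_1x+c_2).$$
   Context: **Analogous polytopes, virtual polytopes.** Two convex polytopes are analogous if they have the same normal fan. If $P'$ is analogous to $P$, faces of $P'$ correspond naturally to faces of $P$; $F(P')$ denotes the face of $P'$ corresponding to the face $F$ of $P$. Let $S_P$ be the semigroup under Minkowski sum of all lattice polytopes (with vertices in $\mathbb{Z}^n$) analogous to $P$, and $L_P$ its Grothendieck group, a lattice whose elements are called virtual polytopes analogous to $P$. The volume polynomial $\mathrm{vol}_P$ is the unique homogeneous polynomial of degree $n$ on $L_P$ whose value on each $P'\in S_P$ is the volume of $P'$. Polynomials on $L_P$ are also viewed as polynomials on $L_P\otimes\mathbb{R}$. **Khovanskii--Pukhlikov ring.** Let $P_1,\dots,P_\ell$ be a basis of $L_P$, with corresponding coordinates $(s_1,\dots,s_\ell)$ on $L_P$, and put $\partial_i=\partial/\partial s_i$. Then $R_P=\mathbb{Z}[\partial_1,\dots,\partial_\ell]/\mathrm{Ann}(\mathrm{vol}_P)$, where $\mathrm{Ann}(\mathrm{vol}_P)$ is the ideal of all differential operators $D$ with $D(\mathrm{vol}_P)=0$. The ring is graded by $\deg\partial_i=1$. A virtual polytope $P'\in L_P$ with coordinates $(s_1(P'),\dots,s_\ell(P'))$ defines the degree one element $\partial_{P'}=\sum_i s_i(P')\partial_i\in R_P$. The same definition applies to any lattice with a volume polynomial on it. **Codimension two truncation.** Let $P\subset\mathbb{R}^n$ be a convex lattice polytope, $\mathcal{F}=\{F_1,\dots,F_k\}$ a (possibly empty) collection of codimension two faces of $P$, and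 $\widehat P$ a polytope analogous to $P$ (defining an element of $L_P$). For each $i$ choose a linear function $\psi_i$ on $\mathbb{R}^n$ taking a constant value $\Psi_i(\widehat P)$ on $F_i(\widehat P)$ and with $\psi_i(x)<\Psi_i(\widehat P)$ for $x\in\widehat P\setminus F_i(\widehat P)$; fix a constant $\Psi_i(Q)<\Psi_i(\widehat P)$. The codimension two truncation is $$Q=\widehat P\cap\bigcap_{i=1}^k\{\psi_i(x)\le\Psi_i(Q)\},$$ where each $\Psi_i(Q)$ is assumed so close to $\Psi_i(\widehat P)$ that $\widehat P\setminus Q$ contains no vertices of $\widehat P$ except those lying in $\bigcup_i F_i(\widehat P)$. **The functions $\mathrm{vol}_{\mathcal{F}}$, $g_j$, $q$.** For $P'$ analogous to $P$, let $\Psi_i(P')$ be the (constant, maximal) value of $\psi_i$ on $F_i(P')$. For small $s>0$ put $$\overline Q_{P'}(s)=\bigcup_{i=1}^k\{x\in P' : \psi_i(x)\ge\Psi_i(P')+s(\Psi_i(Q)-\Psi_i(\widehat P))\}$$ (the part cut off from $P'$). Then $$\mathrm{vol}(\overline Q_{P'}(s))=\Bigl(\sum_{i=1}^k a_i\,\mathrm{vol}_{n-2}(F_i(P'))\Bigr)\frac{s^2}{2}+\sum_{j=3}^n g_j(P')s^j,$$ with real constants $a_1,\dots,a_k$ and with $g_j(P')$ a linear combination of volumes of certain codimension $j$ faces of $P'$. Let $\mathrm{vol}_{\mathcal{F}}$ and $g_j$ be the polynomial functions on $L_P$ such that, for all $P'$ analogous to $P$, $\mathrm{vol}_{\mathcal{F}}(P')=\sum_i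 a_i\mathrm{vol}_{n-2}(F_i(P'))$ and $g_j(P')$ is the coefficient of $s^j$ in the expansion of $\mathrm{vol}(\overline Q_{P'}(s))$, $j=3,\dots,n$. Set $$q(s,P')=\mathrm{vol}_{\mathcal{F}}(P')\frac{s^2}{2}+\sum_{j=3}^n g_j(P')s^j.$$ **Push-pull polytope and its lattice.** The push-pull polytope is $\Delta=\Delta(P,Q)=\mathrm{conv}\bigl((P\times 1)\cup(Q\times 0)\bigr)\subset\mathbb{R}^n\times\mathbb{R}$. More generally, for $s>0$ and $P'$ analogous to $P$ such that $P'-P$ is a combination of $P_1,\dots,P_\ell$ with nonnegative coefficients, set $$\Delta(s,P')=\mathrm{conv}\bigl((P'\times s)\cup((P'+s(Q-P))\times 0)\bigr),$$ where $P'+s(Q-P)$ is computed in the Grothendieck group of convex polytopes. Thus $\Delta(1,P)=\Delta$, the polytopes $\Delta(s,P')$ are analogous to $\Delta$, and $\Delta(s,P')+\Delta(t,P'')=\Delta(s+t,P'+P'')$. $L_\Delta$ is the Grothendieck group of the semigroup of the polytopes $\Delta(s,P')$; it has a unique basis $C,\Delta_1,\dots,\Delta_\ell$ such that $\Delta(s,\sum_i s_iP_i)$ has coordinates $(s,s_1,\dots,s_\ell)$. The volume polynomial $\mathrm{vol}_\Delta$ on $L_\Delta$ has as value on $\Delta(s,P')$ the $(n+1)$-dimensional volume of $\Delta(s,P')$, and $R_\Delta=\mathbb{Z}[\partial/\partial s,\partial/\partial s_1,\dots,\partial/\partial s_\ell]/\mathrm{Ann}(\mathrm{vol}_\Delta)$,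 where $(s,s_1,\dots,s_\ell)$ are the coordinates on $L_\Delta$ in the basis $C,\Delta_1,\dots,\Delta_\ell$ and $\mathrm{Ann}(\mathrm{vol}_\Delta)$ is the ideal of all differential operators $D$ in this polynomial ring with $D(\mathrm{vol}_\Delta)=0$.
   Formalization: The cuts are also assumed so small that, for 0<s≤1, truncating P̂ at levels Ψ_i(P̂)+s(Ψ_i(Q)−Ψ_i(P̂)) gives a polytope analogous to Q; without this, two deep cuts at adjacent corners of a square give a counterexample. *)

theory Defs
  imports
    "HOL-Analysis.Analysis"
    "HOL-Library.Poly_Mapping"
    "HOL-Library.Set_Algebras"
    "HOL-Algebra.UnivPoly"
    "HOL-Algebra.QuotRing"
    "HOL-Algebra.Algebraic_Closure_Type"
begin

section \<open>Analogous polytopes\<close>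

text \<open>Outer normals: functionals that attain their maximum over \<open>P\<close> at every point of \<open>F\<close>.\<close>

definition normal_cone :: "'a::euclidean_space set \<Rightarrow> 'a set \<Rightarrow> 'a set" where
  "normal_cone P F = {u. \<forall>x\<in>F. \<forall>y\<in>P. u \<bullet> y \<le> u \<bullet> x}"

definition normal_fan :: "'a::euclidean_space set \<Rightarrow> 'a set set" where
  "normal_fan P = {normal_cone P F | F. F face_of P \<and> F \<noteq> {}}"

definition analogous :: "'a::euclidean_space set \<Rightarrow> 'a set \<Rightarrow> bool" where
  "analogous A B \<longleftrightarrow>
     polytope A \<and> A \<noteq> {} \<and> polytope B \<and> B \<noteq> {} \<and> normal_fan A = normal_fan B"

definition corr_face :: "'a::euclidean_space set \<Rightarrow> 'a set \<Rightarrow> 'a set \<Rightarrow> 'a set" where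
  "corr_face P F P' =
     (THE F'. F' face_of P' \<and> F' \<noteq> {} \<and> normal_cone P' F' = normal_cone P F)"

definition lattice_polytope :: "(real^'n) set \<Rightarrow> bool" where
  "lattice_polytope P \<longleftrightarrow>
     polytope P \<and> P \<noteq> {} \<and> (\<forall>v. v extreme_point_of P \<longrightarrow> (\<forall>i. v $ i \<in> \<int>))"

text \<open>Semigroups of polytopes are taken under Minkowski sum, which is \<open>+\<close> on sets.\<close>

definition S_P :: "(real^'n) set \<Rightarrow> (real^'n) set set" where
  "S_P P = {P'. lattice_polytope P' \<and> analogous P' P}"


section \<open>Grothendieck groups and bases\<close>

text \<open>
  The Grothendieck group of a subsemigroup \<open>S\<close> of an additive commutative monoid, as classes of
  pairs \<open>(a, b)\<close> standing for \<open>a - b\<close>. It is written multiplicatively, as a \<open>monoid\<close> record.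
\<close>

definition groth_rel :: "'a::comm_monoid_add set \<Rightarrow> (('a \<times> 'a) \<times> ('a \<times> 'a)) set" where
  "groth_rel S = {((a, b), (c, d)) | a b c d.
     a \<in> S \<and> b \<in> S \<and> c \<in> S \<and> d \<in> S \<and> (\<exists>e\<in>S. a + d + e = c + b + e)}"

definition grothendieck :: "'a::comm_monoid_add set \<Rightarrow> ('a \<times> 'a) set monoid" where
  "grothendieck S =
     \<lparr>carrier = (S \<times> S) // groth_rel S,
      monoid.mult = (\<lambda>U V. groth_rel S `` {(a + c, b + d) | a b c d. (a, b) \<in> U \<and> (c, d) \<in> V}),
      one = groth_rel S `` {(a, a) | a. a \<in> S}\<rparr>"

text \<open>The canonical map of \<open>S\<close> to its Grothendieck group; \<open>S\<close> need not contain a zero.\<close>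

definition groth_incl :: "'a::comm_monoid_add set \<Rightarrow> 'a \<Rightarrow> ('a \<times> 'a) set" where
  "groth_incl S a = groth_rel S `` {(a + a, a)}"

definition lattice_comb :: "('g, 'm) monoid_scheme \<Rightarrow> ('k::finite \<Rightarrow> 'g) \<Rightarrow> ('k \<Rightarrow> int) \<Rightarrow> 'g" where
  "lattice_comb G b c = (\<Otimes>\<^bsub>G\<^esub>i\<in>UNIV. b i [^]\<^bsub>G\<^esub> c i)"

definition lattice_basis :: "('g, 'm) monoid_scheme \<Rightarrow> ('k::finite \<Rightarrow> 'g) \<Rightarrow> bool" where
  "lattice_basis G b \<longleftrightarrow>
     (\<forall>i. b i \<in> carrier G) \<and> (\<forall>x\<in>carrier G. \<exists>!c. x = lattice_comb G b c)"

definition lattice_coords :: "('g, 'm) monoid_scheme \<Rightarrow> ('k::finite \<Rightarrow> 'g) \<Rightarrow> 'g \<Rightarrow> real^'k" where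
  "lattice_coords G b x = (\<chi> i. of_int ((THE c. x = lattice_comb G b c) i))"

definition poly_coords ::
    "'a::comm_monoid_add set \<Rightarrow> ('k::finite \<Rightarrow> ('a \<times> 'a) set) \<Rightarrow> 'a \<Rightarrow> real^'k" where
  "poly_coords S b A = lattice_coords (grothendieck S) b (groth_incl S A)"

text \<open>
  Polynomials on a lattice with basis \<open>b\<close> are real polynomial functions of the coordinates,
  that is, of the points of its realification \<open>real^'k\<close>.
\<close>

definition volume_polynomial ::
    "'a::euclidean_space set set \<Rightarrow> ('k::finite \<Rightarrow> ('a set \<times> 'a set) set) \<Rightarrow> (real^'k \<Rightarrow> real) \<Rightarrow> bool"
  where
  "volume_polynomial S b f \<longleftrightarrow>
     real_polynomial_function f \<and>
     (\<forall>t x. f (t *\<^sub>R x) = t ^ DIM('a) * f x) \<and>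
     (\<forall>A\<in>S. f (poly_coords S b A) = measure lebesgue A)"


section \<open>Differential operators and Khovanskii--Pukhlikov rings\<close>

text \<open>
  \<open>'k diffop\<close> is the polynomial ring over the integers in commuting variables \<open>\<partial>\<^sub>i\<close>,
  \<open>i :: 'k\<close>; an element maps exponent vectors to coefficients.
\<close>

type_synonym 'k diffop = "('k \<Rightarrow>\<^sub>0 nat) \<Rightarrow>\<^sub>0 int"

definition partial_deriv :: "'k::finite \<Rightarrow> (real^'k \<Rightarrow> real) \<Rightarrow> real^'k \<Rightarrow> real" where
  "partial_deriv i f = (\<lambda>x. deriv (\<lambda>t. f (x + t *\<^sub>R axis i 1)) 0)"

text \<open>The order of the variables chosen here is immaterial on polynomial functions.\<close>

definition apply_monomial :: "('k::finite \<Rightarrow>\<^sub>0 nat) \<Rightarrow> (real^'k \<Rightarrow> real) \<Rightarrow> real^'k \<Rightarrow> real" where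
  "apply_monomial m f =
     foldr (\<lambda>i. partial_deriv i ^^ Poly_Mapping.lookup m i) (SOME xs. distinct xs \<and> set xs = UNIV) f"

definition apply_diffop :: "'k::finite diffop \<Rightarrow> (real^'k \<Rightarrow> real) \<Rightarrow> real^'k \<Rightarrow> real" where
  "apply_diffop D f = (\<lambda>x. \<Sum>m\<in>Poly_Mapping.keys D. of_int (Poly_Mapping.lookup D m) * apply_monomial m f x)"

definition homogeneous_diffop :: "nat \<Rightarrow> 'k::finite diffop \<Rightarrow> bool" where
  "homogeneous_diffop d D \<longleftrightarrow> (\<forall>m\<in>Poly_Mapping.keys D. (\<Sum>i\<in>UNIV. Poly_Mapping.lookup m i) = d)"

definition diffop_ring :: "'k::finite diffop ring" where
  "diffop_ring = ring_of_type_algebra"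

definition Ann :: "(real^'k::finite \<Rightarrow> real) \<Rightarrow> 'k diffop set" where
  "Ann f = {D. apply_diffop D f = (\<lambda>x. 0)}"

definition KP_ring :: "(real^'k::finite \<Rightarrow> real) \<Rightarrow> 'k diffop set ring" where
  "KP_ring f = diffop_ring Quot Ann f"

definition KP_class :: "(real^'k::finite \<Rightarrow> real) \<Rightarrow> 'k diffop \<Rightarrow> 'k diffop set" where
  "KP_class f D = Ann f +>\<^bsub>diffop_ring\<^esub> D"

text \<open>\<open>\<partial>\<^sub>A\<close> for an element \<open>A\<close> of the semigroup; the coordinates are integers.\<close>

definition poly_diffop ::
    "'a::comm_monoid_add set \<Rightarrow> ('k::finite \<Rightarrow> ('a \<times> 'a) set) \<Rightarrow> 'a \<Rightarrow> 'k diffop" where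
  "poly_diffop S b A =
     (\<Sum>i\<in>UNIV. Poly_Mapping.single (Poly_Mapping.single i 1) \<lfloor>poly_coords S b A $ i\<rfloor>)"


section \<open>Codimension two truncations\<close>

definition face_value ::
    "(real^'n) set \<Rightarrow> (real^'n) set \<Rightarrow> (real^'n \<Rightarrow> real) \<Rightarrow> (real^'n) set \<Rightarrow> real" where
  "face_value P F \<psi> P' = the_elem (\<psi> ` corr_face P F P')"

definition truncation ::
    "(real^'n) set \<Rightarrow> nat \<Rightarrow> (nat \<Rightarrow> real^'n \<Rightarrow> real) \<Rightarrow> (nat \<Rightarrow> real) \<Rightarrow> (real^'n) set" where
  "truncation P' k \<psi> c = P' \<inter> (\<Inter>i\<in>{1..k}. {x. \<psi> i x \<le> c i})"

definition cut_level ::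
    "(real^'n) set \<Rightarrow> (real^'n) set \<Rightarrow> (nat \<Rightarrow> (real^'n) set) \<Rightarrow> (nat \<Rightarrow> real^'n \<Rightarrow> real) \<Rightarrow> (nat \<Rightarrow> real)
      \<Rightarrow> (real^'n) set \<Rightarrow> real \<Rightarrow> nat \<Rightarrow> real" where
  "cut_level P Phat F \<psi> c P' s i =
     face_value P (F i) (\<psi> i) P' + s * (c i - face_value P (F i) (\<psi> i) Phat)"

definition cut_off ::
    "(real^'n) set \<Rightarrow> (real^'n) set \<Rightarrow> nat \<Rightarrow> (nat \<Rightarrow> (real^'n) set) \<Rightarrow> (nat \<Rightarrow> real^'n \<Rightarrow> real)
      \<Rightarrow> (nat \<Rightarrow> real) \<Rightarrow> (real^'n) set \<Rightarrow> real \<Rightarrow> (real^'n) set" where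
  "cut_off P Phat k F \<psi> c P' s =
     (\<Union>i\<in>{1..k}. {x\<in>P'. \<psi> i x \<ge> cut_level P Phat F \<psi> c P' s i})"

text \<open>
  \<open>c i\<close> is the value of the \<open>i\<close>-th cutting function at which \<open>Q\<close> is cut off.
  The last two clauses say that the cuts are close enough to the faces: no other vertex is cut
  off, and the shape does not change while the cutting hyperplanes are moved back, all in the
  same proportion, towards the faces. The first of these alone does not prevent two cuts from
  meeting in the middle of an edge of \<open>Phat\<close> that joins two of the faces; cutting two
  adjacent corners off a square so deeply that their common edge disappears is an example.
\<close>

definition codim_two_truncation ::
    "(real^'n) set \<Rightarrow> (real^'n) set \<Rightarrow> nat \<Rightarrow> (nat \<Rightarrow> (real^'n) set) \<Rightarrow> (nat \<Rightarrow> real^'n \<Rightarrow> real)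
      \<Rightarrow> (nat \<Rightarrow> real) \<Rightarrow> (real^'n) set \<Rightarrow> bool" where
  "codim_two_truncation P Phat k F \<psi> c Q \<longleftrightarrow>
     inj_on F {1..k} \<and>
     (\<forall>i\<in>{1..k}. F i face_of P \<and> F i \<noteq> {} \<and> aff_dim (F i) = aff_dim P - 2) \<and>
     (\<forall>i\<in>{1..k}. linear (\<psi> i) \<and>
        (\<exists>M. (\<forall>x\<in>corr_face P (F i) Phat. \<psi> i x = M) \<and>
             (\<forall>x\<in>Phat - corr_face P (F i) Phat. \<psi> i x < M) \<and> c i < M)) \<and>
     Q = truncation Phat k \<psi> c \<and>
     (\<forall>v. v extreme_point_of Phat \<and> v \<in> Phat - Q \<longrightarrow> v \<in> (\<Union>i\<in>{1..k}. corr_face P (F i) Phat)) \<and>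
     (\<forall>s. 0 < s \<and> s \<le> 1 \<longrightarrow>
        analogous (truncation Phat k \<psi> (cut_level P Phat F \<psi> c Phat s)) Q)"

text \<open>
  The \<open>m\<close>-dimensional volume of a set \<open>A\<close> of affine dimension \<open>m\<close>: the Lebesgue measure
  of the product of \<open>A\<close> with a unit cube in the orthogonal complement of its directions.
\<close>

definition dim_volume :: "nat \<Rightarrow> 'a::euclidean_space set \<Rightarrow> real" where
  "dim_volume m A =
     (let U = (SOME U. finite U \<and> card U = DIM('a) - m \<and> pairwise orthogonal U \<and>
                 (\<forall>u\<in>U. norm u = 1 \<and> (\<forall>x\<in>A. \<forall>y\<in>A. u \<bullet> (x - y) = 0)))
      in measure lebesgue (A + (\<Sum>u\<in>U. closed_segment 0 u)))"

definition q_poly :: "nat \<Rightarrow> (real^'k::finite \<Rightarrow> real) \<Rightarrow> (nat \<Rightarrow> real^'k \<Rightarrow> real) \<Rightarrow> real \<Rightarrow> real^'k \<Rightarrow> real"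
  where
  "q_poly n volF g s p = volF p * (s\<^sup>2 / 2) + (\<Sum>j=3..n. g j p * s ^ j)"

text \<open>
  The polynomials \<open>volF\<close> and \<open>g j\<close> on the lattice of virtual polytopes attached to the truncation.
  They are determined by their values on the points of \<open>S_P P\<close>.
\<close>

definition truncation_polynomials ::
    "(real^'n) set \<Rightarrow> (real^'n) set \<Rightarrow> nat \<Rightarrow> (nat \<Rightarrow> (real^'n) set) \<Rightarrow> (nat \<Rightarrow> real^'n \<Rightarrow> real)
      \<Rightarrow> (nat \<Rightarrow> real) \<Rightarrow> ('l::finite \<Rightarrow> ((real^'n) set \<times> (real^'n) set) set)
      \<Rightarrow> (nat \<Rightarrow> real) \<Rightarrow> (real^'l \<Rightarrow> real) \<Rightarrow> (nat \<Rightarrow> real^'l \<Rightarrow> real) \<Rightarrow> bool" where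
  "truncation_polynomials P Phat k F \<psi> c b a volF g \<longleftrightarrow>
     real_polynomial_function volF \<and>
     (\<forall>j\<in>{3..CARD('n)}. real_polynomial_function (g j)) \<and>
     (\<forall>P'\<in>S_P P.
        volF (poly_coords (S_P P) b P') =
          (\<Sum>i=1..k. a i * dim_volume (CARD('n) - 2) (corr_face P (F i) P')) \<and>
        (\<forall>\<^sub>F s in at_right 0.
           measure lebesgue (cut_off P Phat k F \<psi> c P' s) =
             q_poly CARD('n) volF g s (poly_coords (S_P P) b P')))"


section \<open>Push-pull polytopes\<close>

text \<open>
  In \<open>push_pull s P' Y\<close> the polytope \<open>Y\<close> plays the role of \<open>P' + s (Q - P)\<close>. The latter is
  computed in the Grothendieck group of convex polytopes, so \<open>Y\<close> is characterized by
  \<open>Y + s P = P' + s Q\<close>, by the cancellation law for Minkowski sums. For the coordinates of the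
  lattice to be integers, \<open>s\<close> runs through the positive integers and \<open>P'\<close> through \<open>S_P P\<close>.
\<close>

definition push_pull :: "real \<Rightarrow> (real^'n) set \<Rightarrow> (real^'n) set \<Rightarrow> ((real^'n) \<times> real) set" where
  "push_pull s P' Y = convex hull ((P' \<times> {s}) \<union> (Y \<times> {0}))"

definition push_pull_admissible ::
    "(real^'n) set \<Rightarrow> (real^'n) set \<Rightarrow> nat \<Rightarrow> (real^'n) set \<Rightarrow> (real^'n) set \<Rightarrow> bool" where
  "push_pull_admissible P Q s P' Y \<longleftrightarrow>
     0 < s \<and> P' \<in> S_P P \<and> polytope Y \<and>
     Y + (\<lambda>x. real s *\<^sub>R x) ` P = P' + (\<lambda>x. real s *\<^sub>R x) ` Q"

definition S_Delta :: "(real^'n) set \<Rightarrow> (real^'n) set \<Rightarrow> ((real^'n) \<times> real) set set" where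
  "S_Delta P Q = {push_pull (real s) P' Y | s P' Y. push_pull_admissible P Q s P' Y}"

definition join_coord :: "real \<Rightarrow> real^'l::finite \<Rightarrow> real^('l option)" where
  "join_coord s p = (\<chi> j. case j of None \<Rightarrow> s | Some i \<Rightarrow> p $ i)"

text \<open>
  The basis \<open>C, \<Delta>\<^sub>1, \<dots>, \<Delta>\<^sub>l\<close> is \<open>E None\<close> followed by \<open>E (Some i)\<close>, where \<open>i\<close> runs
  through the index type of the basis \<open>b\<close>.
\<close>

definition push_pull_basis ::
    "(real^'n) set \<Rightarrow> (real^'n) set \<Rightarrow> ('l::finite \<Rightarrow> ((real^'n) set \<times> (real^'n) set) set)
      \<Rightarrow> ('l option \<Rightarrow> (((real^'n) \<times> real) set \<times> ((real^'n) \<times> real) set) set) \<Rightarrow> bool" where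
  "push_pull_basis P Q b E \<longleftrightarrow>
     lattice_basis (grothendieck (S_Delta P Q)) E \<and>
     (\<forall>s P' Y. push_pull_admissible P Q s P' Y \<longrightarrow>
        poly_coords (S_Delta P Q) E (push_pull (real s) P' Y) =
          join_coord (real s) (poly_coords (S_P P) b P'))"


section \<open>The quadratic extension\<close>

definition quadratic_extension :: "('r, 'm) ring_scheme \<Rightarrow> 'r \<Rightarrow> 'r \<Rightarrow> (nat \<Rightarrow> 'r) set ring" where
  "quadratic_extension R c1 c2 =
     UP R Quot (Idl\<^bsub>UP R\<^esub>
       {up_ring.monom (UP R) \<one>\<^bsub>R\<^esub> 2 \<ominus>\<^bsub>UP R\<^esub> up_ring.monom (UP R) c1 1
          \<oplus>\<^bsub>UP R\<^esub> up_ring.monom (UP R) c2 0})"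

end

theory Submission
  imports Defs
begin

text \<open>
  Write \<open>V\<close> for the volume polynomial of the push-pull polytopes and \<open>\<delta> = Phat - P\<close>. The slice of
  \<open>\<Delta>(s, P')\<close> at depth \<open>\<tau>\<close> is \<open>P' + \<tau> (Q - P)\<close>, which is \<open>P' + \<tau> \<delta>\<close> with the truncation carried out to
  depth \<open>\<tau>\<close>; hence \<open>\<partial>V/\<partial>s (s, P') = vol (P' + s \<delta>) - q (s, P' + s \<delta>)\<close>, and \<open>V\<close> vanishes at \<open>s = 0\<close>.
  From this, \<open>Ann vol_P\<close> annihilates \<open>V\<close>, and the hypothesis on \<open>q\<close> says precisely that the
  \<open>s\<close>-derivative of \<open>(\<partial>\<^sup>2/\<partial>s\<^sup>2 - c\<^sub>1 \<partial>/\<partial>s + c\<^sub>2) V\<close> is zero. Conversely, if \<open>A + B \<partial>/\<partial>s\<close> annihilates \<open>V\<close>,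
  then the terms of order \<open>0\<close> and \<open>1\<close> at \<open>s = 0\<close> show that \<open>A\<close> and \<open>B\<close> annihilate \<open>vol_P\<close>. So evaluation
  at \<open>x = \<partial>/\<partial>s\<close> maps \<open>R_P[x]\<close> onto \<open>R_\<Delta>\<close> with kernel generated by \<open>x\<^sup>2 - c\<^sub>1 x + c\<^sub>2\<close>.

  The formula for \<open>\<partial>V/\<partial>s\<close> need only be checked on a Zariski dense set of lattice points. Volumes of
  lattice polytopes suffice, because \<open>V\<close> and the volume are homogeneous: comparing the heights \<open>N\<close> and
  \<open>N - 1\<close> gives difference quotients of \<open>V\<close> with step \<open>1/N\<close>.
\<close>

section \<open>Differential operators on polynomial functions\<close>

text \<open>Only lattice polytopes of positive height are available, and this shapes the geometry.
  Virtual polytopes P' + \<tau> (Q - P) are always met in a form without subtraction: P' is written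
  as R + s P or as A + Phat, so that the slices become the honest Minkowski sums R + t P + (s - t) Q
  and A + (1 - s) Phat + s Q. The price is that identities are known only on a translate of the
  semigroup of coordinates, which is still Zariski dense. The second sum is the truncation of A +
  Phat because the normal fan of Q refines that of Phat; this comes from the last clause of
  \<open>codim_two_truncation\<close>, which keeps the fan of Q while the cuts move back. Height 0
  is not attained either, so the vanishing of V there is a limit. Finally, the quadratic operator
  needs an initial value besides its vanishing s-derivative: q has a double zero at s = 0, so the
  second s-derivative of V there is the \<delta>-derivative of vol_P, and the term with c_1 cancels
  it.\<close>

lemma real_polynomial_function_line:
  fixes f :: "'a::euclidean_space \<Rightarrow> real"
  assumes "real_polynomial_function f"
  shows "real_polynomial_function (\<lambda>t::real. f (x + t *\<^sub>R v))"
proof -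
  have "polynomial_function (\<lambda>t::real. x + t *\<^sub>R v)"
    by (intro polynomial_function_add polynomial_function_const polynomial_function_bounded_linear
        bounded_linear_scaleR_left)
  from real_polynomial_function_compose[OF this assms] show ?thesis by (simp add: o_def)
qed

text \<open>Directions other than the coordinate axes are needed because \<open>c1\<close> acts as
  the derivative along the vector of Phat - P.\<close>

definition dir_deriv :: "'a::euclidean_space \<Rightarrow> ('a \<Rightarrow> real) \<Rightarrow> 'a \<Rightarrow> real" where
  "dir_deriv v f x = deriv (\<lambda>t. f (x + t *\<^sub>R v)) 0"

lemma partial_deriv_eq: "partial_deriv i f = dir_deriv (axis i 1) f"
  by (auto simp: partial_deriv_def dir_deriv_def)

lemma has_dir_deriv:
  fixes f :: "'a::euclidean_space \<Rightarrow> real"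
  assumes "real_polynomial_function f"
  shows "((\<lambda>t. f (x + t *\<^sub>R v)) has_real_derivative dir_deriv v f (x + t *\<^sub>R v)) (at t)"
proof -
  obtain p' where p': "\<And>t. ((\<lambda>t. f (x + t *\<^sub>R v)) has_real_derivative p' t) (at t)"
    using has_real_derivative_polynomial_function[OF real_polynomial_function_line[OF assms]] by blast
  have "((\<lambda>u. f (x + (t + u) *\<^sub>R v)) has_real_derivative p' t) (at 0)"
    using p'[of t] DERIV_shift[of "\<lambda>t. f (x + t *\<^sub>R v)" "p' t" 0 t] by (simp add: add.commute)
  then have "dir_deriv v f (x + t *\<^sub>R v) = p' t"
    unfolding dir_deriv_def by (intro DERIV_imp_deriv) (simp add: algebra_simps)
  with p' show ?thesis by simp
qed

lemma has_dir_deriv_0: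
  fixes f :: "'a::euclidean_space \<Rightarrow> real"
  assumes "real_polynomial_function f"
  shows "((\<lambda>t. f (x + t *\<^sub>R v)) has_real_derivative dir_deriv v f x) (at 0)"
  using has_dir_deriv[OF assms, of x v 0] by simp

lemma dir_derivI:
  "((\<lambda>t. f (x + t *\<^sub>R v)) has_real_derivative d) (at 0) \<Longrightarrow> dir_deriv v f x = d"
  unfolding dir_deriv_def by (rule DERIV_imp_deriv)

lemma dir_deriv_const: "dir_deriv v (\<lambda>x. c) = (\<lambda>x. 0)"
  by (rule ext, rule dir_derivI) simp

lemma dir_deriv_linear:
  assumes "bounded_linear f"
  shows "dir_deriv v f = (\<lambda>x. f v)"
proof (rule ext, rule dir_derivI)
  interpret bounded_linear f by fact
  show "((\<lambda>t. f (x + t *\<^sub>R v)) has_real_derivative f v) (at 0)" for x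
    by (auto simp: add scaleR intro!: derivative_eq_intros)
qed

lemma dir_deriv_add:
  assumes "real_polynomial_function f" "real_polynomial_function g"
  shows "dir_deriv v (\<lambda>x. f x + g x) = (\<lambda>x. dir_deriv v f x + dir_deriv v g x)"
  by (rule ext, rule dir_derivI) (intro DERIV_add has_dir_deriv_0 assms)

lemma dir_deriv_mult:
  assumes "real_polynomial_function f" "real_polynomial_function g"
  shows "dir_deriv v (\<lambda>x. f x * g x) = (\<lambda>x. dir_deriv v f x * g x + f x * dir_deriv v g x)"
proof (rule ext, rule dir_derivI)
  fix x
  show "((\<lambda>t. f (x + t *\<^sub>R v) * g (x + t *\<^sub>R v)) has_real_derivative
      dir_deriv v f x * g x + f x * dir_deriv v g x) (at 0)"
    using DERIV_mult[OF has_dir_deriv_0[OF assms(1), of x v] has_dir_deriv_0[OF assms(2), of x v]]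
    by (simp add: algebra_simps)
qed

lemma dir_deriv_cmult:
  assumes "real_polynomial_function f"
  shows "dir_deriv v (\<lambda>x. c * f x) = (\<lambda>x. c * dir_deriv v f x)"
  by (rule ext, rule dir_derivI) (intro DERIV_cmult has_dir_deriv_0 assms)

lemma real_polynomial_function_dir_deriv:
  assumes "real_polynomial_function f"
  shows "real_polynomial_function (dir_deriv v f)"
  using assms
  by (induction f rule: real_polynomial_function.induct)
     (auto simp: dir_deriv_linear dir_deriv_const dir_deriv_add dir_deriv_mult)

text \<open>Symmetry of second derivatives by induction on the formation of the polynomial: for a
  product, both sides expand by Leibniz to the same four terms.\<close>

lemma dir_deriv_commute:
  assumes "real_polynomial_function f"
  shows "dir_deriv v (dir_deriv w f) = dir_deriv w (dir_deriv v f)"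
  using assms
  by (induction f rule: real_polynomial_function.induct)
     (auto simp: dir_deriv_linear dir_deriv_const dir_deriv_add dir_deriv_mult algebra_simps
        real_polynomial_function_dir_deriv real_polynomial_function.intros(4))

text \<open>The definition differentiates along one line at a time, so linearity in the direction is
  not built in; it again follows by induction on the formation of the polynomial.\<close>

lemma dir_deriv_add_left:
  assumes "real_polynomial_function f"
  shows "dir_deriv (v + w) f x = dir_deriv v f x + dir_deriv w f x"
  using assms
  by (induction f rule: real_polynomial_function.induct)
     (auto simp: dir_deriv_linear dir_deriv_const dir_deriv_add dir_deriv_mult algebra_simps
        bounded_linear.linear linear_add)

lemma dir_deriv_scaleR_left:
  assumes "real_polynomial_function f"
  shows "dir_deriv (c *\<^sub>R v) f x = c * dir_deriv v f x"
  using assms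
  by (induction f rule: real_polynomial_function.induct)
     (auto simp: dir_deriv_linear dir_deriv_const dir_deriv_add dir_deriv_mult algebra_simps
        bounded_linear.linear linear_cmul)

lemma dir_deriv_sum_left:
  assumes "real_polynomial_function f"
  shows "dir_deriv (\<Sum>i\<in>I. c i *\<^sub>R v i) f x = (\<Sum>i\<in>I. c i * dir_deriv (v i) f x)"
proof (induction I rule: infinite_finite_induct)
  case (insert i I)
  then show ?case by (simp add: dir_deriv_add_left assms dir_deriv_scaleR_left)
qed (use dir_deriv_scaleR_left[OF assms, of 0] in auto)

lemma dir_deriv_translate:
  "dir_deriv v (\<lambda>x. f (x + w)) = (\<lambda>x. dir_deriv v f (x + w))"
  by (auto simp: dir_deriv_def algebra_simps)

lemma real_polynomial_function_translate:
  fixes f :: "'a::euclidean_space \<Rightarrow> real"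
  assumes "real_polynomial_function f"
  shows "real_polynomial_function (\<lambda>x. f (x + w))"
proof -
  have "polynomial_function (\<lambda>x. x + w)"
    by (intro polynomial_function_add polynomial_function_const polynomial_function_id)
  from real_polynomial_function_compose[OF this assms] show ?thesis by (simp add: o_def)
qed

lemma real_polynomial_function_partial_deriv:
  "real_polynomial_function f \<Longrightarrow> real_polynomial_function (partial_deriv i f)"
  by (simp add: partial_deriv_eq real_polynomial_function_dir_deriv)

lemma real_polynomial_function_cmult:
  "real_polynomial_function f \<Longrightarrow> real_polynomial_function (\<lambda>x. c * f x)"
  by (intro real_polynomial_function.intros(4) real_polynomial_function.intros(2))

section \<open>Induction over exponent vectors and operators\<close>

lemma exponent_induct [case_names zero add]:
  fixes m :: "'k::finite \<Rightarrow>\<^sub>0 nat"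
  assumes "P 0" and "\<And>i m. P m \<Longrightarrow> P (Poly_Mapping.single i 1 + m)"
  shows "P m"
proof (induction "\<Sum>i\<in>UNIV. Poly_Mapping.lookup m i" arbitrary: m)
  case 0
  then have "m = 0" by (intro poly_mapping_eqI) auto
  then show ?case using assms by simp
next
  case (Suc n)
  then obtain i where i: "Poly_Mapping.lookup m i \<noteq> 0"
    by (metis Zero_not_Suc sum.neutral)
  define m' where "m' = m - Poly_Mapping.single i 1"
  have m: "m = Poly_Mapping.single i 1 + m'"
    using i unfolding m'_def
    by (intro poly_mapping_eqI) (auto simp: lookup_add lookup_minus lookup_single when_def)
  have "(\<Sum>j\<in>UNIV. Poly_Mapping.lookup m j) = 1 + (\<Sum>j\<in>UNIV. Poly_Mapping.lookup m' j)"
    by (subst m) (simp add: lookup_add sum.distrib lookup_single when_def)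
  with Suc have "P m'" by simp
  then show ?case using assms(2) m by metis
qed

lemma poly_mapping_induct_add [case_names single add]:
  fixes D :: "'a \<Rightarrow>\<^sub>0 'b::comm_monoid_add"
  assumes single: "\<And>m c. P (Poly_Mapping.single m c)"
    and add: "\<And>D E. P D \<Longrightarrow> P E \<Longrightarrow> P (D + E)"
  shows "P D"
proof -
  have "P (\<Sum>m\<in>M. Poly_Mapping.single m (Poly_Mapping.lookup D m))" if "finite M" for M
    using that
  proof induction
    case empty
    \<comment> \<open>The zero polynomial is a monomial with coefficient 0, so it needs no case of
      its own.\<close>
    show ?case using single[of undefined 0] by simp
  qed (auto intro: single add)
  moreover have "(\<Sum>m\<in>Poly_Mapping.keys D. Poly_Mapping.single m (Poly_Mapping.lookup D m)) = D"
    by (intro poly_mapping_eqI)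
       (auto simp: lookup_sum lookup_single when_def in_keys_iff sum.delta)
  ultimately show ?thesis by (metis finite_keys)
qed

definition dvar :: "'k \<Rightarrow> 'k diffop" where
  "dvar i = Poly_Mapping.single (Poly_Mapping.single i 1) 1"

text \<open>Constants and variables generate the operators as a ring, so an identity compatible with
  sums and products has to be checked for a single partial derivative only.\<close>

lemma diffop_induct [case_names const var add mult]:
  fixes D :: "'k::finite diffop"
  assumes const: "\<And>c. P (Poly_Mapping.single 0 c)"
    and var: "\<And>i. P (dvar i)"
    and add: "\<And>D E. P D \<Longrightarrow> P E \<Longrightarrow> P (D + E)"
    and mult: "\<And>D E. P D \<Longrightarrow> P E \<Longrightarrow> P (D * E)"
  shows "P D"
proof (induction D rule: poly_mapping_induct_add)
  case (single m c)
  show ?case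
  proof (induction m rule: exponent_induct)
    case (add i m)
    have "Poly_Mapping.single (Poly_Mapping.single i 1 + m) c = dvar i * Poly_Mapping.single m c"
      by (simp add: dvar_def mult_single)
    then show ?case using mult[OF var add] by simp
  qed (rule const)
qed (rule add)

section \<open>The action of operators on polynomial functions\<close>

lemma apply_monomial_0: "apply_monomial 0 f = f"
proof -
  have "foldr (\<lambda>i. partial_deriv i ^^ Poly_Mapping.lookup 0 i) xs f = f" for xs
    by (induction xs) auto
  then show ?thesis by (simp add: apply_monomial_def)
qed

text \<open>Both claims share one induction: moving the additional derivative past the others uses
  symmetry of derivatives, hence that every intermediate function is a polynomial. Distinctness of
  \<open>xs\<close> makes the raised exponent count once.\<close>

lemma foldr_partial_deriv_Suc:
  assumes "real_polynomial_function f"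
  shows "real_polynomial_function (foldr (\<lambda>i. partial_deriv i ^^ e i) xs f) \<and>
    (distinct xs \<longrightarrow> i \<in> set xs \<longrightarrow> foldr (\<lambda>j. partial_deriv j ^^ (e(i := Suc (e i))) j) xs f =
      partial_deriv i (foldr (\<lambda>j. partial_deriv j ^^ e j) xs f))"
proof (induction xs)
  case (Cons j xs)
  let ?g = "foldr (\<lambda>i. partial_deriv i ^^ e i) xs f"
  have g: "real_polynomial_function ?g" using Cons by simp
  have pow: "real_polynomial_function ((partial_deriv j ^^ n) h) \<and>
      (partial_deriv j ^^ n) (partial_deriv i h) = partial_deriv i ((partial_deriv j ^^ n) h)"
    if "real_polynomial_function h" for n h
    using that
    by (induction n)
       (auto simp: real_polynomial_function_dir_deriv partial_deriv_eq dir_deriv_commute)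
  have same: "foldr (\<lambda>k. partial_deriv k ^^ (e(i := Suc (e i))) k) xs f = ?g" if "i \<notin> set xs"
    using that by (induction xs) auto
  show ?case using Cons pow[OF g] same by auto
qed (use assms in auto)

lemma real_polynomial_function_apply_monomial:
  "real_polynomial_function f \<Longrightarrow> real_polynomial_function (apply_monomial m f)"
  using foldr_partial_deriv_Suc unfolding apply_monomial_def by blast

text \<open>\<open>SOME\<close> fixes an unknown ordering of the variables. After this rule the
  ordering is never mentioned again.\<close>

lemma apply_monomial_Suc:
  fixes f :: "real^'k::finite \<Rightarrow> real"
  assumes "real_polynomial_function f"
  shows "apply_monomial (Poly_Mapping.single i 1 + m) f = partial_deriv i (apply_monomial m f)"
proof -
  define xs :: "'k list" where "xs = (SOME xs. distinct xs \<and> set xs = UNIV)"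
  have "\<exists>xs :: 'k list. distinct xs \<and> set xs = UNIV"
    using finite_distinct_list[OF finite_class.finite_UNIV] by metis
  from someI_ex[OF this] have "distinct xs \<and> set xs = UNIV"
    unfolding xs_def .
  moreover have "Poly_Mapping.lookup (Poly_Mapping.single i 1 + m) =
      (Poly_Mapping.lookup m)(i := Suc (Poly_Mapping.lookup m i))"
    by (auto simp: lookup_add lookup_single when_def)
  moreover have "apply_monomial m f = foldr (\<lambda>i. partial_deriv i ^^ Poly_Mapping.lookup m i) xs f" for m
    unfolding apply_monomial_def xs_def ..
  ultimately show ?thesis
    using foldr_partial_deriv_Suc[OF assms, of "Poly_Mapping.lookup m" xs i] by (metis UNIV_I)
qed

lemma apply_diffop_superset:
  assumes "finite M" "Poly_Mapping.keys D \<subseteq> M"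
  shows "apply_diffop D f x =
    (\<Sum>m\<in>M. of_int (Poly_Mapping.lookup D m) * apply_monomial m f x)"
  unfolding apply_diffop_def using assms
  by (intro sum.mono_neutral_left) (auto simp: in_keys_iff)

lemma apply_diffop_single:
  "apply_diffop (Poly_Mapping.single m c) f = (\<lambda>x. of_int c * apply_monomial m f x)"
  by (rule ext, subst apply_diffop_superset[of "{m}"]) auto

lemma apply_diffop_0 [simp]: "apply_diffop 0 f = (\<lambda>x. 0)"
  by (simp add: apply_diffop_def)

lemma apply_diffop_const:
  "apply_diffop (Poly_Mapping.single 0 c) f = (\<lambda>x. of_int c * f x)"
  by (simp add: apply_diffop_single apply_monomial_0)

lemma apply_diffop_add: "apply_diffop (D + E) f = (\<lambda>x. apply_diffop D f x + apply_diffop E f x)"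
proof
  fix x
  let ?M = "Poly_Mapping.keys D \<union> Poly_Mapping.keys E"
  have "Poly_Mapping.keys (D + E) \<subseteq> ?M" by (rule keys_add)
  then show "apply_diffop (D + E) f x = apply_diffop D f x + apply_diffop E f x"
    by (subst (1 2 3) apply_diffop_superset[of ?M])
       (auto simp: lookup_add sum.distrib algebra_simps)
qed

lemma apply_diffop_uminus: "apply_diffop (- D) f = (\<lambda>x. - apply_diffop D f x)"
  by (auto simp: apply_diffop_def sum_negf)

lemma apply_diffop_diff: "apply_diffop (D - E) f = (\<lambda>x. apply_diffop D f x - apply_diffop E f x)"
  using apply_diffop_add[of D "- E" f] by (simp add: apply_diffop_uminus)

lemma real_polynomial_function_apply_diffop:
  "real_polynomial_function f \<Longrightarrow> real_polynomial_function (apply_diffop D f)"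
  unfolding apply_diffop_def
  by (intro real_polynomial_function_sum real_polynomial_function_cmult
      real_polynomial_function_apply_monomial) auto

lemma apply_diffop_dvar:
  assumes "real_polynomial_function f"
  shows "apply_diffop (dvar i) f = partial_deriv i f"
  using apply_monomial_Suc[OF assms, of i 0]
  by (simp add: dvar_def apply_diffop_single apply_monomial_0)

lemma apply_diffop_dvar_mult:
  assumes "real_polynomial_function f"
  shows "apply_diffop (dvar i * D) f = partial_deriv i (apply_diffop D f)"
proof (induction D rule: poly_mapping_induct_add)
  case (single m c)
  show ?case
    using assms
    by (simp add: dvar_def mult_single apply_diffop_single apply_monomial_Suc[OF assms, simplified]
        partial_deriv_eq dir_deriv_cmult real_polynomial_function_apply_monomial)
next
  case (add D E)
  then show ?case using assms
    by (simp add: distrib_left apply_diffop_add partial_deriv_eq dir_deriv_add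
        real_polynomial_function_apply_diffop)
qed

lemma apply_diffop_const_mult:
  "apply_diffop (Poly_Mapping.single 0 c * D) f = (\<lambda>x. of_int c * apply_diffop D f x)"
proof (induction D rule: poly_mapping_induct_add)
  case (single m d)
  show ?case by (simp add: mult_single apply_diffop_single mult.assoc)
next
  case (add D E)
  then show ?case by (simp add: distrib_left apply_diffop_add)
qed

lemma apply_diffop_mult:
  assumes "real_polynomial_function f"
  shows "apply_diffop (D * E) f = apply_diffop D (apply_diffop E f)"
proof -
  \<comment> \<open>Both f and E are generalized: the product case uses the hypotheses for other
    right factors and for an already differentiated function.\<close>
  have "\<forall>f E. real_polynomial_function f \<longrightarrow>
      apply_diffop (D * E) f = apply_diffop D (apply_diffop E f)"
  proof (induction D rule: diffop_induct)
    case (mult D1 D2)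
    then show ?case by (metis mult.assoc real_polynomial_function_apply_diffop)
  qed (simp_all add: apply_diffop_const_mult apply_diffop_const apply_diffop_dvar_mult
      apply_diffop_dvar real_polynomial_function_apply_diffop distrib_right apply_diffop_add)
  with assms show ?thesis by blast
qed

lemma apply_diffop_fun_add:
  assumes "real_polynomial_function f" "real_polynomial_function g"
  shows "apply_diffop D (\<lambda>x. f x + g x) = (\<lambda>x. apply_diffop D f x + apply_diffop D g x)"
proof -
  have "\<forall>f g. real_polynomial_function f \<longrightarrow> real_polynomial_function g \<longrightarrow>
      apply_diffop D (\<lambda>x. f x + g x) = (\<lambda>x. apply_diffop D f x + apply_diffop D g x)"
    by (induction D rule: diffop_induct)
       (simp_all add: apply_diffop_const apply_diffop_dvar real_polynomial_function.intros(3)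
        partial_deriv_eq dir_deriv_add apply_diffop_add apply_diffop_mult algebra_simps
        real_polynomial_function_apply_diffop)
  with assms show ?thesis by blast
qed

lemma apply_diffop_fun_cmult:
  assumes "real_polynomial_function f"
  shows "apply_diffop D (\<lambda>x. c * f x) = (\<lambda>x. c * apply_diffop D f x)"
proof -
  have "\<forall>f. real_polynomial_function f \<longrightarrow>
      apply_diffop D (\<lambda>x. c * f x) = (\<lambda>x. c * apply_diffop D f x)"
    by (induction D rule: diffop_induct)
       (simp_all add: apply_diffop_const apply_diffop_dvar real_polynomial_function_cmult
        partial_deriv_eq dir_deriv_cmult apply_diffop_add apply_diffop_mult algebra_simps
        real_polynomial_function_apply_diffop)
  with assms show ?thesis by blast
qed

lemma apply_diffop_fun_zero [simp]: "apply_diffop D (\<lambda>x. 0) = (\<lambda>x. 0)"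
  using apply_diffop_fun_cmult[OF real_polynomial_function.intros(2), of D 0 0] by simp

lemma apply_diffop_fun_diff:
  assumes "real_polynomial_function f" "real_polynomial_function g"
  shows "apply_diffop D (\<lambda>x. f x - g x) = (\<lambda>x. apply_diffop D f x - apply_diffop D g x)"
  using apply_diffop_fun_add[OF assms(1) real_polynomial_function_cmult[OF assms(2), of "-1"]]
    apply_diffop_fun_cmult[OF assms(2), of D "-1"] by simp

lemma apply_diffop_fun_sum:
  assumes "finite I" "\<And>i. i \<in> I \<Longrightarrow> real_polynomial_function (f i)"
  shows "apply_diffop D (\<lambda>x. \<Sum>i\<in>I. f i x) = (\<lambda>x. \<Sum>i\<in>I. apply_diffop D (f i) x)"
  using assms
  by (induction I) (auto simp: apply_diffop_fun_add real_polynomial_function_sum)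

lemma apply_diffop_translate:
  assumes "real_polynomial_function f"
  shows "apply_diffop D (\<lambda>x. f (x + w)) = (\<lambda>x. apply_diffop D f (x + w))"
proof -
  have "apply_diffop D (\<lambda>x. f (x + w)) = (\<lambda>x. apply_diffop D f (x + w))"
    if "real_polynomial_function f" for f
    using that
  proof (induction D arbitrary: f rule: diffop_induct)
    case (var i f)
    show ?case
      unfolding apply_diffop_dvar[OF var] partial_deriv_eq
        apply_diffop_dvar[OF real_polynomial_function_translate[OF var, of w]]
      by (rule dir_deriv_translate[of _ f w])
  next
    case (mult D E f)
    show ?case
      unfolding apply_diffop_mult[OF mult.prems] mult.IH(2)[OF mult.prems]
        apply_diffop_mult[OF real_polynomial_function_translate[OF mult.prems, of w]]
      by (rule mult.IH(1)[OF real_polynomial_function_apply_diffop[OF mult.prems]])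
  next
    case (add D E f)
    show ?case unfolding apply_diffop_add add.IH[OF add.prems] ..
  qed (simp add: apply_diffop_const)
  from this[OF assms] show ?thesis .
qed

text \<open>Links the formal degree one elements of the ring with geometry: the coordinates of a
  polytope become a direction of differentiation.\<close>

lemma apply_diffop_linear_form:
  fixes f :: "real^'k::finite \<Rightarrow> real"
  assumes "real_polynomial_function f"
  shows "apply_diffop (\<Sum>i\<in>UNIV. Poly_Mapping.single (Poly_Mapping.single i 1) (c i)) f =
    dir_deriv (\<chi> i. of_int (c i)) f"
proof
  fix x
  have *: "apply_diffop (\<Sum>i\<in>I. Poly_Mapping.single (Poly_Mapping.single i 1) (c i)) f x =
    (\<Sum>i\<in>I. of_int (c i) * partial_deriv i f x)" if "finite I" for I
    using that
    by (induction I) (auto simp: apply_diffop_add apply_diffop_single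
        apply_monomial_Suc[OF assms, of _ 0, simplified] apply_monomial_0)
  have "(\<chi> i. of_int (c i)) = (\<Sum>i\<in>UNIV. of_int (c i) *\<^sub>R axis i (1::real))"
    by (simp add: vec_eq_iff axis_def sum_component if_distrib[of "\<lambda>x. _ * x"] cong: if_cong)
  then show "apply_diffop (\<Sum>i\<in>UNIV. Poly_Mapping.single (Poly_Mapping.single i 1) (c i)) f x =
    dir_deriv (\<chi> i. of_int (c i)) f x"
    by (simp only: *[OF finite_class.finite_UNIV] dir_deriv_sum_left[OF assms] partial_deriv_eq)
qed

section \<open>Operators annihilating the volume of the push-pull polytope\<close>

text \<open>The inclusion of the operators in the s_i into those in (s, s_i). Exponents are moved
  along \<open>Some\<close>, so \<partial>/\<partial>s, the variable \<open>None\<close>, does not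
  occur. Linear extension by \<open>frag_extend\<close> gives additivity for free.\<close>

definition lift_diffop :: "'l::finite diffop \<Rightarrow> 'l option diffop" where
  "lift_diffop = frag_extend (\<lambda>m. Poly_Mapping.single
     (\<Sum>i\<in>UNIV. Poly_Mapping.single (Some i) (Poly_Mapping.lookup m i)) 1)"

lemma lift_diffop_add: "lift_diffop (D + E) = lift_diffop D + lift_diffop E"
  and lift_diffop_diff: "lift_diffop (D - E) = lift_diffop D - lift_diffop E"
  by (simp_all add: lift_diffop_def frag_extend_add frag_extend_diff)

lemma lift_diffop_single:
  "lift_diffop (Poly_Mapping.single m c) =
    Poly_Mapping.single (\<Sum>i\<in>UNIV. Poly_Mapping.single (Some i) (Poly_Mapping.lookup m i)) c"
proof -
  have cmul: "frag_cmul c (Poly_Mapping.single m (1::int)) = Poly_Mapping.single m c" for m :: "'b"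
    by (intro poly_mapping_eqI) (auto simp: lookup_single when_def)
  have "lift_diffop (frag_cmul c (Poly_Mapping.single m 1)) = frag_cmul c
      (Poly_Mapping.single (\<Sum>i\<in>UNIV. Poly_Mapping.single (Some i) (Poly_Mapping.lookup m i)) 1)"
    unfolding lift_diffop_def frag_extend_cmul frag_extend_of ..
  then show ?thesis by (simp only: cmul)
qed

lemma lift_diffop_const: "lift_diffop (Poly_Mapping.single 0 c) = Poly_Mapping.single 0 c"
  by (simp add: lift_diffop_single)

lemma lift_diffop_1 [simp]: "lift_diffop 1 = 1"
  using lift_diffop_const[of 1] by simp

lemma lift_diffop_dvar: "lift_diffop (dvar i) = dvar (Some i)"
proof -
  have "(\<Sum>j\<in>UNIV. Poly_Mapping.single (Some j) (Poly_Mapping.lookup (Poly_Mapping.single i 1) j)) =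
      (\<Sum>j\<in>UNIV. if j = i then Poly_Mapping.single (Some i) (1::nat) else 0)"
    by (intro sum.cong) (auto simp: lookup_single when_def)
  then show ?thesis unfolding dvar_def lift_diffop_single by simp
qed

lemma lift_diffop_mult: "lift_diffop (D * E) = lift_diffop D * lift_diffop E"
proof (induction D rule: poly_mapping_induct_add)
  case (single m c)
  show ?case
    by (induction E rule: poly_mapping_induct_add)
       (simp_all add: lift_diffop_single mult_single lookup_add single_add sum.distrib
         distrib_left lift_diffop_add)
qed (simp add: distrib_right lift_diffop_add)

section \<open>The coordinates (s, P') and differentiation with s frozen\<close>

lemma join_coord_None [simp]: "join_coord s p $ None = s"
  and join_coord_Some [simp]: "join_coord s p $ Some i = p $ i"
  by (simp_all add: join_coord_def)

lemma join_coord_add: "join_coord s p + join_coord t r = join_coord (s + t) (p + r)"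
  and join_coord_scaleR: "c *\<^sub>R join_coord s p = join_coord (c * s) (c *\<^sub>R p)"
  by (simp_all add: join_coord_def vec_eq_iff split: option.split)

lemma join_coord_surj: "\<exists>s p. x = join_coord s p"
  by (intro exI[of _ "x $ None"] exI[of _ "\<chi> i. x $ Some i"])
     (simp add: join_coord_def vec_eq_iff split: option.split)

lemma join_coord_axis:
  "join_coord t 0 = t *\<^sub>R axis None 1" "join_coord 0 (axis i 1) = axis (Some i) (1::real)"
  by (auto simp: join_coord_def vec_eq_iff axis_def split: option.split)

lemma polynomial_function_join_coord: "polynomial_function (join_coord s)"
proof -
  have "bounded_linear (join_coord 0 :: real^'a \<Rightarrow> _)"
    unfolding linear_conv_bounded_linear[symmetric]
    by (intro linearI) (simp_all add: join_coord_add join_coord_scaleR)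
  then have "polynomial_function (\<lambda>p :: real^'a. join_coord s 0 + join_coord 0 p)"
    by (intro polynomial_function_add polynomial_function_const polynomial_function_bounded_linear)
  then show ?thesis by (simp add: join_coord_add)
qed

lemma real_polynomial_function_join_coord:
  "real_polynomial_function F \<Longrightarrow> real_polynomial_function (\<lambda>p. F (join_coord s p))"
  using real_polynomial_function_compose[OF polynomial_function_join_coord, of F s]
  by (simp add: o_def)

lemma has_derivative_join_coord:
  assumes "real_polynomial_function F"
  shows "((\<lambda>t. F (join_coord t p)) has_real_derivative partial_deriv None F (join_coord s p)) (at s)"
  using has_dir_deriv[OF assms, of "join_coord 0 p" "axis None 1" s]
  by (simp add: partial_deriv_eq join_coord_axis[symmetric] join_coord_scaleR join_coord_add)

text \<open>A lifted operator never moves the coordinate \<open>None\<close>, so s may be frozen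
  before differentiating.\<close>

lemma apply_lift_diffop:
  assumes "real_polynomial_function F"
  shows "apply_diffop (lift_diffop D) F (join_coord s p) = apply_diffop D (\<lambda>p. F (join_coord s p)) p"
  using assms
proof (induction D arbitrary: F p rule: diffop_induct)
  case (const c F p)
  show ?case by (simp add: lift_diffop_const apply_diffop_const)
next
  case (var i F p)
  have "partial_deriv (Some i) F (join_coord s p) = partial_deriv i (\<lambda>p. F (join_coord s p)) p"
    by (simp add: partial_deriv_def join_coord_axis(2)[symmetric] join_coord_add join_coord_scaleR)
  then show ?case
    by (simp add: lift_diffop_dvar apply_diffop_dvar[OF var]
        apply_diffop_dvar[OF real_polynomial_function_join_coord[OF var]])
next
  case (add D E F p)
  then show ?case by (simp add: lift_diffop_add apply_diffop_add)
next
  case (mult D E F p)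
  have "apply_diffop (lift_diffop (D * E)) F (join_coord s p) =
      apply_diffop D (\<lambda>p. apply_diffop (lift_diffop E) F (join_coord s p)) p"
    by (simp add: lift_diffop_mult apply_diffop_mult[OF mult.prems]
        mult.IH(1)[OF real_polynomial_function_apply_diffop[OF mult.prems]])
  also have "\<dots> = apply_diffop D (apply_diffop E (\<lambda>p. F (join_coord s p))) p"
    by (simp add: mult.IH(2)[OF mult.prems])
  finally show ?case
    by (simp add: apply_diffop_mult[OF real_polynomial_function_join_coord[OF mult.prems]])
qed

lemma apply_diffop_partial_deriv:
  assumes "real_polynomial_function f"
  shows "apply_diffop D (partial_deriv i f) = partial_deriv i (apply_diffop D f)"
  using apply_diffop_mult[OF assms, of D "dvar i"] apply_diffop_mult[OF assms, of "dvar i" D]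
    apply_diffop_dvar[OF assms] apply_diffop_dvar[OF real_polynomial_function_apply_diffop[OF assms]]
  by (simp add: mult.commute)

lemma partial_deriv_0 [simp]: "partial_deriv i (\<lambda>x. 0) = (\<lambda>x. 0)"
  by (simp add: partial_deriv_eq dir_deriv_const)

lemma in_Ann: "D \<in> Ann f \<longleftrightarrow> (\<forall>x. apply_diffop D f x = 0)"
  by (auto simp: Ann_def)

text \<open>For V itself there is no closed formula, only for its s-derivative and its value at s =
  0. As D commutes with \<partial>/\<partial>s, the function D V is constant along the s-lines and
  starts at 0.\<close>

lemma in_Ann_join_coordI:
  fixes V :: "real^('l::finite option) \<Rightarrow> real"
  assumes V: "real_polynomial_function V"
    and at_0: "\<And>p. apply_diffop D V (join_coord 0 p) = 0"
    and deriv: "\<And>s p. apply_diffop D (partial_deriv None V) (join_coord s p) = 0"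
  shows "D \<in> Ann V"
  unfolding in_Ann
proof
  fix x
  let ?W = "apply_diffop D V"
  have W: "real_polynomial_function ?W" using V by (rule real_polynomial_function_apply_diffop)
  have "partial_deriv None ?W = apply_diffop D (partial_deriv None V)"
    using V by (simp add: apply_diffop_partial_deriv)
  then have "((\<lambda>t. ?W (join_coord t p)) has_real_derivative 0) (at s)" for s and p :: "real^'l"
    using has_derivative_join_coord[OF W, of p s] deriv by simp
  then have "?W (join_coord s p) = ?W (join_coord 0 p)" for s and p :: "real^'l"
    using DERIV_isconst_all[of "\<lambda>t. ?W (join_coord t p)" s 0] by blast
  moreover obtain s and p :: "real^'l" where "x = join_coord s p" using join_coord_surj by blast
  ultimately show "?W x = 0" using at_0 by metis
qed

text \<open>All that the algebra takes from geometry: \<open>f\<close> stands for vol_P,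
  \<open>V\<close> for the volume of the push-pull polytopes, and \<open>V_0\<close> with
  \<open>V_deriv\<close> is an initial value problem that determines \<open>V\<close>.\<close>

locale push_pull_volumes =
  fixes f volF :: "real^'l::finite \<Rightarrow> real" and g :: "nat \<Rightarrow> real^'l \<Rightarrow> real" and n :: nat
    and V :: "real^('l option) \<Rightarrow> real" and c1 DF :: "'l diffop" and Dj :: "nat \<Rightarrow> 'l diffop"
    and \<delta> :: "real^'l"
  assumes f: "real_polynomial_function f" and V: "real_polynomial_function V"
    and DF: "apply_diffop DF f = volF"
    and Dj: "\<And>j. j \<in> {3..n} \<Longrightarrow> apply_diffop (Dj j) f = g j"
    and c1: "\<And>h. real_polynomial_function h \<Longrightarrow> apply_diffop c1 h = dir_deriv \<delta> h"
    and V_0: "\<And>p. V (join_coord 0 p) = 0"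
    and V_deriv: "\<And>s p. partial_deriv None V (join_coord s p) =
      f (p + s *\<^sub>R \<delta>) - q_poly n volF g s (p + s *\<^sub>R \<delta>)"
    and q: "\<And>s p.
        deriv (deriv (\<lambda>t. q_poly n volF g t (p + t *\<^sub>R \<delta>))) s
        - apply_diffop c1 (\<lambda>p'. deriv (\<lambda>t. q_poly n volF g t (p' + t *\<^sub>R \<delta>)) s) p
        + apply_diffop DF (\<lambda>p'. q_poly n volF g s (p' + s *\<^sub>R \<delta>)) p
        = volF (p + s *\<^sub>R \<delta>)"
begin

lemma volF: "real_polynomial_function volF"
  using DF real_polynomial_function_apply_diffop[OF f] by metis

lemma g: "3 \<le> j \<Longrightarrow> j \<le> n \<Longrightarrow> real_polynomial_function (g j)"
  using Dj[of j] real_polynomial_function_apply_diffop[OF f, of "Dj j"] by simp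

lemma real_polynomial_function_q_poly: "real_polynomial_function (q_poly n volF g s)"
  unfolding q_poly_def
  by (intro real_polynomial_function.intros(3) real_polynomial_function_sum
      real_polynomial_function.intros(4) real_polynomial_function.intros(2) volF g) auto

text \<open>Operators commute, so whatever kills \<open>f\<close> kills every derivative of
  \<open>f\<close>; by \<open>DF\<close> and \<open>Dj\<close> all coefficients of q are such
  derivatives.\<close>

lemma apply_diffop_q_poly_eq_0:
  assumes "D \<in> Ann f"
  shows "apply_diffop D (q_poly n volF g s) = (\<lambda>p. 0)"
proof -
  have 0: "apply_diffop D (apply_diffop E f) = (\<lambda>p. 0)" for E
  proof -
    have "apply_diffop D (apply_diffop E f) = apply_diffop E (apply_diffop D f)"
      by (metis apply_diffop_mult f mult.commute)
    then show ?thesis using assms by (simp add: Ann_def)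
  qed
  have F: "apply_diffop D volF = (\<lambda>p. 0)" using 0 DF by metis
  have G: "apply_diffop D (g j) = (\<lambda>p. 0)" if "j \<in> {3..n}" for j using 0 Dj[OF that] by metis
  have "q_poly n volF g s = (\<lambda>p. s\<^sup>2 / 2 * volF p + (\<Sum>j=3..n. s ^ j * g j p))"
    by (auto simp: q_poly_def mult.commute)
  moreover have "apply_diffop D (\<lambda>p. \<Sum>j=3..n. s ^ j * g j p) =
      (\<lambda>p. \<Sum>j=3..n. apply_diffop D (\<lambda>p. s ^ j * g j p) p)"
    by (rule apply_diffop_fun_sum) (auto intro: real_polynomial_function_cmult g)
  moreover have "apply_diffop D (\<lambda>p. s ^ j * g j p) = (\<lambda>p. 0)" if "j \<in> {3..n}" for j
    using apply_diffop_fun_cmult[OF g, of j D "s ^ j"] G[OF that] that by simp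
  moreover have "apply_diffop D (\<lambda>p. s\<^sup>2 / 2 * volF p) = (\<lambda>p. 0)"
    using apply_diffop_fun_cmult[OF volF, of D "s\<^sup>2 / 2"] F by simp
  moreover have "real_polynomial_function (\<lambda>p. s\<^sup>2 / 2 * volF p)"
    "real_polynomial_function (\<lambda>p. \<Sum>j=3..n. s ^ j * g j p)"
    by (auto intro!: real_polynomial_function_cmult real_polynomial_function_sum volF g)
  ultimately show ?thesis
    using apply_diffop_fun_add[of "\<lambda>p. s\<^sup>2 / 2 * volF p" "\<lambda>p. \<Sum>j=3..n. s ^ j * g j p" D]
    by simp
qed

text \<open>Translation by s \<delta> commutes with operators with constant coefficients, so both
  terms of \<open>V_deriv\<close> are killed.\<close>

lemma lift_diffop_in_Ann:
  assumes "D \<in> Ann f"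
  shows "lift_diffop D \<in> Ann V"
proof (rule in_Ann_join_coordI[OF V])
  fix s p
  let ?h = "\<lambda>p. f (p + s *\<^sub>R \<delta>)" and ?r = "\<lambda>p. q_poly n volF g s (p + s *\<^sub>R \<delta>)"
  show "apply_diffop (lift_diffop D) V (join_coord 0 p) = 0"
    by (simp add: apply_lift_diffop[OF V] V_0)
  have "apply_diffop (lift_diffop D) (partial_deriv None V) (join_coord s p) =
      apply_diffop D (\<lambda>p. ?h p - ?r p) p"
    by (simp add: apply_lift_diffop[OF real_polynomial_function_partial_deriv[OF V]] V_deriv)
  also have "\<dots> = apply_diffop D ?h p - apply_diffop D ?r p"
    using apply_diffop_fun_diff[OF real_polynomial_function_translate[OF f]
        real_polynomial_function_translate[OF real_polynomial_function_q_poly]] by metis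
  also have "\<dots> = 0"
    unfolding apply_diffop_translate[OF f] apply_diffop_translate[OF real_polynomial_function_q_poly]
    using assms by (simp add: apply_diffop_q_poly_eq_0 in_Ann)
  finally show "apply_diffop (lift_diffop D) (partial_deriv None V) (join_coord s p) = 0" .
qed

text \<open>Linear independence of 1 and x over R_P. At s = 0 only the B-term survives, because
  there V vanishes and \<partial>V/\<partial>s is vol_P. With B gone, A kills V identically, and one
  more s-derivative at s = 0 exposes A vol_P.\<close>

lemma lift_diffop_in_Ann_iff:
  "lift_diffop A + lift_diffop B * dvar None \<in> Ann V \<longleftrightarrow> A \<in> Ann f \<and> B \<in> Ann f"
proof
  assume "A \<in> Ann f \<and> B \<in> Ann f"
  then show "lift_diffop A + lift_diffop B * dvar None \<in> Ann V"
    using lift_diffop_in_Ann[of A] lift_diffop_in_Ann[of B]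
    by (subst mult.commute) (simp add: in_Ann apply_diffop_add apply_diffop_mult V Ann_def)
next
  assume *: "lift_diffop A + lift_diffop B * dvar None \<in> Ann V"
  note V' = real_polynomial_function_partial_deriv[OF V, of None]
  have f_eq: "partial_deriv None V (join_coord 0 p) = f p" for p
    by (simp add: V_deriv q_poly_def)
  have AB: "apply_diffop (lift_diffop A) V x + apply_diffop (lift_diffop B) (partial_deriv None V) x = 0"
    for x
    using * by (simp add: in_Ann apply_diffop_add apply_diffop_mult V apply_diffop_dvar)
  have B: "B \<in> Ann f"
    unfolding in_Ann
  proof
    fix p
    show "apply_diffop B f p = 0"
      using AB[of "join_coord 0 p"]
      by (simp add: apply_lift_diffop[OF V] apply_lift_diffop[OF V'] V_0 f_eq)
  qed
  have "apply_diffop (lift_diffop B) (partial_deriv None V) x = 0" for x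
    using lift_diffop_in_Ann[OF B] by (simp add: Ann_def apply_diffop_partial_deriv[OF V])
  with AB have "apply_diffop (lift_diffop A) V = (\<lambda>x. 0)" by auto
  then have "apply_diffop (lift_diffop A) (partial_deriv None V) = (\<lambda>x. 0)"
    by (simp add: apply_diffop_partial_deriv[OF V])
  then have "apply_diffop A f p = 0" for p
    using apply_lift_diffop[OF V', where D = A and s = 0 and p = p] by (simp add: f_eq)
  with B show "A \<in> Ann f \<and> B \<in> Ann f" by (simp add: in_Ann)
qed

text \<open>Apply the operator to \<partial>V/\<partial>s. On vol_P (P' + s \<delta>) its first two
  terms cancel, since \<partial>/\<partial>s and c_1 both act as the \<delta>-derivative; D_F leaves
  vol_F (P' + s \<delta>), and by the hypothesis q contributes the same with the opposite
  sign.\<close>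

lemma quadratic_in_Ann:
  "dvar None * dvar None - lift_diffop c1 * dvar None + lift_diffop DF \<in> Ann V"
proof (rule in_Ann_join_coordI[OF V])
  define U where "U = partial_deriv None V"
  define Q where "Q t p = q_poly n volF g t (p + t *\<^sub>R \<delta>)" for t p
  have U: "real_polynomial_function U"
    unfolding U_def by (rule real_polynomial_function_partial_deriv[OF V])
  have U': "real_polynomial_function (partial_deriv None U)"
    by (rule real_polynomial_function_partial_deriv[OF U])
  let ?L = "dvar None * dvar None - lift_diffop c1 * dvar None + lift_diffop DF"
  have U_eq: "U (join_coord s p) = f (p + s *\<^sub>R \<delta>) - Q s p" for s p
    by (simp add: U_def Q_def V_deriv)
  have L: "apply_diffop ?L h (join_coord s p) = partial_deriv None (partial_deriv None h) (join_coord s p)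
      - apply_diffop c1 (\<lambda>p. partial_deriv None h (join_coord s p)) p
      + apply_diffop DF (\<lambda>p. h (join_coord s p)) p"
    if h: "real_polynomial_function h" for h s p
    using h by (simp add: apply_diffop_add apply_diffop_diff apply_diffop_mult apply_diffop_dvar
        real_polynomial_function_partial_deriv apply_lift_diffop)
  note f' = real_polynomial_function_dir_deriv[OF f, of \<delta>]
  have fd: "((\<lambda>t. f (p + t *\<^sub>R \<delta>)) has_real_derivative dir_deriv \<delta> f (p + s *\<^sub>R \<delta>)) (at s)" for s p
    by (rule has_dir_deriv[OF f])
  have fdd: "((\<lambda>t. dir_deriv \<delta> f (p + t *\<^sub>R \<delta>)) has_real_derivative
      dir_deriv \<delta> (dir_deriv \<delta> f) (p + s *\<^sub>R \<delta>)) (at s)" for s p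
    by (rule has_dir_deriv[OF f'])
  \<comment> \<open>Turned around so that Q is differentiated through the polynomials f and U and
    not through its own sum.\<close>
  have Q_eq: "Q s p = f (p + s *\<^sub>R \<delta>) - U (join_coord s p)" for s p
    by (simp add: U_eq)
  have "((\<lambda>t. Q t p) has_real_derivative
      dir_deriv \<delta> f (p + s *\<^sub>R \<delta>) - partial_deriv None U (join_coord s p)) (at s)" for s p
    unfolding Q_eq by (intro DERIV_diff fd has_derivative_join_coord U)
  then have dQ: "deriv (\<lambda>t. Q t p) s =
      dir_deriv \<delta> f (p + s *\<^sub>R \<delta>) - partial_deriv None U (join_coord s p)" for s p
    by (rule DERIV_imp_deriv)
  have ddQ: "deriv (deriv (\<lambda>t. Q t p)) s = dir_deriv \<delta> (dir_deriv \<delta> f) (p + s *\<^sub>R \<delta>)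
      - partial_deriv None (partial_deriv None U) (join_coord s p)" for s p
    unfolding dQ by (rule DERIV_imp_deriv, intro DERIV_diff fdd has_derivative_join_coord U')
  note t = real_polynomial_function_translate real_polynomial_function_join_coord
  {
    fix s p
    have "apply_diffop c1 (\<lambda>p'. dir_deriv \<delta> f (p' + s *\<^sub>R \<delta>) - partial_deriv None U (join_coord s p')) p
        = dir_deriv \<delta> (dir_deriv \<delta> f) (p + s *\<^sub>R \<delta>)
          - apply_diffop c1 (\<lambda>p. partial_deriv None U (join_coord s p)) p"
      by (subst apply_diffop_fun_diff[OF t(1)[OF f'] t(2)[OF U']])
         (simp add: apply_diffop_translate[OF f'] c1[OF f'])
    moreover have "apply_diffop DF (\<lambda>p'. f (p' + s *\<^sub>R \<delta>) - U (join_coord s p')) p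
        = volF (p + s *\<^sub>R \<delta>) - apply_diffop DF (\<lambda>p. U (join_coord s p)) p"
      by (subst apply_diffop_fun_diff[OF t(1)[OF f] t(2)[OF U]])
         (simp add: apply_diffop_translate[OF f] DF)
    ultimately have "apply_diffop ?L U (join_coord s p) = 0"
      using q[of p s] unfolding Q_def[symmetric] ddQ dQ L[OF U] by (simp add: Q_eq)
    then show "apply_diffop ?L (partial_deriv None V) (join_coord s p) = 0"
      by (simp add: U_def)
  }
  fix p
  \<comment> \<open>Initial value: the factor t^2 of q makes the derivative of Q vanish at 0. Then
    \<partial>U/\<partial>s at s = 0 is the \<delta>-derivative of f, that is c_1 f, and the
    D_F-term vanishes with V.\<close>
  have "((\<lambda>t. t\<^sup>2 * (volF (p + t *\<^sub>R \<delta>) / 2 + (\<Sum>j=3..n. g j (p + t *\<^sub>R \<delta>) * t ^ (j - 2))))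
      has_real_derivative 0) (at 0)" for p
  proof -
    have "real_polynomial_function
        (\<lambda>t. volF (p + t *\<^sub>R \<delta>) / 2 + (\<Sum>j=3..n. g j (p + t *\<^sub>R \<delta>) * t ^ (j - 2)))" (is "real_polynomial_function ?w")
      by (intro real_polynomial_function.intros(3) real_polynomial_function_sum
          real_polynomial_function.intros(4) real_polynomial_function_divide
          real_polynomial_function_power real_polynomial_function.intros(1)[OF bounded_linear_ident]
          real_polynomial_function_line volF g) auto
    \<comment> \<open>The value of this derivative is irrelevant, since the product rule multiplies
      it by 0^2.\<close>
    then obtain w' where "(?w has_real_derivative w') (at 0)"
      using has_real_derivative_polynomial_function by blast
    then have "((\<lambda>t. t\<^sup>2 * ?w t) has_real_derivative (2 * 0 * ?w 0 + w' * 0\<^sup>2)) (at 0)"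
      by (intro DERIV_mult) (auto intro!: derivative_eq_intros)
    then show ?thesis by simp
  qed
  moreover have "Q t p = t\<^sup>2 * (volF (p + t *\<^sub>R \<delta>) / 2 + (\<Sum>j=3..n. g j (p + t *\<^sub>R \<delta>) * t ^ (j - 2)))" for t p
  proof -
    have "t ^ j = t\<^sup>2 * t ^ (j - 2)" if "j \<in> {3..n}" for j
    proof -
      have "j = 2 + (j - 2)" using that unfolding atLeastAtMost_iff by arith
      then show ?thesis by (metis power_add)
    qed
    then have "g j x * t ^ j = t\<^sup>2 * (g j x * t ^ (j - 2))" if "j \<in> {3..n}" for j x
      using that by (simp add: mult.left_commute)
    then have "(\<Sum>j=3..n. g j x * t ^ j) = t\<^sup>2 * (\<Sum>j=3..n. g j x * t ^ (j - 2))" for x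
      unfolding sum_distrib_left by (intro sum.cong refl)
    then show ?thesis
      by (simp add: Q_def q_poly_def distrib_left)
  qed
  ultimately have "((\<lambda>t. Q t p) has_real_derivative 0) (at 0)" for p
    by simp
  then have "deriv (\<lambda>t. Q t p) 0 = 0" for p by (rule DERIV_imp_deriv)
  then have "partial_deriv None U (join_coord 0 p) = dir_deriv \<delta> f p" for p
    using dQ[of p 0] by simp
  moreover have "U (join_coord 0 p) = f p" for p
    by (simp add: U_def V_deriv q_poly_def)
  ultimately show "apply_diffop ?L V (join_coord 0 p) = 0"
    by (simp add: L[OF V] U_def[symmetric] V_0 c1[OF f])
qed

end

section \<open>Quadratic extensions\<close>

text \<open>Division by the monic quadratic leaves a remainder A + B x. If the polynomial evaluates
  to zero, so does the remainder, and \<open>inj\<close> kills it.\<close>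

lemma UP_kernel_eval_quadratic:
  fixes R :: "('r, 'm) ring_scheme" (structure) and S :: "('s, 'n) ring_scheme"
  assumes R: "cring R" and S: "cring S" and h: "h \<in> ring_hom R S" and s: "s \<in> carrier S"
    and c: "c1 \<in> carrier R" "c2 \<in> carrier R"
    and rel: "s \<otimes>\<^bsub>S\<^esub> s \<ominus>\<^bsub>S\<^esub> h c1 \<otimes>\<^bsub>S\<^esub> s \<oplus>\<^bsub>S\<^esub> h c2 = \<zero>\<^bsub>S\<^esub>"
    and inj: "\<And>A B. A \<in> carrier R \<Longrightarrow> B \<in> carrier R \<Longrightarrow> h A \<oplus>\<^bsub>S\<^esub> h B \<otimes>\<^bsub>S\<^esub> s = \<zero>\<^bsub>S\<^esub> \<Longrightarrow>
      A = \<zero>\<^bsub>R\<^esub> \<and> B = \<zero>\<^bsub>R\<^esub>"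
  shows "a_kernel (UP R) S (UnivPoly.eval R S h s) = Idl\<^bsub>UP R\<^esub>
       {up_ring.monom (UP R) \<one>\<^bsub>R\<^esub> 2 \<ominus>\<^bsub>UP R\<^esub> up_ring.monom (UP R) c1 1
          \<oplus>\<^bsub>UP R\<^esub> up_ring.monom (UP R) c2 0}"
proof -
  define P where "P = UP R"
  interpret UP_pre_univ_prop R S h P
    by (rule UP_pre_univ_propI[OF R S h], rule eq_reflection, rule P_def)
  interpret UP_univ_prop R S h P s "UnivPoly.eval R S h s"
    by unfold_locales (rule s)
  define g where "g = up_ring.monom P \<one> 2 \<ominus>\<^bsub>P\<^esub> up_ring.monom P c1 1 \<oplus>\<^bsub>P\<^esub> up_ring.monom P c2 0"
  let ?e = "UnivPoly.eval R S h s"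
  have gP: "g \<in> carrier P" using c by (simp add: g_def)
  have eg: "?e g = \<zero>\<^bsub>S\<^esub>"
  proof -
    have "?e g = s \<otimes>\<^bsub>S\<^esub> s \<ominus>\<^bsub>S\<^esub> h c1 \<otimes>\<^bsub>S\<^esub> s \<oplus>\<^bsub>S\<^esub> h c2"
      using c s by (simp add: g_def a_minus_def Eval_monom numeral_2_eq_2)
    then show ?thesis using rel by simp
  qed
  have ker: "x \<in> a_kernel P S ?e \<longleftrightarrow> x \<in> carrier P \<and> ?e x = \<zero>\<^bsub>S\<^esub>" for x
    unfolding a_kernel_def' by blast
  have "a_kernel P S ?e = Idl\<^bsub>P\<^esub> {g}"
  proof
    have "ideal (a_kernel P S ?e) P"
      by (rule ring_hom_ring.kernel_is_ideal) (rule ring_hom_ringI2, auto intro: P.ring_axioms S.ring_axioms)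
    moreover have "g \<in> a_kernel P S ?e"
      unfolding ker using gP eg ..
    ultimately show "Idl\<^bsub>P\<^esub> {g} \<subseteq> a_kernel P S ?e"
      by (intro P.genideal_minimal) simp_all
  next
    show "a_kernel P S ?e \<subseteq> Idl\<^bsub>P\<^esub> {g}"
    proof
      fix f assume "f \<in> a_kernel P S ?e"
      then have fP: "f \<in> carrier P" and ef: "?e f = \<zero>\<^bsub>S\<^esub>" unfolding ker by blast+
      have id: "ideal (Idl\<^bsub>P\<^esub> {g}) P" using gP by (intro P.genideal_ideal) auto
      have gI: "g \<in> Idl\<^bsub>P\<^esub> {g}" using gP by (intro P.genideal_self') auto
      show "f \<in> Idl\<^bsub>P\<^esub> {g}"
      proof (cases "\<one> = \<zero>")
        \<comment> \<open>Over the zero ring the quadratic is the zero polynomial and cannot be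
          divided by, but every polynomial is zero.\<close>
        case True
        then have "\<And>n. up_ring.coeff P f n = \<zero>"
          using R.one_zeroD coeff_closed[OF fP] by auto
        then have "f = \<zero>\<^bsub>P\<^esub>" using fP by (intro up_eqI) auto
        then show ?thesis using additive_subgroup.zero_closed[OF ideal.axioms(1)[OF id]] by simp
      next
        case False
        have coeffs: "up_ring.coeff P g n = (if n = 2 then \<one> else if n = 1 then \<ominus> c1 else if n = 0 then c2 else \<zero>)" for n
          using c by (simp add: g_def a_minus_def)
        have deg: "deg R g = 2"
        proof (rule antisym)
          show "deg R g \<le> 2" using gP coeffs by (intro deg_aboveI) auto
          show "2 \<le> deg R g" using False gP coeffs by (intro deg_belowI) auto
        qed
        have g0: "g \<noteq> \<zero>\<^bsub>P\<^esub>" using deg by auto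
        obtain q r k where q: "q \<in> carrier P" and r: "r \<in> carrier P"
          and f: "up_ring.coeff P g (deg R g) [^] (k::nat) \<odot>\<^bsub>P\<^esub> f = g \<otimes>\<^bsub>P\<^esub> q \<oplus>\<^bsub>P\<^esub> r"
          and rdeg: "r = \<zero>\<^bsub>P\<^esub> \<or> deg R r < deg R g"
          using long_div_theorem[OF gP fP g0] by metis
        \<comment> \<open>Division over a ring multiplies the dividend by a power of the leading
          coefficient, which is 1 here.\<close>
        have f': "f = g \<otimes>\<^bsub>P\<^esub> q \<oplus>\<^bsub>P\<^esub> r"
          using f fP by (simp add: deg coeffs)
        have rc: "up_ring.coeff P r n = \<zero>" if "n > 1" for n
          using rdeg deg deg_aboveD[OF _ r, of n] that by auto
        have r_eq: "r = up_ring.monom P (up_ring.coeff P r 0) 0 \<oplus>\<^bsub>P\<^esub> up_ring.monom P (up_ring.coeff P r 1) 1"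
        proof (rule up_eqI)
          fix n
          show "up_ring.coeff P r n = up_ring.coeff P (up_ring.monom P (up_ring.coeff P r 0) 0 \<oplus>\<^bsub>P\<^esub> up_ring.monom P (up_ring.coeff P r 1) 1) n"
            using r rc[of n] by (cases "n = 0"; cases "n = 1") auto
        qed (use r in auto)
        have "?e r = h (up_ring.coeff P r 0) \<oplus>\<^bsub>S\<^esub> h (up_ring.coeff P r 1) \<otimes>\<^bsub>S\<^esub> s"
          using r s by (subst r_eq) (simp add: Eval_monom)
        moreover have "?e r = \<zero>\<^bsub>S\<^esub>"
          using ef gP q r by (simp add: f' eg)
        ultimately have "up_ring.coeff P r 0 = \<zero> \<and> up_ring.coeff P r 1 = \<zero>"
          using inj[OF coeff_closed[OF r] coeff_closed[OF r]] by metis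
        then have "r = \<zero>\<^bsub>P\<^esub>" using r_eq by simp
        then show ?thesis using f' q gP gI ideal.I_r_closed[OF id] by simp
      qed
    qed
  qed
  then show ?thesis by (simp add: P_def g_def)
qed

text \<open>The first isomorphism theorem for evaluation at \<open>s\<close>. Generation is phrased
  through subrings because the image of evaluation is one, and because for operators it can then be
  checked by induction on their formation.\<close>

lemma quadratic_extension_iso:
  fixes R :: "('r, 'm) ring_scheme" (structure) and S :: "'s ring"
  assumes R: "cring R" and S: "cring S" and h: "h \<in> ring_hom R S" and s: "s \<in> carrier S"
    and c: "c1 \<in> carrier R" "c2 \<in> carrier R"
    and rel: "s \<otimes>\<^bsub>S\<^esub> s \<ominus>\<^bsub>S\<^esub> h c1 \<otimes>\<^bsub>S\<^esub> s \<oplus>\<^bsub>S\<^esub> h c2 = \<zero>\<^bsub>S\<^esub>"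
    and inj: "\<And>A B. A \<in> carrier R \<Longrightarrow> B \<in> carrier R \<Longrightarrow> h A \<oplus>\<^bsub>S\<^esub> h B \<otimes>\<^bsub>S\<^esub> s = \<zero>\<^bsub>S\<^esub> \<Longrightarrow>
      A = \<zero>\<^bsub>R\<^esub> \<and> B = \<zero>\<^bsub>R\<^esub>"
    and gen: "\<And>T. \<lbrakk>subring T S; h ` carrier R \<subseteq> T; s \<in> T\<rbrakk> \<Longrightarrow> carrier S \<subseteq> T"
  shows "S \<simeq> quadratic_extension R c1 c2"
proof -
  define P where "P = UP R"
  interpret UP_pre_univ_prop R S h P
    by (rule UP_pre_univ_propI[OF R S h], rule eq_reflection, rule P_def)
  interpret UP_univ_prop R S h P s "UnivPoly.eval R S h s"
    by unfold_locales (rule s)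
  let ?e = "UnivPoly.eval R S h s"
  have hr: "ring_hom_ring P S ?e"
    by (rule ring_hom_ringI2) (auto intro: P.ring_axioms S.ring_axioms)
  have "subring (?e ` carrier P) S"
    using ring_hom_ring.img_is_subring[OF hr P.carrier_is_subring] .
  moreover have "h ` carrier R \<subseteq> ?e ` carrier P"
  proof
    fix y assume "y \<in> h ` carrier R"
    then obtain r where "r \<in> carrier R" "y = h r" by auto
    then have "y = ?e (up_ring.monom P r 0)" "up_ring.monom P r 0 \<in> carrier P" using s by (simp_all add: Eval_monom)
    then show "y \<in> ?e ` carrier P" by blast
  qed
  moreover have "s \<in> ?e ` carrier P"
  proof -
    have "?e (up_ring.monom P \<one> 1) = s" using s by (simp add: Eval_monom)
    then show ?thesis by (metis image_eqI monom_closed R.one_closed)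
  qed
  ultimately have "?e ` carrier P = carrier S" using gen[of "?e ` carrier P"] by auto
  from ring_hom_ring.FactRing_iso[OF hr this]
  have "P Quot (a_kernel P S ?e) \<simeq> S" .
  moreover have "P Quot (a_kernel P S ?e) = quadratic_extension R c1 c2"
    unfolding quadratic_extension_def P_def
    by (rule arg_cong[OF UP_kernel_eval_quadratic[OF R S h s c rel inj], of "\<lambda>I. UP R Quot I"])
  \<comment> \<open>The isomorphism found goes from the quotient to S; reversing it requires that
    its source is a ring.\<close>
  moreover have "ring (P Quot (a_kernel P S ?e))"
    by (intro ideal.quotient_is_ring ring_hom_ring.kernel_is_ideal hr)
  ultimately show ?thesis using ring_iso_sym by metis
qed

section \<open>Khovanskii--Pukhlikov rings as quotients of the operator ring\<close>

lemma diffop_ring_simps [simp]: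
  "carrier diffop_ring = UNIV" "x \<otimes>\<^bsub>diffop_ring\<^esub> y = x * y" "x \<oplus>\<^bsub>diffop_ring\<^esub> y = x + y"
  "\<one>\<^bsub>diffop_ring\<^esub> = 1" "\<zero>\<^bsub>diffop_ring\<^esub> = 0"
  by (simp_all add: diffop_ring_def ring_of_type_algebra_def)

lemma cring_diffop_ring: "cring (diffop_ring :: 'k::finite diffop ring)"
  unfolding diffop_ring_def by (rule cring_from_type_algebra)

lemma ideal_Ann:
  fixes f :: "real^'k::finite \<Rightarrow> real"
  assumes "real_polynomial_function f"
  shows "ideal (Ann f) diffop_ring"
proof -
  interpret cring "diffop_ring :: 'k diffop ring" by (rule cring_diffop_ring)
  have inv: "\<ominus>\<^bsub>diffop_ring\<^esub> D = - D" for D :: "'k diffop"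
    using minus_equality[of "- D" D] by simp
  have ab: "D * E \<in> Ann f" if "E \<in> Ann f" for D E
    using that by (simp add: Ann_def apply_diffop_mult assms)
  have sg: "subgroup (Ann f) (add_monoid (diffop_ring :: 'k diffop ring))"
  proof (rule add.subgroupI)
    show "Ann f \<noteq> {}" using in_Ann[of 0 f] by force
    show "\<ominus>\<^bsub>diffop_ring\<^esub> D \<in> Ann f" if "D \<in> Ann f" for D
      using that by (simp add: inv in_Ann apply_diffop_uminus)
    show "D \<oplus>\<^bsub>diffop_ring\<^esub> E \<in> Ann f" if "D \<in> Ann f" "E \<in> Ann f" for D E
      using that by (simp add: in_Ann apply_diffop_add)
  qed simp
  show ?thesis
    by (rule idealI[OF ring_axioms sg]) (use ab in \<open>auto simp: mult.commute\<close>)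
qed

lemma cring_KP_ring: "real_polynomial_function f \<Longrightarrow> cring (KP_ring f)"
  unfolding KP_ring_def by (rule ideal.quotient_is_cring[OF ideal_Ann cring_diffop_ring])

lemma KP_class_hom: "real_polynomial_function f \<Longrightarrow> KP_class f \<in> ring_hom diffop_ring (KP_ring f)"
  using ideal.rcos_ring_hom[OF ideal_Ann, of f] by (simp add: KP_ring_def KP_class_def[abs_def])

lemma carrier_KP_ring: "carrier (KP_ring f) = range (KP_class f)"
  by (auto simp: KP_ring_def FactRing_def A_RCOSETS_def' KP_class_def)

lemma KP_class_hom_simps:
  assumes "real_polynomial_function f"
  shows "KP_class f D \<otimes>\<^bsub>KP_ring f\<^esub> KP_class f E = KP_class f (D * E)"
    and "KP_class f D \<oplus>\<^bsub>KP_ring f\<^esub> KP_class f E = KP_class f (D + E)"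
    and "\<one>\<^bsub>KP_ring f\<^esub> = KP_class f 1"
    and "\<zero>\<^bsub>KP_ring f\<^esub> = KP_class f 0"
  using ring_hom_mult[OF KP_class_hom[OF assms]] ring_hom_add[OF KP_class_hom[OF assms]]
    ring_hom_one[OF KP_class_hom[OF assms]]
    ring_hom_zero[OF KP_class_hom[OF assms] cring.axioms(1)[OF cring_diffop_ring]
      cring.axioms(1)[OF cring_KP_ring[OF assms]]]
  by simp_all

lemma KP_class_eq_iff:
  fixes f :: "real^'k::finite \<Rightarrow> real"
  assumes "real_polynomial_function f"
  shows "KP_class f D = KP_class f E \<longleftrightarrow> D - E \<in> Ann f"
proof -
  interpret cring "diffop_ring :: 'k diffop ring" by (rule cring_diffop_ring)
  have inv: "\<ominus>\<^bsub>diffop_ring\<^esub> D = - D" for D :: "'k diffop"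
    using minus_equality[of "- D" D] by simp
  show ?thesis
    using quotient_eq_iff_same_a_r_cos[OF ideal_Ann[OF assms], of D E]
    by (simp add: KP_class_def a_minus_def inv)
qed

lemma KP_class_minus:
  assumes "real_polynomial_function f"
  shows "KP_class f D \<ominus>\<^bsub>KP_ring f\<^esub> KP_class f E = KP_class f (D - E)"
proof -
  interpret cring "KP_ring f" by (rule cring_KP_ring[OF assms])
  have "\<ominus>\<^bsub>KP_ring f\<^esub> KP_class f E = KP_class f (- E)"
    using minus_equality[of "KP_class f (- E)" "KP_class f E"]
    by (simp add: KP_class_hom_simps[OF assms] carrier_KP_ring)
  then show ?thesis by (simp add: a_minus_def KP_class_hom_simps[OF assms])
qed

context push_pull_volumes
begin

theorem KP_ring_iso:
  "KP_ring V \<simeq> quadratic_extension (KP_ring f) (KP_class f c1) (KP_class f DF)"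
proof -
  \<comment> \<open>\<open>inv_into\<close> picks some representative of the class; that the choice
    does not matter is \<open>lift_diffop_in_Ann\<close>.\<close>
  define h where "h x = KP_class V (lift_diffop (inv_into UNIV (KP_class f) x))" for x
  have h: "h (KP_class f D) = KP_class V (lift_diffop D)" for D
  proof -
    define E where "E = inv_into UNIV (KP_class f) (KP_class f D)"
    have "KP_class f E = KP_class f D" unfolding E_def by (rule f_inv_into_f) simp
    then have "E - D \<in> Ann f" by (simp add: KP_class_eq_iff f)
    then have "lift_diffop E - lift_diffop D \<in> Ann V"
      by (metis lift_diffop_in_Ann lift_diffop_diff)
    then show ?thesis by (simp add: h_def E_def[symmetric] KP_class_eq_iff V)
  qed
  note KP = KP_class_hom_simps[OF f] KP_class_hom_simps[OF V]
  show ?thesis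
  proof (rule quadratic_extension_iso[where h = h and s = "KP_class V (dvar None)"])
    show "cring (KP_ring f)" "cring (KP_ring V)" by (simp_all add: cring_KP_ring f V)
    show "h \<in> ring_hom (KP_ring f) (KP_ring V)"
      by (rule ring_hom_memI)
         (auto simp: carrier_KP_ring KP h lift_diffop_mult lift_diffop_add)
    show "KP_class V (dvar None) \<in> carrier (KP_ring V)" "KP_class f c1 \<in> carrier (KP_ring f)"
      "KP_class f DF \<in> carrier (KP_ring f)"
      by (simp_all add: carrier_KP_ring)
    show "KP_class V (dvar None) \<otimes>\<^bsub>KP_ring V\<^esub> KP_class V (dvar None) \<ominus>\<^bsub>KP_ring V\<^esub>
        h (KP_class f c1) \<otimes>\<^bsub>KP_ring V\<^esub> KP_class V (dvar None) \<oplus>\<^bsub>KP_ring V\<^esub> h (KP_class f DF)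
        = \<zero>\<^bsub>KP_ring V\<^esub>"
      using quadratic_in_Ann by (simp add: h KP KP_class_minus V KP_class_eq_iff)
  next
    fix x y
    assume "x \<in> carrier (KP_ring f)" "y \<in> carrier (KP_ring f)"
      and xy: "h x \<oplus>\<^bsub>KP_ring V\<^esub> h y \<otimes>\<^bsub>KP_ring V\<^esub> KP_class V (dvar None) = \<zero>\<^bsub>KP_ring V\<^esub>"
    then obtain A B where x: "x = KP_class f A" and y: "y = KP_class f B"
      by (auto simp: carrier_KP_ring)
    have "lift_diffop A + lift_diffop B * dvar None \<in> Ann V"
      using xy by (simp add: x y h KP KP_class_eq_iff V)
    then show "x = \<zero>\<^bsub>KP_ring f\<^esub> \<and> y = \<zero>\<^bsub>KP_ring f\<^esub>"
      by (simp add: x y KP KP_class_eq_iff f lift_diffop_in_Ann_iff)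
  next
    fix T
    assume T: "subring T (KP_ring V)" "h ` carrier (KP_ring f) \<subseteq> T" "KP_class V (dvar None) \<in> T"
    have lift: "KP_class V (lift_diffop D) \<in> T" for D
      using T(2) h by (force simp: carrier_KP_ring)
    have "KP_class V D \<in> T" for D
    proof (induction D rule: diffop_induct)
      case (const c)
      show ?case using lift[of "Poly_Mapping.single 0 c"] by (simp add: lift_diffop_const)
    next
      case (var i)
      \<comment> \<open>The variable \<open>None\<close> is covered by the assumption on T, a
        variable \<open>Some j\<close> by lifting the variable j.\<close>
      show ?case using T(3) lift[of "dvar (the i)"] by (cases i) (auto simp: lift_diffop_dvar)
    next
      case (add D E)
      show ?case using subringE(7)[OF T(1) add] by (simp add: KP)
    next
      case (mult D E)
      show ?case using subringE(6)[OF T(1) mult] by (simp add: KP)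
    qed
    then show "carrier (KP_ring V) \<subseteq> T" by (auto simp: carrier_KP_ring)
  qed
qed

end

section \<open>Coordinates on Grothendieck groups\<close>

text \<open>The zero of Minkowski addition is a point, which is analogous to P only if P is a point;
  so no zero can be assumed.\<close>

locale add_semigroup_set =
  fixes S :: "'a::comm_monoid_add set"
  assumes add_closed: "a \<in> S \<Longrightarrow> b \<in> S \<Longrightarrow> a + b \<in> S" and nonempty: "S \<noteq> {}"
begin

definition cls :: "'a \<Rightarrow> 'a \<Rightarrow> ('a \<times> 'a) set" where
  "cls a b = groth_rel S `` {(a, b)}"

lemma groth_rel_iff: "((a, b), (c, d)) \<in> groth_rel S \<longleftrightarrow>
    a \<in> S \<and> b \<in> S \<and> c \<in> S \<and> d \<in> S \<and> (\<exists>e\<in>S. a + d + e = c + b + e)"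
  by (simp add: groth_rel_def)

lemma equiv_groth_rel: "equiv (S \<times> S) (groth_rel S)"
proof (rule equivI)
  show "refl_on (S \<times> S) (groth_rel S)"
    using nonempty by (auto simp: refl_on_def groth_rel_iff)
  show "groth_rel S \<subseteq> (S \<times> S) \<times> S \<times> S" by (auto simp: groth_rel_def)
  show "sym (groth_rel S)"
    by (auto simp: sym_def groth_rel_iff) metis
  show "trans (groth_rel S)"
  proof (rule transI, clarsimp simp: groth_rel_iff)
    fix a b c d c' d' e e'
    assume S: "c \<in> S" "d \<in> S" "e \<in> S" "e' \<in> S"
      and 1: "a + d + e = c + b + e" and 2: "c + d' + e' = c' + d + e'"
    have "a + d' + (d + e + (c + e')) = (a + d + e) + (c + d' + e')" by (simp add: ac_simps)
    also have "\<dots> = c' + b + (d + e + (c + e'))" unfolding 1 2 by (simp add: ac_simps)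
    finally show "\<exists>e\<in>S. a + d' + e = c' + b + e" using S add_closed by blast
  qed
qed

lemma cls_eq_iff:
  assumes "a \<in> S" "b \<in> S" "c \<in> S" "d \<in> S"
  shows "cls a b = cls c d \<longleftrightarrow> (\<exists>e\<in>S. a + d + e = c + b + e)"
  unfolding cls_def using eq_equiv_class_iff[OF equiv_groth_rel, of "(a, b)" "(c, d)"] assms
  by (simp add: groth_rel_iff)

lemma carrier_grothendieck: "carrier (grothendieck S) = {cls a b | a b. a \<in> S \<and> b \<in> S}"
  by (auto simp: grothendieck_def quotient_def cls_def)

lemma one_grothendieck: "a \<in> S \<Longrightarrow> \<one>\<^bsub>grothendieck S\<^esub> = cls a a"
proof -
  assume a: "a \<in> S"
  have "((a', a'), x) \<in> groth_rel S \<Longrightarrow> ((a, a), x) \<in> groth_rel S" for a' x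
    using a by (cases x) (auto simp: groth_rel_iff add.assoc intro: add_closed, metis add.left_commute add.commute add_closed)
  then have "groth_rel S `` {(a, a) | a. a \<in> S} = cls a a"
    unfolding cls_def using a by blast
  then show ?thesis by (simp add: grothendieck_def)
qed

text \<open>The product in the record is formed from whole classes, so independence of the
  representatives has to be proved.\<close>

lemma mult_grothendieck:
  assumes "a \<in> S" "b \<in> S" "c \<in> S" "d \<in> S"
  shows "cls a b \<otimes>\<^bsub>grothendieck S\<^esub> cls c d = cls (a + c) (b + d)"
proof -
  have *: "((a + c, b + d), (a' + c', b' + d')) \<in> groth_rel S"
    if ab: "((a, b), (a', b')) \<in> groth_rel S" and cd: "((c, d), (c', d')) \<in> groth_rel S" for a' b' c' d'
  proof -
    obtain e e' where e: "e \<in> S" "e' \<in> S" "a + b' + e = a' + b + e" "c + d' + e' = c' + d + e'"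
      using ab cd by (auto simp: groth_rel_iff)
    have "a + c + (b' + d') + (e + e') = (a + b' + e) + (c + d' + e')" by (simp add: ac_simps)
    also have "\<dots> = a' + c' + (b + d) + (e + e')" unfolding e by (simp add: ac_simps)
    finally show ?thesis using ab cd e add_closed by (auto simp: groth_rel_iff)
  qed
  have self: "(a, b) \<in> cls a b" "(c, d) \<in> cls c d"
    using assms nonempty by (auto simp: cls_def groth_rel_iff)
  have "groth_rel S `` {(x + z, y + w) | x y z w. (x, y) \<in> cls a b \<and> (z, w) \<in> cls c d}
    = cls (a + c) (b + d)" (is "?L = _")
  proof
    show "?L \<subseteq> cls (a + c) (b + d)"
    proof
      fix u assume "u \<in> ?L"
      then obtain x y z w where "((a, b), (x, y)) \<in> groth_rel S" "((c, d), (z, w)) \<in> groth_rel S"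
        and u: "((x + z, y + w), u) \<in> groth_rel S"
        unfolding cls_def by blast
      from *[OF this(1,2)] u show "u \<in> cls (a + c) (b + d)"
        using equiv_groth_rel unfolding cls_def by (meson Image_singleton_iff equivE transE)
    qed
    show "cls (a + c) (b + d) \<subseteq> ?L"
      using self unfolding cls_def by blast
  qed
  then show ?thesis by (simp add: grothendieck_def)
qed

lemma comm_group_grothendieck: "comm_group (grothendieck S)"
proof (rule comm_groupI)
  obtain s where s: "s \<in> S" using nonempty by blast
  show "\<one>\<^bsub>grothendieck S\<^esub> \<in> carrier (grothendieck S)"
    using s one_grothendieck by (auto simp: carrier_grothendieck)
  fix x assume "x \<in> carrier (grothendieck S)"
  then obtain a b where x: "x = cls a b" "a \<in> S" "b \<in> S" by (auto simp: carrier_grothendieck)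
  show "\<one>\<^bsub>grothendieck S\<^esub> \<otimes>\<^bsub>grothendieck S\<^esub> x = x"
    using s x by (simp add: one_grothendieck[OF s] mult_grothendieck cls_eq_iff add_closed)
      (metis add.assoc add.commute)
  have "cls b a \<otimes>\<^bsub>grothendieck S\<^esub> x = \<one>\<^bsub>grothendieck S\<^esub>"
    using s x by (simp add: one_grothendieck[OF s] mult_grothendieck cls_eq_iff add_closed)
      (metis add.assoc add.commute)
  then show "\<exists>y\<in>carrier (grothendieck S). y \<otimes>\<^bsub>grothendieck S\<^esub> x = \<one>\<^bsub>grothendieck S\<^esub>"
    using x by (auto simp: carrier_grothendieck)
  fix y assume "y \<in> carrier (grothendieck S)"
  then obtain c d where y: "y = cls c d" "c \<in> S" "d \<in> S" by (auto simp: carrier_grothendieck)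
  show "x \<otimes>\<^bsub>grothendieck S\<^esub> y \<in> carrier (grothendieck S)"
    using x y add_closed by (auto simp: mult_grothendieck carrier_grothendieck)
  show "x \<otimes>\<^bsub>grothendieck S\<^esub> y = y \<otimes>\<^bsub>grothendieck S\<^esub> x"
    using x y by (simp add: mult_grothendieck add.commute)
  fix z assume "z \<in> carrier (grothendieck S)"
  then obtain e f where z: "z = cls e f" "e \<in> S" "f \<in> S" by (auto simp: carrier_grothendieck)
  show "x \<otimes>\<^bsub>grothendieck S\<^esub> y \<otimes>\<^bsub>grothendieck S\<^esub> z = x \<otimes>\<^bsub>grothendieck S\<^esub> (y \<otimes>\<^bsub>grothendieck S\<^esub> z)"
    using x y z by (simp add: mult_grothendieck add_closed add.assoc)
qed

lemma groth_incl_closed: "a \<in> S \<Longrightarrow> groth_incl S a \<in> carrier (grothendieck S)"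
  unfolding groth_incl_def cls_def[symmetric] carrier_grothendieck using add_closed by blast

lemma groth_incl_add:
  "a \<in> S \<Longrightarrow> b \<in> S \<Longrightarrow>
    groth_incl S (a + b) = groth_incl S a \<otimes>\<^bsub>grothendieck S\<^esub> groth_incl S b"
  by (simp add: groth_incl_def cls_def[symmetric] mult_grothendieck add_closed ac_simps)

text \<open>Reads (a - b) + b = a. It expresses an arbitrary class, in particular a basis element,
  through classes of actual members of S.\<close>

lemma cls_mult_groth_incl:
  assumes "a \<in> S" "b \<in> S"
  shows "cls a b \<otimes>\<^bsub>grothendieck S\<^esub> groth_incl S b = groth_incl S a"
proof -
  have "cls (a + (b + b)) (b + b) = cls (a + a) a"
    using assms by (subst cls_eq_iff) (auto simp: ac_simps add_closed)
  then show ?thesis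
    using assms by (simp add: groth_incl_def cls_def[symmetric] mult_grothendieck add_closed)
qed

end

section \<open>Coordinates with respect to a lattice basis\<close>

lemma (in comm_group) lattice_comb_add:
  fixes b :: "'k::finite \<Rightarrow> 'a"
  assumes "\<And>i. b i \<in> carrier G"
  shows "lattice_comb G b (\<lambda>i. c i + d i) = lattice_comb G b c \<otimes> lattice_comb G b d"
  unfolding lattice_comb_def using assms
  by (simp add: int_pow_mult finprod_multf)

lemma (in comm_group) lattice_comb_unit:
  fixes b :: "'k::finite \<Rightarrow> 'a"
  assumes "\<And>i. b i \<in> carrier G"
  shows "lattice_comb G b (\<lambda>j. if j = i then 1 else 0) = b i"
proof -
  have "lattice_comb G b (\<lambda>j. if j = i then 1 else 0) = (\<Otimes>j\<in>UNIV. if i = j then b j else \<one>)"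
    unfolding lattice_comb_def using assms
    by (intro finprod_cong') (auto simp: int_pow_1)
  also have "\<dots> = b i" using assms by (intro finprod_singleton) auto
  finally show ?thesis .
qed

lemma lattice_coords_comb:
  assumes "lattice_basis G b" "lattice_comb G b c \<in> carrier G"
  shows "lattice_coords G b (lattice_comb G b c) = (\<chi> i. of_int (c i))"
proof -
  have "(THE d. lattice_comb G b c = lattice_comb G b d) = c"
    using assms by (intro the1_equality) (auto simp: lattice_basis_def)
  then show ?thesis by (simp add: lattice_coords_def)
qed

lemma lattice_basis_obtain:
  assumes "lattice_basis G b" "x \<in> carrier G"
  obtains c where "x = lattice_comb G b c" "lattice_coords G b x = (\<chi> i. of_int (c i))"
  using assms lattice_coords_comb[OF assms(1)] unfolding lattice_basis_def by metis

lemma lattice_coords_mult: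
  assumes "comm_group G" "lattice_basis G b" "x \<in> carrier G" "y \<in> carrier G"
  shows "lattice_coords G b (x \<otimes>\<^bsub>G\<^esub> y) = lattice_coords G b x + lattice_coords G b y"
proof -
  interpret comm_group G by fact
  obtain c where c: "x = lattice_comb G b c" "lattice_coords G b x = (\<chi> i. of_int (c i))"
    using lattice_basis_obtain[OF assms(2,3)] .
  obtain d where d: "y = lattice_comb G b d" "lattice_coords G b y = (\<chi> i. of_int (d i))"
    using lattice_basis_obtain[OF assms(2,4)] .
  have bi: "\<And>i. b i \<in> carrier G" using assms(2) by (simp add: lattice_basis_def)
  have "x \<otimes>\<^bsub>G\<^esub> y = lattice_comb G b (\<lambda>i. c i + d i)"
    by (simp add: lattice_comb_add[OF bi] c(1) d(1))
  then show ?thesis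
    using lattice_coords_comb[OF assms(2), of "\<lambda>i. c i + d i"] m_closed[OF assms(3,4)]
    by (simp add: c(2) d(2) vec_eq_iff)
qed

context add_semigroup_set
begin

context
  fixes b :: "'k::finite \<Rightarrow> ('a \<times> 'a) set"
  assumes basis: "lattice_basis (grothendieck S) b"
begin

lemma poly_coords_add:
  "a \<in> S \<Longrightarrow> c \<in> S \<Longrightarrow> poly_coords S b (a + c) = poly_coords S b a + poly_coords S b c"
  by (simp add: poly_coords_def groth_incl_add groth_incl_closed
      lattice_coords_mult[OF comm_group_grothendieck basis])

text \<open>Hence the floor in \<open>poly_diffop\<close> loses nothing: coordinates in a lattice
  basis come from integer exponents.\<close>

lemma floor_poly_coords:
  assumes "a \<in> S"
  shows "of_int \<lfloor>poly_coords S b a $ i\<rfloor> = poly_coords S b a $ i"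
proof -
  obtain c where "lattice_coords (grothendieck S) b (groth_incl S a) = (\<chi> i. of_int (c i))"
    using lattice_basis_obtain[OF basis groth_incl_closed[OF assms]] .
  then show ?thesis by (simp add: poly_coords_def)
qed

text \<open>Each basis element is a difference of two members of S, so each axis vector is a
  difference of two coordinate vectors. Together with closure under sums this makes the coordinates
  Zariski dense.\<close>

lemma span_poly_coords: "span (poly_coords S b ` S) = UNIV"
proof -
  interpret comm_group "grothendieck S" by (rule comm_group_grothendieck)
  have "axis i 1 \<in> span (poly_coords S b ` S)" for i
  proof -
    have bi: "\<And>i. b i \<in> carrier (grothendieck S)" using basis by (simp add: lattice_basis_def)
    obtain x y where xy: "b i = cls x y" "x \<in> S" "y \<in> S"
      using bi[of i] by (auto simp: carrier_grothendieck)
    have "lattice_coords (grothendieck S) b (b i) = axis i 1"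
      using lattice_coords_comb[OF basis, of "\<lambda>j. if j = i then 1 else 0"] bi
      by (simp add: lattice_comb_unit[OF bi] vec_eq_iff axis_def)
    then have "axis i 1 + poly_coords S b y = poly_coords S b x"
      using lattice_coords_mult[OF comm_group_grothendieck basis bi groth_incl_closed[OF xy(3)], of i]
        cls_mult_groth_incl[OF xy(2,3)] xy(1) by (simp add: poly_coords_def)
    then have "axis i 1 = poly_coords S b x - poly_coords S b y" by (simp add: algebra_simps)
    then show ?thesis using xy by (auto intro!: span_diff intro: span_base)
  qed
  then have "(\<Sum>i\<in>UNIV. (x $ i) *\<^sub>R axis i 1) \<in> span (poly_coords S b ` S)" for x :: "real^'k"
    by (intro span_sum span_scale)
  moreover have "(\<Sum>i\<in>UNIV. (x $ i) *\<^sub>R axis i 1) = x" for x :: "real^'k"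
    by (simp add: vec_eq_iff axis_def if_distrib[of "\<lambda>x. _ * x"] cong: if_cong)
  ultimately show ?thesis by (metis UNIV_eq_I)
qed

end

end

section \<open>Zariski density of a spanning semigroup\<close>

lemma real_polynomial_function_eq_0:
  fixes f :: "real \<Rightarrow> real"
  assumes "real_polynomial_function f" "infinite {x. f x = 0}"
  shows "f x = 0"
proof -
  obtain a n where f: "f = (\<lambda>x. \<Sum>i\<le>n. a i * x ^ i)"
    using assms(1) real_polynomial_function_iff_sum by auto
  then have "\<forall>i\<le>n. a i = 0"
    using polyfun_finite_roots[of a n] assms(2) by auto
  then show ?thesis by (simp add: f)
qed

text \<open>In the direction of an element of \<open>T\<close> the polynomial has infinitely many zeros, so it vanishes on
  the whole line; the lines in all these directions sweep out the span.\<close>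

lemma real_polynomial_function_eq_0_semigroup:
  fixes f :: "'a::euclidean_space \<Rightarrow> real"
  assumes f: "real_polynomial_function f"
    and T: "span T = UNIV" "\<And>x y. x \<in> T \<Longrightarrow> y \<in> T \<Longrightarrow> x + y \<in> T"
    and 0: "\<And>x. x \<in> T \<Longrightarrow> f (p + x) = 0"
  shows "f x = 0"
proof -
  have line: "f (y + t *\<^sub>R a) = 0" if "\<And>m::nat. f (y + real m *\<^sub>R a) = 0" for y a t
  proof (rule real_polynomial_function_eq_0[OF real_polynomial_function_line[OF f]])
    have "range real \<subseteq> {t. f (y + t *\<^sub>R a) = 0}" using that by auto
    then show "infinite {t. f (y + t *\<^sub>R a) = 0}"
      using infinite_super range_inj_infinite inj_of_nat by metis
  qed
  have mult: "x + real m *\<^sub>R a \<in> T" if "x \<in> T" "a \<in> T" for x a m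
  proof (induction m)
    case (Suc m)
    have "x + real (Suc m) *\<^sub>R a = (x + real m *\<^sub>R a) + a" by (simp add: algebra_simps)
    then show ?case using T(2)[OF Suc that(2)] by (simp only:)
  qed (use that in simp)
  \<comment> \<open>The base point y stays quantified, so that a step along \<open>a\<close> may use
    the hypothesis at every y + m a, which is again in T.\<close>
  have "\<forall>y\<in>T. f (p + y + v) = 0" if "v \<in> span T" for v
    using that
  proof (induction rule: span_induct_alt)
    case base
    show ?case using 0 by simp
  next
    case (step c a v)
    show ?case
    proof
      fix y assume y: "y \<in> T"
      have "f ((p + y + v) + real m *\<^sub>R a) = 0" for m
        using step.IH mult[OF y step.hyps(1), of m] by (metis add.assoc add.commute add.left_commute)
      from line[OF this, of c] show "f (p + y + (c *\<^sub>R a + v)) = 0" by (simp add: ac_simps)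
    qed
  qed
  moreover obtain y where "y \<in> T"
  proof (cases "T = {}")
    case True
    then have "(UNIV :: 'a set) = {0}" using T(1) by simp
    then show ?thesis using UNIV_not_singleton by blast
  qed blast
  ultimately have "f (p + y + (x - (p + y))) = 0" using T(1) by blast
  then show ?thesis by simp
qed

section \<open>Normal fans and Minkowski sums\<close>

definition max_face :: "'a::euclidean_space set \<Rightarrow> 'a \<Rightarrow> 'a set" where
  "max_face A u = {x\<in>A. \<forall>y\<in>A. u \<bullet> y \<le> u \<bullet> x}"

text \<open>For a polytope, the cone of the normal fan with \<open>u\<close> in its relative
  interior. Indexing the fan by functionals turns equality of fans into equality of functions, and
  corresponding faces belong to the same \<open>u\<close>.\<close>

definition max_cone :: "'a::euclidean_space set \<Rightarrow> 'a \<Rightarrow> 'a set" where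
  "max_cone A u = normal_cone A (max_face A u)"

lemma max_face_subset: "max_face A u \<subseteq> A"
  by (auto simp: max_face_def)

lemma max_faceD: "x \<in> max_face A u \<Longrightarrow> y \<in> A \<Longrightarrow> u \<bullet> y \<le> u \<bullet> x"
  by (auto simp: max_face_def)

lemma max_face_nonempty:
  assumes "compact A" "A \<noteq> {}"
  shows "max_face A u \<noteq> {}"
proof -
  have "continuous_on A (\<lambda>x. u \<bullet> x)" by (intro continuous_intros)
  from continuous_attains_sup[OF assms this] show ?thesis by (auto simp: max_face_def)
qed

lemma max_cone_iff: "w \<in> max_cone A u \<longleftrightarrow> max_face A u \<subseteq> max_face A w"
  by (auto simp: max_cone_def normal_cone_def max_face_def)

lemma max_cone_refl: "u \<in> max_cone A u"
  by (simp add: max_cone_iff)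

lemma max_face_eq_iff: "max_cone A u = max_cone A w \<longleftrightarrow> max_face A u = max_face A w"
  by (metis max_cone_def max_cone_iff max_cone_refl subset_antisym)

lemma max_face_plus:
  assumes "compact A" "A \<noteq> {}" "compact B" "B \<noteq> {}"
  shows "max_face (A + B) u = max_face A u + max_face B u"
proof
  show "max_face A u + max_face B u \<subseteq> max_face (A + B) u"
    by (auto simp: max_face_def set_plus_def inner_add_right intro!: add_mono)
  show "max_face (A + B) u \<subseteq> max_face A u + max_face B u"
  proof
    fix z assume z: "z \<in> max_face (A + B) u"
    then obtain x y where xy: "z = x + y" "x \<in> A" "y \<in> B"
      by (auto simp: max_face_def set_plus_def)
    have "u \<bullet> x' \<le> u \<bullet> x" if "x' \<in> A" for x'
      using max_faceD[OF z, of "x' + y"] that xy by (simp add: inner_add_right set_plus_intro)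
    moreover have "u \<bullet> y' \<le> u \<bullet> y" if "y' \<in> B" for y'
      using max_faceD[OF z, of "x + y'"] that xy by (simp add: inner_add_right set_plus_intro)
    ultimately show "z \<in> max_face A u + max_face B u"
      using xy by (auto simp: max_face_def)
  qed
qed

text \<open>The fan of a Minkowski sum is the common refinement of the fans: fixing a maximizer in
  one summand isolates the condition on the other.\<close>

lemma max_cone_plus:
  assumes "compact A" "A \<noteq> {}" "compact B" "B \<noteq> {}"
  shows "max_cone (A + B) u = max_cone A u \<inter> max_cone B u"
proof
  show "max_cone A u \<inter> max_cone B u \<subseteq> max_cone (A + B) u"
    unfolding max_cone_iff subset_iff Int_iff max_face_plus[OF assms]
    by (meson set_plus_mono2 subset_iff)
  show "max_cone (A + B) u \<subseteq> max_cone A u \<inter> max_cone B u"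
  proof
    fix w assume "w \<in> max_cone (A + B) u"
    then have w: "w \<bullet> (a + b) \<le> w \<bullet> (x + y)"
      if "x \<in> max_face A u" "y \<in> max_face B u" "a \<in> A" "b \<in> B" for a b x y
      using that assms by (auto simp: max_cone_def normal_cone_def max_face_plus)
    obtain x0 y0 where 0: "x0 \<in> max_face A u" "y0 \<in> max_face B u"
      using max_face_nonempty[OF assms(1,2), of u] max_face_nonempty[OF assms(3,4), of u] by blast
    have "w \<bullet> a \<le> w \<bullet> x" if "x \<in> max_face A u" "a \<in> A" for a x
      using w[OF that(1) 0(2) that(2), of y0] 0 max_face_subset[of B u] by (auto simp: inner_add_right)
    moreover have "w \<bullet> b \<le> w \<bullet> y" if "y \<in> max_face B u" "b \<in> B" for b y
      using w[OF 0(1) that(1) _ that(2), of x0] 0 max_face_subset[of A u] by (auto simp: inner_add_right)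
    ultimately show "w \<in> max_cone A u \<inter> max_cone B u"
      by (auto simp: max_cone_def normal_cone_def)
  qed
qed

text \<open>Faces of a polytope are exposed; the normal of an exposing hyperplane serves as
  u.\<close>

lemma face_eq_max_face:
  assumes "polytope P" "F face_of P" "F \<noteq> {}"
  obtains u where "F = max_face P u"
proof -
  have "F exposed_face_of P"
    using assms exposed_face_of_polyhedron polytope_imp_polyhedron by blast
  then obtain a b where ab: "P \<subseteq> {x. a \<bullet> x \<le> b}" "F = P \<inter> {x. a \<bullet> x = b}"
    by (auto simp: exposed_face_of_def)
  have "F = max_face P a"
  proof
    show "F \<subseteq> max_face P a" using ab by (auto simp: max_face_def)
    obtain y where y: "y \<in> P" "a \<bullet> y = b" using ab assms(3) by blast
    show "max_face P a \<subseteq> F"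
    proof
      fix x assume x: "x \<in> max_face P a"
      then have "x \<in> P" "a \<bullet> x \<le> b" using ab(1) max_face_subset by blast+
      with max_faceD[OF x y(1)] y(2) show "x \<in> F" unfolding ab(2) by simp
    qed
  qed
  then show ?thesis by (rule that)
qed

lemma max_face_face_of:
  assumes "polytope P" "P \<noteq> {}"
  shows "max_face P u face_of P"
proof -
  obtain x where x: "x \<in> max_face P u"
    using max_face_nonempty assms polytope_imp_compact by blast
  have "max_face P u = P \<inter> {y. u \<bullet> y = u \<bullet> x}"
    using x by (auto simp: max_face_def intro: order_antisym)
  also have "\<dots> face_of P"
    using assms x by (intro face_of_Int_supporting_hyperplane_le polytope_imp_convex)
      (auto simp: max_face_def)
  finally show ?thesis .
qed

lemma normal_fan_eq:
  assumes "polytope P" "P \<noteq> {}"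
  shows "normal_fan P = range (max_cone P)"
proof
  show "normal_fan P \<subseteq> range (max_cone P)"
    using face_eq_max_face[OF assms(1)] by (force simp: normal_fan_def max_cone_def)
  show "range (max_cone P) \<subseteq> normal_fan P"
    using max_face_face_of[OF assms] max_face_nonempty[OF polytope_imp_compact[OF assms(1)] assms(2)]
    by (auto simp: normal_fan_def max_cone_def)
qed

text \<open>Recovers the indexing by functionals from the bare set of cones: among those containing
  \<open>u\<close>, one is contained in all others.\<close>

lemma max_cone_eq_Inter:
  assumes "polytope P" "P \<noteq> {}"
  shows "max_cone P u = \<Inter>{C\<in>normal_fan P. u \<in> C}"
  using assms max_cone_refl[of u P] by (auto simp: normal_fan_eq max_cone_iff)

lemma analogous_iff:
  "analogous A B \<longleftrightarrow>
    polytope A \<and> A \<noteq> {} \<and> polytope B \<and> B \<noteq> {} \<and> max_cone A = max_cone B"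
proof -
  have "normal_fan A = normal_fan B \<longleftrightarrow> max_cone A = max_cone B"
    if "polytope A" "A \<noteq> {}" "polytope B" "B \<noteq> {}"
  proof
    assume "normal_fan A = normal_fan B"
    then show "max_cone A = max_cone B"
      unfolding fun_eq_iff max_cone_eq_Inter[OF that(1,2)] max_cone_eq_Inter[OF that(3,4)]
      by (simp only: simp_thms)
  qed (simp only: normal_fan_eq that not_False_eq_True)
  then show ?thesis unfolding analogous_def by blast
qed

section \<open>Minkowski sums of analogous lattice polytopes and corresponding faces\<close>

lemma polytope_set_plus:
  fixes A B :: "'a::euclidean_space set"
  assumes "polytope A" "polytope B"
  shows "polytope (A + B)"
proof -
  obtain V W where "finite V" "A = convex hull V" "finite W" "B = convex hull W"
    using assms by (auto simp: polytope_def)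
  then show ?thesis
    unfolding polytope_def by (metis convex_hull_set_plus finite_set_plus)
qed

lemma set_plus_nonempty: "A \<noteq> {} \<Longrightarrow> B \<noteq> {} \<Longrightarrow> A + B \<noteq> {}"
  by (auto simp: set_plus_def)

lemma compact_set_plus:
  fixes A B :: "'a::real_normed_vector set"
  assumes "compact A" "compact B" shows "compact (A + B)"
proof -
  have "A + B = {x + y |x y. x \<in> A \<and> y \<in> B}" by (auto simp: set_plus_def)
  then show ?thesis using compact_sums[OF assms] by simp
qed

lemma analogous_set_plus:
  assumes "analogous A C" "analogous B C"
  shows "analogous (A + B) C"
proof -
  have "max_cone (A + B) u = max_cone C u" for u
    using assms max_cone_plus[of A B u] by (simp add: analogous_iff polytope_imp_compact)
  then show ?thesis
    using assms by (auto simp: analogous_iff polytope_set_plus dest: set_plus_nonempty)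
qed

text \<open>A segment around one summand, translated by the other, would be a segment around v. This
  keeps the vertices of sums of lattice polytopes integral.\<close>

lemma extreme_point_of_set_plus:
  fixes A B :: "'a::euclidean_space set"
  assumes "v extreme_point_of (A + B)"
  obtains x y where "v = x + y" "x extreme_point_of A" "y extreme_point_of B"
proof -
  have v: "v \<in> A + B" "\<And>a b. a \<in> A + B \<Longrightarrow> b \<in> A + B \<Longrightarrow> v \<notin> open_segment a b"
    using assms by (auto simp: extreme_point_of_def)
  then obtain x y where xy: "v = x + y" "x \<in> A" "y \<in> B" by (auto simp: set_plus_def)
  have "x \<notin> open_segment a b" if "a \<in> A" "b \<in> A" for a b
    using v(2)[of "y + a" "y + b"] that xy
    by (metis add.commute open_segment_translation_eq set_plus_intro)
  moreover have "y \<notin> open_segment a b" if "a \<in> B" "b \<in> B" for a b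
    using v(2)[of "x + a" "x + b"] that xy
    by (metis open_segment_translation_eq set_plus_intro)
  ultimately show ?thesis using that xy by (auto simp: extreme_point_of_def)
qed

lemma lattice_polytope_set_plus:
  fixes A B :: "(real^'n) set"
  assumes "lattice_polytope A" "lattice_polytope B"
  shows "lattice_polytope (A + B)"
proof -
  have "v $ i \<in> \<int>" if "v extreme_point_of (A + B)" for i and v :: "real^'n"
    using extreme_point_of_set_plus[OF that] assms
    by (metis Ints_add lattice_polytope_def vector_add_component)
  then show ?thesis
    using assms by (simp add: lattice_polytope_def polytope_set_plus set_plus_nonempty)
qed

lemma S_P_add: "A \<in> S_P P \<Longrightarrow> B \<in> S_P P \<Longrightarrow> A + B \<in> S_P P"
  by (simp add: S_P_def lattice_polytope_set_plus analogous_set_plus)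

lemma S_P_self: "lattice_polytope P \<Longrightarrow> P \<in> S_P P"
  by (simp add: S_P_def lattice_polytope_def analogous_iff)

text \<open>\<open>THE\<close> is legitimate because a normal cone determines its face.\<close>

lemma corr_face_max_face:
  assumes "analogous A P" 
  shows "corr_face P (max_face P u) A = max_face A u"
proof -
  have A: "polytope A" "A \<noteq> {}" "max_cone A = max_cone P" using assms by (auto simp: analogous_iff)
  show ?thesis
    unfolding corr_face_def
  proof (rule the_equality)
    show "max_face A u face_of A \<and> max_face A u \<noteq> {} \<and>
        normal_cone A (max_face A u) = normal_cone P (max_face P u)"
      using max_face_face_of[OF A(1,2)] max_face_nonempty[OF polytope_imp_compact[OF A(1)] A(2)] A(3)
      by (metis max_cone_def)
    fix F' assume F': "F' face_of A \<and> F' \<noteq> {} \<and> normal_cone A F' = normal_cone P (max_face P u)"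
    then obtain w where w: "F' = max_face A w" using face_eq_max_face[OF A(1)] by metis
    then have "max_cone A w = max_cone A u" using F' A(3) by (metis max_cone_def)
    then show "F' = max_face A u" using w by (simp add: max_face_eq_iff)
  qed
qed

text \<open>Farkas' lemma: otherwise separating \<open>u\<close> from the cone of active normals yields a feasible
  direction at \<open>v\<close> along which \<open>u\<close> increases.\<close>

lemma max_face_polyhedron_cone:
  fixes a :: "'i \<Rightarrow> 'a::euclidean_space"
  assumes "finite J" and v: "\<And>j. j \<in> J \<Longrightarrow> a j \<bullet> v \<le> b j"
    and max: "\<And>x. (\<And>j. j \<in> J \<Longrightarrow> a j \<bullet> x \<le> b j) \<Longrightarrow> u \<bullet> x \<le> u \<bullet> v"
  shows "u \<in> convex_cone hull (a ` {j\<in>J. a j \<bullet> v = b j})"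
proof (rule ccontr)
  let ?K = "convex_cone hull (a ` {j\<in>J. a j \<bullet> v = b j})"
  assume "u \<notin> ?K"
  then obtain d \<beta> where d: "d \<bullet> u < \<beta>" "\<And>x. x \<in> ?K \<Longrightarrow> d \<bullet> x > \<beta>"
    using separating_hyperplane_closed_point[of ?K u] assms(1)
    by (auto simp: convex_convex_cone_hull closed_convex_cone_hull)
  have "\<beta> < 0" using d(2)[OF convex_cone_hull_contains_0] by simp
  have dpos: "d \<bullet> x \<ge> 0" if x: "x \<in> ?K" for x
  proof (rule ccontr)
    assume neg: "\<not> d \<bullet> x \<ge> 0"
    \<comment> \<open>In a cone, a point with negative value of d can be rescaled until the value is
      exactly \<beta>, against strict separation.\<close>
    have "(\<beta> / (d \<bullet> x)) *\<^sub>R x \<in> ?K"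
      using neg \<open>\<beta> < 0\<close> x by (intro convex_cone_hull_mul) (auto simp: divide_nonpos_neg)
    then show False using d(2) neg by force
  qed
  \<comment> \<open>A step too short to violate an inactive constraint: slack divided by rate of
    change. The summand 1 avoids division by zero, the inserted 1 covers the case without inactive
    constraints.\<close>
  define \<epsilon> where "\<epsilon> = Min (insert 1 ((\<lambda>j. (b j - a j \<bullet> v) / (1 + \<bar>a j \<bullet> d\<bar>)) ` {j\<in>J. a j \<bullet> v < b j}))"
  have "\<epsilon> > 0"
    unfolding \<epsilon>_def using assms(1) by (subst Min_gr_iff) auto
  have "a j \<bullet> (v - \<epsilon> *\<^sub>R d) \<le> b j" if j: "j \<in> J" for j
  proof (cases "a j \<bullet> v = b j")
    case True
    then have "d \<bullet> a j \<ge> 0" using j by (intro dpos hull_inc) auto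
    then show ?thesis using True \<open>\<epsilon> > 0\<close> by (simp add: inner_diff_right inner_commute)
  next
    case False
    then have "a j \<bullet> v < b j" using v[OF j] by simp
    then have "\<epsilon> \<le> (b j - a j \<bullet> v) / (1 + \<bar>a j \<bullet> d\<bar>)"
      unfolding \<epsilon>_def using assms(1) j by (intro Min_le) auto
    then have "\<epsilon> * (1 + \<bar>a j \<bullet> d\<bar>) \<le> b j - a j \<bullet> v"
      by (simp add: pos_le_divide_eq add_pos_nonneg)
    moreover have "- (\<epsilon> * (a j \<bullet> d)) \<le> \<epsilon> * (1 + \<bar>a j \<bullet> d\<bar>)"
    proof -
      have "\<epsilon> * (- (a j \<bullet> d)) \<le> \<epsilon> * (1 + \<bar>a j \<bullet> d\<bar>)"
        using \<open>\<epsilon> > 0\<close> by (intro mult_left_mono) auto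
      then show ?thesis by simp
    qed
    ultimately show ?thesis by (simp add: inner_diff_right)
  qed
  from max[OF this] have "\<epsilon> * (u \<bullet> d) \<ge> 0" by (simp add: inner_diff_right)
  then have "d \<bullet> u \<ge> 0" using \<open>\<epsilon> > 0\<close> by (simp add: zero_le_mult_iff inner_commute)
  with d(1) \<open>\<beta> < 0\<close> show False by simp
qed

text \<open>Membership in a Minkowski sum can thus be tested one functional at a time, without
  finding the summands of x.\<close>

lemma in_compact_convex_if_le_support:
  fixes Z :: "'a::euclidean_space set"
  assumes "compact Z" "convex Z" and "\<And>u. \<exists>z\<in>Z. u \<bullet> x \<le> u \<bullet> z"
  shows "x \<in> Z"
proof (rule ccontr)
  assume "x \<notin> Z"
  then obtain a b where ab: "a \<bullet> x < b" "\<forall>z\<in>Z. a \<bullet> z > b"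
    using separating_hyperplane_closed_point[of Z x] assms compact_imp_closed by blast
  obtain z where "z \<in> Z" "(- a) \<bullet> x \<le> (- a) \<bullet> z" using assms(3) by blast
  then show False using ab by force
qed

text \<open>Support functions are compared one u at a time. Let v in Q be maximal for u; by Farkas,
  u is a nonnegative combination of the normals active at v, of half-spaces of B and of cuts. The
  hypothesis \<open>ref\<close> expresses that the fan of Q refines those of A and B: single points
  y and z are maximal for all these normals at once. So p = z + (1 - s) y + s v dominates x along
  each normal, hence along u.\<close>

lemma truncation_decomposition:
  fixes A B :: "'a::euclidean_space set" and w :: "'i \<Rightarrow> 'a"
  assumes A: "compact A" "convex A" and B: "polytope B" and I: "finite I"
    and Q: "Q = B \<inter> {x. \<forall>i\<in>I. w i \<bullet> x \<le> c i}"
    and ref: "\<And>u. \<exists>v y z. v \<in> max_face Q u \<and> (\<forall>n\<in>normal_cone Q {v}. y \<in> max_face B n \<and> z \<in> max_face A n)"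
    and s: "0 \<le> s" "s \<le> (1::real)"
    and x: "x \<in> A + B" "\<And>i y z. i \<in> I \<Longrightarrow> y \<in> max_face B (w i) \<Longrightarrow> z \<in> max_face A (w i) \<Longrightarrow>
      w i \<bullet> x \<le> w i \<bullet> z + w i \<bullet> y + s * (c i - w i \<bullet> y)"
  shows "x \<in> A + (\<lambda>x. (1 - s) *\<^sub>R x) ` B + (\<lambda>x. s *\<^sub>R x) ` Q" (is "x \<in> ?Z")
proof (rule in_compact_convex_if_le_support)
  obtain H where H: "finite H" "B = \<Inter>H" "\<forall>h\<in>H. \<exists>a b. a \<noteq> 0 \<and> h = {x. a \<bullet> x \<le> b}"
    using polytope_imp_polyhedron[OF B] unfolding polyhedron_def by blast
  then obtain a b where ab: "\<And>h. h \<in> H \<Longrightarrow> h = {x. a h \<bullet> x \<le> b h}" by metis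
  have B_iff: "x \<in> B \<longleftrightarrow> (\<forall>h\<in>H. a h \<bullet> x \<le> b h)" for x
    unfolding H(2) using ab by blast
  have cQ: "compact Q" "convex Q"
  proof -
    have "Q = B \<inter> (\<Inter>i\<in>I. {x. w i \<bullet> x \<le> c i})" unfolding Q by blast
    moreover have "closed (\<Inter>i\<in>I. {x. w i \<bullet> x \<le> c i})" "convex (\<Inter>i\<in>I. {x. w i \<bullet> x \<le> c i})"
      by (auto intro: closed_halfspace_le convex_INT convex_halfspace_le)
    ultimately show "compact Q" "convex Q"
      using compact_Int_closed[OF polytope_imp_compact[OF B]] convex_Int[OF polytope_imp_convex[OF B]]
      by metis+
  qed
  show "compact ?Z"
    using A cQ by (intro compact_set_plus compact_scaling polytope_imp_compact[OF B])
  show "convex ?Z"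
    using A cQ by (intro convex_set_plus convex_scaling polytope_imp_convex[OF B])
  fix u
  obtain v y z where v: "v \<in> max_face Q u"
    and yz: "\<And>n. n \<in> normal_cone Q {v} \<Longrightarrow> y \<in> max_face B n \<and> z \<in> max_face A n"
    using ref[of u] by blast
  have vQ: "v \<in> Q" using v max_face_subset by blast
  have "u \<in> normal_cone Q {v}" using v by (auto simp: normal_cone_def max_face_def)
  then have yzm: "y \<in> B" "z \<in> A" using yz max_face_subset by blast+
  \<comment> \<open>The constraints of Q: \<open>Inl\<close> for the half-spaces of B,
    \<open>Inr\<close> for the cuts.\<close>
  let ?a = "case_sum a w" and ?b = "case_sum b c" and ?J = "Inl ` H \<union> Inr ` I"
  have Q_iff: "x \<in> Q \<longleftrightarrow> (\<forall>j\<in>?J. ?a j \<bullet> x \<le> ?b j)" for x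
    by (simp add: Q B_iff ball_Un)
  define p where "p = z + (1 - s) *\<^sub>R y + s *\<^sub>R v"
  have "u \<in> convex_cone hull (?a ` {j\<in>?J. ?a j \<bullet> v = ?b j})"
  proof (rule max_face_polyhedron_cone)
    show "finite ?J" using H I by simp
    show "?a j \<bullet> v \<le> ?b j" if "j \<in> ?J" for j using vQ Q_iff that by blast
    show "u \<bullet> x \<le> u \<bullet> v" if "\<And>j. j \<in> ?J \<Longrightarrow> ?a j \<bullet> x \<le> ?b j" for x
      using max_faceD[OF v] Q_iff that by blast
  qed
  moreover have "?a ` {j\<in>?J. ?a j \<bullet> v = ?b j} \<subseteq> {n. n \<bullet> x \<le> n \<bullet> p}"
  proof (rule image_subsetI, clarify)
    fix j assume j: "j \<in> ?J" "?a j \<bullet> v = ?b j"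
    have n: "?a j \<in> normal_cone Q {v}"
      using j Q_iff by (auto simp: normal_cone_def)
    note m = yz[OF n]
    show "?a j \<bullet> x \<le> ?a j \<bullet> p"
    proof (cases j)
      case (Inl h)
      have "a h \<bullet> y \<le> b h" using yzm(1) j(1) Inl by (auto simp: B_iff)
      \<comment> \<open>The point v of B lies on this hyperplane, so the maximizer y does too, and p
        has the same value as z + y.\<close>
      moreover have "b h \<le> a h \<bullet> y"
        using m j(2) Inl vQ max_faceD[of y B "a h" v] by (simp add: Q)
      ultimately have "a h \<bullet> y = a h \<bullet> v" using j(2) Inl by simp
      then have "a h \<bullet> p = a h \<bullet> z + a h \<bullet> y" by (simp add: p_def inner_add_right algebra_simps)
      moreover obtain z' y' where "x = z' + y'" "z' \<in> A" "y' \<in> B"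
        using x(1) by (auto simp: set_plus_def)
      ultimately show ?thesis
        using m Inl max_faceD[of y B "a h" y'] max_faceD[of z A "a h" z'] by (simp add: inner_add_right)
    next
      \<comment> \<open>An active cut has value c_i at v, so the value at p is precisely the bound
        assumed for x.\<close>
      case (Inr i)
      then show ?thesis
        using x(2)[of i y z] m j by (auto simp: p_def inner_add_right algebra_simps)
    qed
  qed
  moreover have "convex_cone {n. n \<bullet> x \<le> n \<bullet> p}"
  proof -
    have "{n. n \<bullet> x \<le> n \<bullet> p} = {n. (x - p) \<bullet> n \<le> 0}" by (auto simp: inner_diff_left inner_commute[of _ x] inner_commute[of _ p])
    then show ?thesis by (simp add: convex_cone_halfspace_le)
  qed
  ultimately have "u \<bullet> x \<le> u \<bullet> p" using hull_minimal by blast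
  moreover have "p \<in> ?Z" unfolding p_def using yzm vQ by (intro set_plus_intro) auto
  ultimately show "\<exists>z\<in>?Z. u \<bullet> x \<le> u \<bullet> z" by blast
qed

text \<open>The normal fan of \<open>Q\<close> refines that of \<open>B\<close>: a vertex \<open>v\<close> of \<open>Q\<close> deforms to a vertex of
  \<open>T s\<close> with the same normal cone, which converges as \<open>s \<rightarrow> 0\<close> to a point of \<open>B\<close>.\<close>

lemma normal_cone_refines:
  fixes B Q :: "'a::euclidean_space set"
  assumes B: "compact B" and Q: "polytope Q" "Q \<noteq> {}"
    and T: "\<And>s::real. 0 < s \<Longrightarrow> s \<le> 1 \<Longrightarrow> analogous (T s) Q \<and> T s \<subseteq> B"
    and sub: "\<And>s x y. 0 < s \<Longrightarrow> s \<le> 1 \<Longrightarrow> x \<in> B \<Longrightarrow> y \<in> Q \<Longrightarrow> (1 - s) *\<^sub>R x + s *\<^sub>R y \<in> T s"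
  shows "\<exists>v y. v \<in> max_face Q u \<and> (\<forall>n\<in>normal_cone Q {v}. y \<in> max_face B n)"
proof -
  have face: "max_face Q u face_of Q" using Q by (rule max_face_face_of)
  moreover have "max_face Q u \<noteq> {}" using Q by (intro max_face_nonempty polytope_imp_compact)
  ultimately obtain v where v: "v extreme_point_of (max_face Q u)"
    using extreme_point_exists_convex[of "max_face Q u"] Q face_of_polytope_polytope
      polytope_imp_compact polytope_imp_convex by metis
  then have vm: "v \<in> max_face Q u" by (simp add: extreme_point_of_def)
  have "{v} face_of Q"
    using v face extreme_point_of_face face_of_singleton by metis
  \<comment> \<open>A functional exposing v makes sense on every T s as well and selects there a
    face with the same normal cone.\<close>
  then obtain u0 where u0: "{v} = max_face Q u0" using face_eq_max_face[OF Q(1)] by blast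
  let ?s = "\<lambda>n. inverse (real (Suc n))"
  have s: "0 < ?s n" "?s n \<le> 1" for n by (simp_all add: field_simps)
  have "\<exists>x. x \<in> max_face (T (?s n)) u0" for n
    using T[OF s(1) s(2)] max_face_nonempty polytope_imp_compact by (metis analogous_iff ex_in_conv)
  then obtain f where f: "\<And>n. f n \<in> max_face (T (?s n)) u0" by metis
  then have "f n \<in> B" for n using T[OF s(1) s(2)] max_face_subset by blast
  then obtain y r where y: "y \<in> B" "strict_mono r" "(f \<circ> r) \<longlonglongrightarrow> y"
    using B unfolding compact_def by metis
  have "y \<in> max_face B n" if n: "n \<in> normal_cone Q {v}" for n
  proof -
    have "n \<in> max_cone (T (?s k)) u0" for k
      using n u0 T[OF s(1) s(2)] by (metis analogous_iff max_cone_def)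
    then have fn: "f k \<in> max_face (T (?s k)) n" for k
      using f max_cone_iff by blast
    \<comment> \<open>The points (1 - s) z + s v of T s tend to z, and the chosen maximizers of T s
      dominate them along n; pass to the limit.\<close>
    have "n \<bullet> z \<le> n \<bullet> y" if z: "z \<in> B" for z
    proof (rule LIMSEQ_le)
      have "?s \<longlonglongrightarrow> 0" by (rule LIMSEQ_inverse_real_of_nat)
      then have "(?s \<circ> r) \<longlonglongrightarrow> 0" using y(2) by (rule LIMSEQ_subseq_LIMSEQ)
      then have "(\<lambda>k. n \<bullet> ((1 - ?s (r k)) *\<^sub>R z + ?s (r k) *\<^sub>R v)) \<longlonglongrightarrow> n \<bullet> ((1 - 0) *\<^sub>R z + 0 *\<^sub>R v)"
        unfolding o_def by (intro tendsto_intros)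
      then show "(\<lambda>k. n \<bullet> ((1 - ?s (r k)) *\<^sub>R z + ?s (r k) *\<^sub>R v)) \<longlonglongrightarrow> n \<bullet> z" by simp
      show "(\<lambda>k. n \<bullet> (f \<circ> r) k) \<longlonglongrightarrow> n \<bullet> y" using y(3) by (intro tendsto_intros)
      have "v \<in> Q" using vm max_face_subset by blast
      then show "\<exists>N. \<forall>k\<ge>N. n \<bullet> ((1 - ?s (r k)) *\<^sub>R z + ?s (r k) *\<^sub>R v) \<le> n \<bullet> (f \<circ> r) k"
        using max_faceD[OF fn] sub[OF s(1) s(2) z] by auto
    qed
    then show ?thesis using y(1) by (simp add: max_face_def)
  qed
  with vm show ?thesis by blast
qed

text \<open>The common maximizers on B form a nonempty face, exposed by one functional u. All of C
  lies in the cone of u, which A shares, so any maximizer of u on A serves.\<close>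

lemma analogous_common_maximizer:
  assumes "analogous A B" and C: "C \<noteq> {}" and y: "\<And>n. n \<in> C \<Longrightarrow> y \<in> max_face B n"
  shows "\<exists>z. \<forall>n\<in>C. z \<in> max_face A n"
proof -
  have AB: "polytope A" "A \<noteq> {}" "polytope B" "B \<noteq> {}" "max_cone A = max_cone B"
    using assms by (auto simp: analogous_iff)
  have "(\<Inter>n\<in>C. max_face B n) face_of B"
    using C max_face_face_of[OF AB(3,4)] by (intro face_of_Inter) blast+
  moreover have "(\<Inter>n\<in>C. max_face B n) \<noteq> {}" using y by blast
  ultimately obtain u where u: "(\<Inter>n\<in>C. max_face B n) = max_face B u"
    using face_eq_max_face[OF AB(3)] by metis
  then have "n \<in> max_cone A u" if "n \<in> C" for n
    using that AB(5) by (auto simp: max_cone_iff)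
  moreover obtain z where "z \<in> max_face A u"
    using max_face_nonempty AB polytope_imp_compact by blast
  ultimately show ?thesis by (auto simp: max_cone_iff)
qed

section \<open>Truncations as Minkowski sums\<close>

lemma negligible_Int_measure_Un:
  assumes "S \<in> lmeasurable" "T \<in> lmeasurable" "negligible (S \<inter> T)"
  shows "measure lebesgue (S \<union> T) = measure lebesgue S + measure lebesgue T"
  using measure_Un3[OF assms(1,2)] assms(3) negligible_imp_measure0 by simp

lemma linear_eq_inner:
  fixes f :: "'a::euclidean_space \<Rightarrow> real"
  assumes "linear f"
  obtains u where "f = (\<lambda>x. u \<bullet> x)"
proof
  show "f = (\<lambda>x. adjoint f 1 \<bullet> x)"
    using adjoint_works[OF assms, of _ 1] by (auto simp: inner_commute)
qed

locale codim_two_cut =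
  fixes P Phat Q :: "(real^'n) set" and k :: nat and F :: "nat \<Rightarrow> (real^'n) set"
    and \<psi> :: "nat \<Rightarrow> real^'n \<Rightarrow> real" and c :: "nat \<Rightarrow> real"
  assumes Phat: "analogous Phat P" and Q: "codim_two_truncation P Phat k F \<psi> c Q"
begin

lemma polytope_P: "polytope P" "P \<noteq> {}" and polytope_Phat: "polytope Phat" "Phat \<noteq> {}"
  using Phat by (auto simp: analogous_iff)

text \<open>The cutting condition is given on Phat alone; equality of fans transports it to every
  analogous polytope. The codimension excludes u = 0, which makes the cutting hyperplanes null sets
  later.\<close>

lemma cut_function:
  assumes i: "i \<in> {1..k}"
  obtains u where "\<psi> i = (\<lambda>x. u \<bullet> x)" "u \<noteq> 0"
    "\<And>A. analogous A P \<Longrightarrow> corr_face P (F i) A = max_face A u"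
proof -
  have Fi: "F i face_of P" "F i \<noteq> {}" "aff_dim (F i) = aff_dim P - 2" "linear (\<psi> i)"
    using Q i by (auto simp: codim_two_truncation_def)
  obtain M where M: "\<forall>x\<in>corr_face P (F i) Phat. \<psi> i x = M"
    "\<forall>x\<in>Phat - corr_face P (F i) Phat. \<psi> i x < M"
    using Q i unfolding codim_two_truncation_def by blast
  obtain u where u: "\<psi> i = (\<lambda>x. u \<bullet> x)" using linear_eq_inner[OF Fi(4)] .
  obtain w where w: "F i = max_face P w" using face_eq_max_face[OF polytope_P(1) Fi(1,2)] .
  have cP: "corr_face P (F i) Phat = max_face Phat w"
    using corr_face_max_face[OF Phat] w by simp
  obtain z where z: "z \<in> max_face Phat w"
    using max_face_nonempty[OF polytope_imp_compact] polytope_Phat by blast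
  have zP: "z \<in> Phat" "u \<bullet> z = M" using z max_face_subset M(1) cP u by auto
  have le: "u \<bullet> x \<le> M" if "x \<in> Phat" for x
    using M that cP u by (cases "x \<in> max_face Phat w") (auto intro: less_imp_le)
  have "max_face Phat u = max_face Phat w"
  proof (intro Set.set_eqI iffI)
    fix x assume "x \<in> max_face Phat u"
    then have "x \<in> Phat" "u \<bullet> x \<ge> M" using max_faceD[of x Phat u z] zP max_face_subset by auto
    then show "x \<in> max_face Phat w" using M(2) unfolding cP u by (metis DiffI not_less)
  next
    fix x assume x: "x \<in> max_face Phat w"
    then have "x \<in> Phat" "u \<bullet> x = M" using max_face_subset M(1) cP u by auto
    then show "x \<in> max_face Phat u" using le by (simp add: max_face_def)
  qed
  then have cones: "max_cone Phat u = max_cone Phat w" by (simp add: max_face_eq_iff)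
  have face: "max_face A u = max_face A w" if "analogous A P" for A
    using cones that Phat by (metis analogous_iff max_face_eq_iff)
  show ?thesis
  proof (rule that[OF u])
    show "corr_face P (F i) A = max_face A u" if "analogous A P" for A
      using corr_face_max_face[OF that, of w] face[OF that] w by simp
    show "u \<noteq> 0"
    proof
      assume "u = 0"
      then have "max_face P u = P" by (auto simp: max_face_def)
      moreover have "analogous P P" using Phat by (simp add: analogous_iff)
      ultimately have "F i = P" using face w by simp
      then show False using Fi(3) by simp
    qed
  qed
qed

lemma face_value_eq:
  assumes "\<psi> i = (\<lambda>x. u \<bullet> x)" "corr_face P (F i) A = max_face A u" "y \<in> max_face A u"
  shows "face_value P (F i) (\<psi> i) A = u \<bullet> y"
proof -
  have "\<psi> i ` corr_face P (F i) A = {u \<bullet> y}"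
    using assms by (auto simp: max_face_def intro: antisym)
  then show ?thesis by (simp add: face_value_def)
qed

lemma polytope_Q: "polytope Q" "Q \<noteq> {}" and Q_subset: "Q \<subseteq> Phat"
proof -
  \<comment> \<open>The last clause of \<open>codim_two_truncation\<close> at s = 1 says in
    particular that Q is a nonempty polytope.\<close>
  have "analogous (truncation Phat k \<psi> (cut_level P Phat F \<psi> c Phat 1)) Q"
    using Q unfolding codim_two_truncation_def by (metis order_refl zero_less_one)
  then show "polytope Q" "Q \<noteq> {}" by (auto simp: analogous_iff)
  show "Q \<subseteq> Phat" using Q by (auto simp: codim_two_truncation_def truncation_def)
qed

lemma Q_eq: "Q = Phat \<inter> {x. \<forall>i\<in>{1..k}. \<psi> i x \<le> c i}"
  using Q by (auto simp: codim_two_truncation_def truncation_def)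

text \<open>Supplies \<open>ref\<close> of \<open>truncation_decomposition\<close>. As s tends to 0,
  the truncations at proportion s grow back to Phat while keeping the fan of Q.\<close>

lemma Phat_refinement:
  assumes "analogous A P"
  shows "\<exists>v y z. v \<in> max_face Q u \<and>
    (\<forall>n\<in>normal_cone Q {v}. y \<in> max_face Phat n \<and> z \<in> max_face A n)"
proof -
  let ?T = "\<lambda>s. truncation Phat k \<psi> (cut_level P Phat F \<psi> c Phat s)"
  obtain v y where vy: "v \<in> max_face Q u" "\<And>n. n \<in> normal_cone Q {v} \<Longrightarrow> y \<in> max_face Phat n"
  proof -
    have "\<exists>v y. v \<in> max_face Q u \<and> (\<forall>n\<in>normal_cone Q {v}. y \<in> max_face Phat n)"
    proof (rule normal_cone_refines[where T = ?T])
      show "compact Phat" "polytope Q" "Q \<noteq> {}"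
        using polytope_Phat polytope_Q polytope_imp_compact by blast+
      show "analogous (?T s) Q \<and> ?T s \<subseteq> Phat" if "0 < s" "s \<le> 1" for s
        using Q that by (auto simp: codim_two_truncation_def truncation_def)
      fix s :: real and x y assume s: "0 < s" "s \<le> 1" and xy: "x \<in> Phat" "y \<in> Q"
      \<comment> \<open>Cut levels are affine in s, from the face value at s = 0 to
        \<open>c i\<close> at s = 1.\<close>
      have "\<psi> i ((1 - s) *\<^sub>R x + s *\<^sub>R y) \<le> cut_level P Phat F \<psi> c Phat s i" if i: "i \<in> {1..k}" for i
      proof -
        obtain w where w: "\<psi> i = (\<lambda>x. w \<bullet> x)" "corr_face P (F i) Phat = max_face Phat w"
          using cut_function[OF i] Phat by metis
        obtain m where m: "m \<in> max_face Phat w"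
          using max_face_nonempty[OF polytope_imp_compact] polytope_Phat by blast
        have "(1 - s) * (w \<bullet> x) \<le> (1 - s) * (w \<bullet> m)"
          using s max_faceD[OF m xy(1)] by (intro mult_left_mono) auto
        moreover have "s * (w \<bullet> y) \<le> s * c i"
        proof (rule mult_left_mono)
          have "\<psi> i y \<le> c i" using xy(2) i unfolding Q_eq by blast
          then show "w \<bullet> y \<le> c i" by (simp add: w(1))
        qed (use s in simp)
        ultimately show ?thesis
          unfolding cut_level_def face_value_eq[OF w m] unfolding w(1)
          by (simp add: inner_add_right algebra_simps)
      qed
      moreover have "(1 - s) *\<^sub>R x + s *\<^sub>R y \<in> Phat"
        using polytope_imp_convex[OF polytope_Phat(1)] xy Q_subset s
        by (intro convexD) auto
      ultimately show "(1 - s) *\<^sub>R x + s *\<^sub>R y \<in> ?T s"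
        by (auto simp: truncation_def)
    qed
    then show ?thesis using that by blast
  qed
  have "analogous A Phat" using assms Phat by (simp add: analogous_iff)
  moreover have "normal_cone Q {v} \<noteq> {}"
    using vy(1) by (auto simp: normal_cone_def max_face_def)
  ultimately obtain z where "\<forall>n\<in>normal_cone Q {v}. z \<in> max_face A n"
    using analogous_common_maximizer[of A Phat "normal_cone Q {v}" y] vy(2) by blast
  with vy show ?thesis by blast
qed

text \<open>For P' = A + Phat, the virtual polytope P' + s (Q - Phat) is an honest sum. The cut
  inequalities describe exactly this sum inside P', and the part cut off meets it only inside the
  cutting hyperplanes.\<close>

lemma measure_truncation:
  assumes A: "analogous A P" and s: "0 \<le> s" "s \<le> (1::real)"
  shows "measure lebesgue (A + Phat) =
    measure lebesgue (A + (\<lambda>x. (1 - s) *\<^sub>R x) ` Phat + (\<lambda>x. s *\<^sub>R x) ` Q)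
    + measure lebesgue (cut_off P Phat k F \<psi> c (A + Phat) s)"
proof -
  let ?W = "A + Phat" and ?Z = "A + (\<lambda>x. (1 - s) *\<^sub>R x) ` Phat + (\<lambda>x. s *\<^sub>R x) ` Q"
  let ?C = "cut_off P Phat k F \<psi> c ?W s"
  define l where "l = cut_level P Phat F \<psi> c ?W s"
  have "\<forall>i\<in>{1..k}. \<exists>u. \<psi> i = (\<lambda>x. u \<bullet> x) \<and> u \<noteq> 0 \<and>
      (\<forall>A. analogous A P \<longrightarrow> corr_face P (F i) A = max_face A u)"
    using cut_function by metis
  then obtain u where u: "\<And>i. i \<in> {1..k} \<Longrightarrow> \<psi> i = (\<lambda>x. u i \<bullet> x)" "\<And>i. i \<in> {1..k} \<Longrightarrow> u i \<noteq> 0"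
    "\<And>i A. i \<in> {1..k} \<Longrightarrow> analogous A P \<Longrightarrow> corr_face P (F i) A = max_face A (u i)"
    by metis
  have A': "polytope A" "A \<noteq> {}" using A by (auto simp: analogous_iff)
  have W: "analogous ?W P" using A Phat by (rule analogous_set_plus)
  \<comment> \<open>Face values add up under Minkowski sums, whereas the depth of a cut is always
    measured on Phat.\<close>
  have l: "l i = u i \<bullet> z + u i \<bullet> y + s * (c i - u i \<bullet> y)"
    if "i \<in> {1..k}" "y \<in> max_face Phat (u i)" "z \<in> max_face A (u i)" for i y z
  proof -
    have "z + y \<in> max_face ?W (u i)"
      using that A' polytope_Phat by (simp add: max_face_plus polytope_imp_compact set_plus_intro)
    then have "face_value P (F i) (\<psi> i) ?W = u i \<bullet> (z + y)"
      using face_value_eq u that W by metis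
    moreover have "face_value P (F i) (\<psi> i) Phat = u i \<bullet> y"
      using face_value_eq u that Phat by metis
    ultimately show ?thesis by (simp add: l_def cut_level_def inner_add_right)
  qed
  have Z: "?Z = ?W \<inter> {x. \<forall>i\<in>{1..k}. u i \<bullet> x \<le> l i}"
  proof
    show "?W \<inter> {x. \<forall>i\<in>{1..k}. u i \<bullet> x \<le> l i} \<subseteq> ?Z"
    proof
      fix x assume x: "x \<in> ?W \<inter> {x. \<forall>i\<in>{1..k}. u i \<bullet> x \<le> l i}"
      show "x \<in> ?Z"
      proof (rule truncation_decomposition[where I = "{1..k}" and w = u and c = c])
        show "Q = Phat \<inter> {x. \<forall>i\<in>{1..k}. u i \<bullet> x \<le> c i}" using Q_eq u(1) by auto
        show "\<exists>v y z. v \<in> max_face Q n \<and>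
            (\<forall>n\<in>normal_cone Q {v}. y \<in> max_face Phat n \<and> z \<in> max_face A n)" for n
          by (rule Phat_refinement[OF A])
        show "u i \<bullet> x \<le> u i \<bullet> z + u i \<bullet> y + s * (c i - u i \<bullet> y)"
          if "i \<in> {1..k}" "y \<in> max_face Phat (u i)" "z \<in> max_face A (u i)" for i y z
        proof -
          have "u i \<bullet> x \<le> l i" using x that(1) by blast
          then show ?thesis unfolding l[OF that] .
        qed
      qed (use x s A' polytope_Phat in \<open>auto simp: polytope_imp_compact polytope_imp_convex\<close>)
    qed
    show "?Z \<subseteq> ?W \<inter> {x. \<forall>i\<in>{1..k}. u i \<bullet> x \<le> l i}"
    proof
      fix x assume "x \<in> ?Z"
      then obtain a y q where x: "x = a + (1 - s) *\<^sub>R y + s *\<^sub>R q" "a \<in> A" "y \<in> Phat" "q \<in> Q"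
        by (auto simp: set_plus_def)
      have "(1 - s) *\<^sub>R y + s *\<^sub>R q \<in> Phat"
        using polytope_imp_convex[OF polytope_Phat(1)] x Q_subset s by (intro convexD) auto
      then have "x \<in> ?W" using x by (auto simp: add.assoc intro: set_plus_intro)
      moreover have "u i \<bullet> x \<le> l i" if i: "i \<in> {1..k}" for i
      proof -
        obtain m z where m: "m \<in> max_face Phat (u i)" "z \<in> max_face A (u i)"
          using max_face_nonempty[OF polytope_imp_compact] polytope_Phat A' by (metis ex_in_conv)
        have "u i \<bullet> a \<le> u i \<bullet> z" "(1 - s) * (u i \<bullet> y) \<le> (1 - s) * (u i \<bullet> m)"
          using s max_faceD m x by (auto intro!: mult_left_mono)
        moreover have "s * (u i \<bullet> q) \<le> s * c i"
        proof (rule mult_left_mono)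
          have "\<psi> i q \<le> c i" using x(4) i unfolding Q_eq by blast
          then show "u i \<bullet> q \<le> c i" by (simp add: u(1)[OF i])
        qed (use s in simp)
        ultimately show ?thesis
          unfolding l[OF i m] x(1) by (simp add: inner_add_right algebra_simps)
      qed
      ultimately show "x \<in> ?W \<inter> {x. \<forall>i\<in>{1..k}. u i \<bullet> x \<le> l i}" by blast
    qed
  qed
  have C: "?C = (\<Union>i\<in>{1..k}. ?W \<inter> {x. u i \<bullet> x \<ge> l i})"
    using u(1) by (auto simp: cut_off_def l_def)
  have Wc: "compact ?W" using A' polytope_Phat by (simp add: compact_set_plus polytope_imp_compact)
  have "compact ?C"
    unfolding C using Wc by (intro compact_UN compact_Int_closed closed_halfspace_ge) auto
  moreover have "compact ?Z"
    using A' polytope_Phat polytope_Q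
    by (intro compact_set_plus compact_scaling) (simp_all add: polytope_imp_compact)
  moreover have "negligible (?Z \<inter> ?C)"
  proof (rule negligible_subset)
    show "negligible (\<Union>i\<in>{1..k}. {x. u i \<bullet> x = l i})"
      using u(2) by (intro negligible_Union) (auto intro: negligible_hyperplane)
    show "?Z \<inter> ?C \<subseteq> (\<Union>i\<in>{1..k}. {x. u i \<bullet> x = l i})"
      unfolding Z C by (auto intro: antisym)
  qed
  moreover have "?W = ?Z \<union> ?C" unfolding Z C by auto
  ultimately show ?thesis
    using negligible_Int_measure_Un[of ?Z ?C] by (simp add: lmeasurable_compact)
qed

end

section \<open>Volumes of slabs\<close>

abbreviation scale :: "real \<Rightarrow> 'a::real_vector set \<Rightarrow> 'a set" where
  "scale c A \<equiv> (\<lambda>x. c *\<^sub>R x) ` A"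

lemma scale_set_plus: "scale c (A + B) = scale c A + scale c B"
proof
  show "scale c (A + B) \<subseteq> scale c A + scale c B"
    by (auto simp: scaleR_add_right elim!: set_plus_elim intro!: set_plus_intro imageI)
  show "scale c A + scale c B \<subseteq> scale c (A + B)"
    by (auto simp: scaleR_add_right[symmetric] elim!: set_plus_elim intro!: imageI set_plus_intro)
qed

lemma scale_scale: "scale c (scale d A) = scale (c * d) A"
  by (simp add: image_image)

lemma scale_add:
  assumes "convex A" "0 \<le> c" "0 \<le> d"
  shows "scale (c + d) A = scale c A + scale d A"
proof (cases "c + d = 0")
  case True
  then have "c = 0" "d = 0" using assms by auto
  then show ?thesis by (cases "A = {}") (auto simp: set_plus_def image_constant_conv)
next
  case False
  then have cd: "c + d > 0" using assms by auto
  show ?thesis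
  proof
    show "scale (c + d) A \<subseteq> scale c A + scale d A"
      by (auto simp: scaleR_add_left intro!: set_plus_intro)
    show "scale c A + scale d A \<subseteq> scale (c + d) A"
    proof
      fix x assume "x \<in> scale c A + scale d A"
      then obtain a b where x: "x = c *\<^sub>R a + d *\<^sub>R b" "a \<in> A" "b \<in> A" by (auto simp: set_plus_def)
      have "(c / (c + d)) *\<^sub>R a + (d / (c + d)) *\<^sub>R b \<in> A"
        using assms x cd by (intro convexD) (auto simp: add_divide_distrib[symmetric])
      moreover have "x = (c + d) *\<^sub>R ((c / (c + d)) *\<^sub>R a + (d / (c + d)) *\<^sub>R b)"
        using cd by (simp add: x scaleR_add_right)
      ultimately show "x \<in> scale (c + d) A" by blast
    qed
  qed
qed

lemma measure_scale:
  fixes A :: "'a::euclidean_space set"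
  shows "measure lebesgue (scale c A) = \<bar>c\<bar> ^ DIM('a) * measure lebesgue A"
  using measure_lebesgue_affine[of c 0 A] by simp

lemma scale_S_P:
  assumes A: "A \<in> S_P P"
  shows "scale (real (Suc m)) A \<in> S_P P"
proof (induction m)
  case (Suc m)
  have "convex A" using A by (auto simp: S_P_def lattice_polytope_def polytope_imp_convex)
  then have "scale (real (Suc m) + 1) A = scale (real (Suc m)) A + scale 1 A"
    by (intro scale_add) auto
  then have "scale (real (Suc (Suc m))) A = scale (real (Suc m)) A + A"
    by (simp add: add.commute)
  then show ?case using Suc A S_P_add by simp
qed (use A in simp)

lemma mem_push_pull_iff:
  assumes A: "convex A" "A \<noteq> {}" and B: "convex B" "B \<noteq> {}" and s: "s > 0"
  shows "(x, t) \<in> push_pull s A B \<longleftrightarrow>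
    0 \<le> t \<and> t \<le> s \<and> x \<in> scale (t / s) A + scale (1 - t / s) B"
proof -
  have eq: "push_pull s A B = {u *\<^sub>R a + v *\<^sub>R b | u v a b.
      u \<ge> 0 \<and> v \<ge> 0 \<and> u + v = 1 \<and> a \<in> A \<times> {s} \<and> b \<in> B \<times> {0}}"
    unfolding push_pull_def using assms by (intro convex_hull_union_two convex_Times) auto
  show ?thesis
  proof
    assume "(x, t) \<in> push_pull s A B"
    then obtain u v a b where uv: "u \<ge> 0" "v \<ge> 0" "u + v = 1" and ab: "a \<in> A" "b \<in> B"
      and xt: "x = u *\<^sub>R a + v *\<^sub>R b" "t = u * s"
      unfolding eq by auto
    have "u * s \<le> 1 * s" using uv s by (intro mult_right_mono) auto
    then have "0 \<le> t \<and> t \<le> s" using uv s xt by simp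
    moreover have "t / s = u" "1 - t / s = v" using uv s xt by simp_all
    ultimately show "0 \<le> t \<and> t \<le> s \<and> x \<in> scale (t / s) A + scale (1 - t / s) B"
      using ab unfolding xt(1) by (auto intro!: set_plus_intro)
  next
    assume *: "0 \<le> t \<and> t \<le> s \<and> x \<in> scale (t / s) A + scale (1 - t / s) B"
    then obtain a b where "a \<in> A" "b \<in> B" "x = (t / s) *\<^sub>R a + (1 - t / s) *\<^sub>R b"
      by (auto simp: set_plus_def)
    moreover from this have "(x, t) = (t / s) *\<^sub>R (a, s) + (1 - t / s) *\<^sub>R (b, 0)"
      using s by simp
    moreover have "t / s \<ge> 0" "1 - t / s \<ge> 0" using * s by auto
    ultimately show "(x, t) \<in> push_pull s A B" unfolding eq by force
  qed
qed

lemma compact_push_pull: "compact A \<Longrightarrow> compact B \<Longrightarrow> compact (push_pull s A B)"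
  unfolding push_pull_def by (intro compact_convex_hull compact_Un compact_Times) auto

text \<open>Cavalieri's principle for a slab of height one: uniform bounds on the slices pass to the
  slab unchanged, so no slice volume has to be integrated exactly.\<close>

lemma measure_slab_bounds:
  fixes S :: "('a::euclidean_space \<times> real) set"
  assumes S: "compact S" and sub: "\<And>x t. (x, t) \<in> S \<Longrightarrow> 0 \<le> t \<and> t \<le> 1"
    and lo: "\<And>t. 0 \<le> t \<Longrightarrow> t \<le> 1 \<Longrightarrow> lo \<le> measure lebesgue {x. (x, t) \<in> S}"
    and hi: "\<And>t. 0 \<le> t \<Longrightarrow> t \<le> 1 \<Longrightarrow> measure lebesgue {x. (x, t) \<in> S} \<le> hi"
    and "0 \<le> lo"
  shows "lo \<le> measure lebesgue S" "measure lebesgue S \<le> hi"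
proof -
  have hi0: "0 \<le> hi" using hi[of 0] measure_nonneg by (meson order_trans zero_le_one order_refl)
  have slice: "compact {x. (x, t) \<in> S}" for t
  proof -
    have "{x. (x, t) \<in> S} = fst ` (S \<inter> UNIV \<times> {t})" by force
    then show ?thesis using S
      by (simp add: compact_Int_closed closed_Times compact_continuous_image continuous_on_fst)
  qed
  have m: "emeasure lborel {x. (x, t) \<in> S} = ennreal (measure lebesgue {x. (x, t) \<in> S})" for t
    using slice[of t] emeasure_compact_finite[OF slice, of t]
    by (simp add: measure_def borel_compact)
  have "emeasure lborel S = (\<integral>\<^sup>+t. emeasure lborel ((\<lambda>x. (x, t)) -` S) \<partial>lborel)"
    unfolding lborel_prod[symmetric]
    by (rule lborel_pair.emeasure_pair_measure_alt2, subst lborel_prod) (simp add: borel_compact S)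
  also have "\<dots> = (\<integral>\<^sup>+t. ennreal (measure lebesgue {x. (x, t) \<in> S}) \<partial>lborel)"
    by (simp add: vimage_def m)
  finally have eS: "emeasure lborel S = (\<integral>\<^sup>+t. ennreal (measure lebesgue {x. (x, t) \<in> S}) \<partial>lborel)" .
  have const: "(\<integral>\<^sup>+t. ennreal c * indicator {0..1::real} t \<partial>lborel) = ennreal c" for c
    by (simp add: nn_integral_cmult_indicator)
  have empty: "{x. (x, t) \<in> S} = {}" if "t \<notin> {0..1}" for t using sub that by force
  have "(\<integral>\<^sup>+t. ennreal lo * indicator {0..1::real} t \<partial>lborel) \<le> emeasure lborel S"
    unfolding eS by (intro nn_integral_mono) (auto simp: indicator_def lo intro!: ennreal_leI)
  moreover have "emeasure lborel S \<le> (\<integral>\<^sup>+t. ennreal hi * indicator {0..1::real} t \<partial>lborel)"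
    unfolding eS by (intro nn_integral_mono) (auto simp: indicator_def hi empty intro!: ennreal_leI)
  moreover have "emeasure lborel S = ennreal (measure lebesgue S)"
    using emeasure_compact_finite[OF S] S by (simp add: measure_def borel_compact)
  ultimately show "lo \<le> measure lebesgue S" "measure lebesgue S \<le> hi"
    using \<open>0 \<le> lo\<close> hi0 unfolding const by (auto simp: ennreal_le_iff)
qed

text \<open>The closed parallel bodies of a compact set decrease to it, so the measure is continuous
  from above along them.\<close>

lemma measure_cball_plus_tendsto:
  fixes K :: "'a::euclidean_space set"
  assumes K: "compact K" "K \<noteq> {}" and C: "C \<ge> 0"
  shows "(\<lambda>m. measure lebesgue (K + cball 0 (C / real (Suc m)))) \<longlonglongrightarrow> measure lebesgue K"
proof -
  let ?L = "\<lambda>m. K + cball 0 (C / real (Suc m))"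
  have L: "compact (?L m)" for m using K by (intro compact_set_plus) auto
  have "(\<Inter>m. ?L m) = K"
  proof
    show "K \<subseteq> (\<Inter>m. ?L m)" using C set_plus_intro[of _ K 0] by fastforce
    show "(\<Inter>m. ?L m) \<subseteq> K"
    proof
      fix x assume x: "x \<in> (\<Inter>m. ?L m)"
      have "infdist x K \<le> C / real (Suc m)" for m
      proof -
        obtain y e where "x = y + e" "y \<in> K" "norm e \<le> C / real (Suc m)"
        proof -
          have "x \<in> ?L m" using x by blast
          then show ?thesis using that by (elim set_plus_elim) (simp add: mem_cball)
        qed
        then show ?thesis using infdist_le[of y K x] by (simp add: dist_norm)
      qed
      moreover have "(\<lambda>m. C / real (Suc m)) \<longlonglongrightarrow> 0"
        using tendsto_mult[OF tendsto_const LIMSEQ_inverse_real_of_nat, of C] by (simp add: divide_inverse)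
      ultimately have "infdist x K \<le> 0" by (intro LIMSEQ_le_const) auto
      then have "infdist x K = 0" using infdist_nonneg[of x K] by linarith
      then show "x \<in> K" using K in_closed_iff_infdist_zero compact_imp_closed by blast
    qed
  qed
  moreover have "(\<lambda>m. measure lebesgue (?L m)) \<longlonglongrightarrow> measure lebesgue (\<Inter>m. ?L m)"
  proof (rule Lim_measure_decseq)
    show "range ?L \<subseteq> sets lebesgue" using L lmeasurable_compact by (auto simp: fmeasurable_def)
    show "decseq ?L"
    proof (rule decseq_SucI)
      fix m
      have "C / real (Suc (Suc m)) \<le> C / real (Suc m)" using C by (intro divide_left_mono) auto
      then show "?L (Suc m) \<subseteq> ?L m" by (intro set_plus_mono2) auto
    qed
    show "emeasure lebesgue (?L m) \<noteq> \<infinity>" for m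
      using lmeasurable_compact[OF L[of m]] by (auto simp: fmeasurable_def)
  qed
  ultimately show ?thesis by simp
qed

section \<open>The volume polynomial of the push-pull polytope\<close>

locale push_pull_setup = codim_two_cut P Phat Q k F \<psi> c
  for P Phat Q :: "(real^'n) set" and k F \<psi> c +
  fixes b :: "'l::finite \<Rightarrow> ((real^'n) set \<times> (real^'n) set) set"
    and E :: "'l option \<Rightarrow> (((real^'n) \<times> real) set \<times> ((real^'n) \<times> real) set) set"
    and volP :: "real^'l \<Rightarrow> real" and V :: "real^('l option) \<Rightarrow> real"
  assumes P: "lattice_polytope P" and Phat_S_P: "Phat \<in> S_P P"
    and basis: "lattice_basis (grothendieck (S_P P)) b"
    and volP: "volume_polynomial (S_P P) b volP"
    and E: "push_pull_basis P Q b E"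
    and V: "volume_polynomial (S_Delta P Q) E V"
begin

sublocale add_semigroup_set "S_P P"
  by unfold_locales (use S_P_add S_P_self[OF P] in auto)

abbreviation pc :: "(real^'n) set \<Rightarrow> real^'l" where
  "pc \<equiv> poly_coords (S_P P) b"

lemma S_PD:
  assumes "A \<in> S_P P"
  shows "analogous A P" "polytope A" "A \<noteq> {}" "compact A" "convex A"
  using assms by (auto simp: S_P_def analogous_iff polytope_imp_compact polytope_imp_convex)

lemma compact_Q: "compact Q" and convex_Q: "convex Q"
  using polytope_Q by (auto simp: polytope_imp_compact polytope_imp_convex)

lemma P_S_P: "P \<in> S_P P"
  using P by (rule S_P_self)

lemma pc_add: "A \<in> S_P P \<Longrightarrow> B \<in> S_P P \<Longrightarrow> pc (A + B) = pc A + pc B"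
  by (rule poly_coords_add[OF basis])

lemma pc_scale:
  assumes A: "A \<in> S_P P"
  shows "pc (scale (real (Suc m)) A) = real (Suc m) *\<^sub>R pc A"
proof (induction m)
  case (Suc m)
  have "scale (real (Suc m) + 1) A = scale (real (Suc m)) A + scale 1 A"
    using S_PD[OF A] by (intro scale_add) auto
  then have "scale (real (Suc (Suc m))) A = scale (real (Suc m)) A + A"
    by (simp add: add.commute)
  then have "pc (scale (real (Suc (Suc m))) A) = (real (Suc m) + 1) *\<^sub>R pc A"
    unfolding scaleR_add_left using Suc pc_add[OF scale_S_P[OF A, of m] A] by simp
  then show ?case by (simp add: add.commute)
qed simp

lemma V_poly: "real_polynomial_function V"
  and V_homogeneous: "V (t *\<^sub>R x) = t ^ Suc CARD('n) * V x"
  using V by (simp_all add: volume_polynomial_def)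

lemma volP_poly: "real_polynomial_function volP"
  and volP_eq: "A \<in> S_P P \<Longrightarrow> volP (pc A) = measure lebesgue A"
  using volP by (simp_all add: volume_polynomial_def)

text \<open>The offset \<open>p\<close> allows for the translates by pc Phat and pc P on which the
  identities are checked.\<close>

lemma density:
  fixes f :: "real^'l \<Rightarrow> real"
  assumes "real_polynomial_function f" "\<And>A. A \<in> S_P P \<Longrightarrow> f (p + pc A) = 0"
  shows "f x = 0"
proof (rule real_polynomial_function_eq_0_semigroup[OF assms(1)])
  show "span (pc ` S_P P) = UNIV" by (rule span_poly_coords[OF basis])
  show "x + y \<in> pc ` S_P P" if xy: "x \<in> pc ` S_P P" "y \<in> pc ` S_P P" for x y
  proof -
    obtain A B where "x = pc A" "y = pc B" "A \<in> S_P P" "B \<in> S_P P" using xy by blast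
    then show ?thesis using pc_add S_P_add by (metis imageI)
  qed
  show "f (p + x) = 0" if "x \<in> pc ` S_P P" for x using that assms(2) by blast
qed

text \<open>With P' = R + s P, the polytope Y = R + s Q solves Y + s P = P' + s Q, so nothing
  virtual appears.\<close>

lemma V_push_pull:
  assumes R: "R \<in> S_P P"
  shows "V (join_coord (real (Suc m)) (pc R + real (Suc m) *\<^sub>R pc P)) =
    measure lebesgue (push_pull (real (Suc m)) (R + scale (real (Suc m)) P) (R + scale (real (Suc m)) Q))"
proof -
  let ?s = "real (Suc m)"
  have adm: "push_pull_admissible P Q (Suc m) (R + scale ?s P) (R + scale ?s Q)"
    using S_PD[OF R] polytope_Q R scale_S_P[OF P_S_P, of m]
    by (simp add: push_pull_admissible_def S_P_add polytope_set_plus polytope_scaling ac_simps)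
  then have "push_pull ?s (R + scale ?s P) (R + scale ?s Q) \<in> S_Delta P Q"
    unfolding S_Delta_def by blast
  moreover have "poly_coords (S_Delta P Q) E (push_pull ?s (R + scale ?s P) (R + scale ?s Q)) =
      join_coord ?s (pc R + ?s *\<^sub>R pc P)"
    using E adm pc_add[OF R scale_S_P[OF P_S_P, of m]] pc_scale[OF P_S_P, of m]
    unfolding push_pull_basis_def by metis
  ultimately show ?thesis
    using V unfolding volume_polynomial_def by metis
qed

text \<open>The height t counts from the Q-end. The two shares of R recombine because R is
  convex.\<close>

lemma mem_push_pull_slice:
  assumes R: "R \<in> S_P P" and s: "s > 0"
  shows "(x, t) \<in> push_pull s (R + scale s P) (R + scale s Q) \<longleftrightarrow>
    0 \<le> t \<and> t \<le> s \<and> x \<in> R + scale t P + scale (s - t) Q"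
proof -
  note R' = S_PD[OF R] and P' = S_PD[OF P_S_P]
  have "scale (t / s) (R + scale s P) + scale (1 - t / s) (R + scale s Q) =
      R + scale t P + scale (s - t) Q" if t: "0 \<le> t" "t \<le> s"
  proof -
    have "scale (t / s + (1 - t / s)) R = scale (t / s) R + scale (1 - t / s) R"
      using s t by (intro scale_add R') auto
    moreover have "(1 - t / s) * s = s - t" using s by (simp add: field_simps)
    ultimately show ?thesis
      using s by (simp add: scale_set_plus scale_scale ac_simps)
  qed
  then show ?thesis
    using mem_push_pull_iff[of "R + scale s P" "R + scale s Q" s x t] s R' P' polytope_Q convex_Q
    by (auto simp: convex_set_plus convex_scaling set_plus_nonempty)
qed

text \<open>Up to a bounded error, K is N (R + Q). From below, freezing points of t R and t P leaves
  a translate of (N - t) (R + Q); from above, exchanging t P for t Q costs at most C, that is C / N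
  after rescaling.\<close>

lemma slab_slice_bounds:
  assumes R: "R \<in> S_P P" and C: "\<And>p q. p \<in> P \<Longrightarrow> q \<in> Q \<Longrightarrow> norm (p - q) \<le> C"
    and N: "N \<ge> 1" and t: "0 \<le> t" "t \<le> (1::real)"
  defines "K \<equiv> scale N R + scale t P + scale (N - t) Q"
  shows "(N - 1) ^ CARD('n) * measure lebesgue (R + Q) \<le> measure lebesgue K"
    and "measure lebesgue K \<le> N ^ CARD('n) * measure lebesgue (R + Q + cball 0 (C / N))"
proof -
  note R' = S_PD[OF R] and P' = S_PD[OF P_S_P]
  have K: "K \<in> lmeasurable"
    unfolding K_def using R' P' compact_Q
    by (intro lmeasurable_compact compact_set_plus compact_scaling)
  obtain r0 p0 where rp: "r0 \<in> R" "p0 \<in> P" using R'(3) P'(3) by blast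
  let ?L = "(+) (t *\<^sub>R r0 + t *\<^sub>R p0) ` scale (N - t) (R + Q)"
  have "scale (t + (N - t)) R = scale t R + scale (N - t) R"
    using N t by (intro scale_add R') auto
  then have NR: "scale N R = scale t R + scale (N - t) R" by simp
  have "?L \<subseteq> K"
  proof
    fix x assume "x \<in> ?L"
    then obtain r q where rq: "r \<in> R" "q \<in> Q" "x = t *\<^sub>R r0 + t *\<^sub>R p0 + (N - t) *\<^sub>R (r + q)"
      by (auto simp: set_plus_def)
    have "x = (t *\<^sub>R r0 + (N - t) *\<^sub>R r) + t *\<^sub>R p0 + (N - t) *\<^sub>R q"
      unfolding rq(3) by (simp add: scaleR_add_right)
    also have "\<dots> \<in> K"
      unfolding K_def NR using rp rq by (intro set_plus_intro imageI)
    finally show "x \<in> K" .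
  qed
  moreover have "?L \<in> lmeasurable"
    using R' compact_Q
    by (intro lmeasurable_compact compact_translation compact_scaling compact_set_plus)
  ultimately have "measure lebesgue ?L \<le> measure lebesgue K"
    using K measure_mono_fmeasurable fmeasurableD by blast
  moreover have "measure lebesgue ?L = (N - t) ^ CARD('n) * measure lebesgue (R + Q)"
    using N t by (simp add: measure_translation measure_scale)
  moreover have "(N - 1) ^ CARD('n) \<le> (N - t) ^ CARD('n)"
    using N t by (intro power_mono) auto
  ultimately show "(N - 1) ^ CARD('n) * measure lebesgue (R + Q) \<le> measure lebesgue K"
    by (smt (verit) measure_nonneg mult_right_mono)
  let ?H = "scale N (R + Q + cball 0 (C / N))"
  have "K \<subseteq> ?H"
  proof
    fix x assume "x \<in> K"
    then obtain r p q where x: "r \<in> R" "p \<in> P" "q \<in> Q" "x = N *\<^sub>R r + t *\<^sub>R p + (N - t) *\<^sub>R q"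
      by (auto simp: K_def set_plus_def)
    have "norm ((t / N) *\<^sub>R (p - q)) \<le> (1 / N) * C"
      unfolding norm_scaleR using N t C[OF x(2,3)] by (intro mult_mono) (auto simp: divide_right_mono)
    then have "r + q + (t / N) *\<^sub>R (p - q) \<in> R + Q + cball 0 (C / N)"
      using x by (intro set_plus_intro) auto
    moreover have "x = N *\<^sub>R (r + q + (t / N) *\<^sub>R (p - q))"
      using N unfolding x(4) by (simp add: algebra_simps)
    ultimately show "x \<in> ?H" by blast
  qed
  moreover have "?H \<in> lmeasurable"
    using R' compact_Q
    by (intro lmeasurable_compact compact_scaling compact_set_plus compact_cball)
  ultimately have "measure lebesgue K \<le> measure lebesgue ?H"
    using K measure_mono_fmeasurable fmeasurableD by blast
  then show "measure lebesgue K \<le> N ^ CARD('n) * measure lebesgue (R + Q + cball 0 (C / N))"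
    using N by (simp add: measure_scale)
qed

text \<open>The part of \<Delta>(N, N x) above height 1 is a translate of \<Delta>(N - 1, N x). The
  slab below it therefore has volume V(N, N x) - V(N - 1, N x), which homogeneity turns into a
  difference of values of V at heights 1 and (N - 1) / N. As N = m + 2, both N and N - 1 are
  positive.\<close>

lemma slab_bounds:
  fixes m :: nat
  assumes R: "R \<in> S_P P" and C: "\<And>p q. p \<in> P \<Longrightarrow> q \<in> Q \<Longrightarrow> norm (p - q) \<le> C"
  defines "N \<equiv> real (Suc (Suc m))" and "x \<equiv> pc R + pc P"
  shows "((N - 1) / N) ^ CARD('n) * measure lebesgue (R + Q) \<le>
      N * (V (join_coord 1 x) - V (join_coord ((N - 1) / N) x))"
    and "N * (V (join_coord 1 x) - V (join_coord ((N - 1) / N) x)) \<le>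
      measure lebesgue (R + Q + cball 0 (C / N))"
proof -
  have N: "N \<ge> 1" "N > 0" and M: "real (Suc m) = N - 1" by (simp_all add: N_def)
  let ?NR = "scale N R"
  have NR: "?NR \<in> S_P P" unfolding N_def by (rule scale_S_P[OF R])
  then have NRP: "?NR + P \<in> S_P P" using P_S_P by (rule S_P_add)
  let ?D = "push_pull N (?NR + scale N P) (?NR + scale N Q)"
  let ?D' = "push_pull (N - 1) (?NR + P + scale (N - 1) P) (?NR + P + scale (N - 1) Q)"
  let ?slab = "?D \<inter> {z. snd z \<le> 1}"
  have "V (join_coord N (N *\<^sub>R x)) = measure lebesgue ?D"
    using V_push_pull[OF NR, of "Suc m", folded N_def] pc_scale[OF R, of "Suc m", folded N_def]
    by (simp add: x_def scaleR_add_right)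
  then have D: "measure lebesgue ?D = N ^ Suc CARD('n) * V (join_coord 1 x)"
    using V_homogeneous[of N "join_coord 1 x"] by (simp add: join_coord_scaleR)
  have "pc (?NR + P) + (N - 1) *\<^sub>R pc P = N *\<^sub>R x"
    using pc_add[OF NR P_S_P] pc_scale[OF R, of "Suc m", folded N_def]
    by (simp add: x_def algebra_simps)
  then have "V (join_coord (N - 1) (N *\<^sub>R x)) = measure lebesgue ?D'"
    using V_push_pull[OF NRP, of m] unfolding M by simp
  then have D': "measure lebesgue ?D' = N ^ Suc CARD('n) * V (join_coord ((N - 1) / N) x)"
    using V_homogeneous[of N "join_coord ((N - 1) / N) x"] N by (simp add: join_coord_scaleR)
  have cD: "compact ?D" "compact ?D'"
    using S_PD[OF NR] S_PD[OF P_S_P] compact_Q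
    by (auto intro!: compact_push_pull compact_set_plus compact_scaling)
  have D_iff: "(y, t) \<in> ?D \<longleftrightarrow> 0 \<le> t \<and> t \<le> N \<and> y \<in> ?NR + scale t P + scale (N - t) Q" for y t
    by (rule mem_push_pull_slice[OF NR N(2)])
  have D'_iff: "(y, t) \<in> ?D' \<longleftrightarrow>
      0 \<le> t \<and> t \<le> N - 1 \<and> y \<in> ?NR + P + scale t P + scale (N - 1 - t) Q" for y t
    by (rule mem_push_pull_slice[OF NRP]) (simp add: N_def)
  \<comment> \<open>The extra summand P of the upper polytope compensates the shift: P + (t - 1) P =
    t P, and the coefficient of Q is (N - 1) - (t - 1) = N - t.\<close>
  have "(y, t) \<in> (+) (0, 1) ` ?D' \<longleftrightarrow> (y, t) \<in> ?D \<and> 1 \<le> t" for y t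
  proof -
    have "(y, t) \<in> (+) (0, 1) ` ?D' \<longleftrightarrow> (y, t - 1) \<in> ?D'"
      by (force simp: image_iff)
    also have "\<dots> \<longleftrightarrow> (y, t) \<in> ?D \<and> 1 \<le> t"
    proof (cases "1 \<le> t")
      case True
      have "scale (1 + (t - 1)) P = scale 1 P + scale (t - 1) P"
        using True S_PD[OF P_S_P] by (intro scale_add) auto
      then have "?NR + P + scale (t - 1) P = ?NR + scale t P" by (simp add: add.assoc)
      then show ?thesis using True unfolding D_iff D'_iff by auto
    qed (simp add: D'_iff)
    finally show ?thesis .
  qed
  then have top: "(+) (0, 1) ` ?D' = ?D \<inter> {z. 1 \<le> snd z}"
    unfolding set_eq_iff Int_iff mem_Collect_eq split_paired_All snd_conv by blast
  have cslab: "compact ?slab"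
    using cD(1) by (intro compact_Int_closed closed_Collect_le continuous_intros)
  have "measure lebesgue (?slab \<union> (+) (0, 1) ` ?D') =
      measure lebesgue ?slab + measure lebesgue ((+) (0, 1) ` ?D')"
  proof (rule negligible_Int_measure_Un)
    show "?slab \<in> lmeasurable" using cslab by (rule lmeasurable_compact)
    show "(+) (0, 1) ` ?D' \<in> lmeasurable"
      using cD(2) by (intro lmeasurable_compact compact_translation)
    have "negligible {z :: (real^'n) \<times> real. (0, 1) \<bullet> z = 1}"
      by (rule negligible_hyperplane) simp
    then show "negligible (?slab \<inter> (+) (0, 1) ` ?D')"
      by (rule negligible_subset) (auto simp: top)
  qed
  moreover have "?slab \<union> (+) (0, 1) ` ?D' = ?D" unfolding top by auto
  ultimately have "measure lebesgue ?D = measure lebesgue ?slab + measure lebesgue ?D'"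
    by (simp only: measure_translation)
  then have slab: "measure lebesgue ?slab =
      N ^ CARD('n) * (N * (V (join_coord 1 x) - V (join_coord ((N - 1) / N) x)))"
    unfolding D D' right_diff_distrib by (simp add: mult.assoc mult.left_commute[of N])
  have slice: "{y. (y, t) \<in> ?slab} = ?NR + scale t P + scale (N - t) Q" if "0 \<le> t" "t \<le> 1" for t
    using that N by (auto simp: D_iff)
  have unit: "0 \<le> t \<and> t \<le> 1" if "(y, t) \<in> ?slab" for y t
    using that by (simp add: D_iff)
  have lo: "(N - 1) ^ CARD('n) * measure lebesgue (R + Q) \<le> measure lebesgue {y. (y, t) \<in> ?slab}"
    if "0 \<le> t" "t \<le> 1" for t
    unfolding slice[OF that] by (rule slab_slice_bounds(1)[OF R C N(1) that])
  have hi: "measure lebesgue {y. (y, t) \<in> ?slab} \<le>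
      N ^ CARD('n) * measure lebesgue (R + Q + cball 0 (C / N))" if "0 \<le> t" "t \<le> 1" for t
    unfolding slice[OF that] by (rule slab_slice_bounds(2)[OF R C N(1) that])
  have nonneg: "0 \<le> (N - 1) ^ CARD('n) * measure lebesgue (R + Q)" using N by simp
  have "(N - 1) ^ CARD('n) * measure lebesgue (R + Q) \<le> measure lebesgue ?slab"
    by (rule measure_slab_bounds(1)[OF cslab])
      (erule unit, rule lo, assumption, assumption, rule hi, assumption, assumption, rule nonneg)
  moreover have "measure lebesgue ?slab \<le> N ^ CARD('n) * measure lebesgue (R + Q + cball 0 (C / N))"
    by (rule measure_slab_bounds(2)[OF cslab])
      (erule unit, rule lo, assumption, assumption, rule hi, assumption, assumption, rule nonneg)
  ultimately show "((N - 1) / N) ^ CARD('n) * measure lebesgue (R + Q) \<le>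
      N * (V (join_coord 1 x) - V (join_coord ((N - 1) / N) x))"
    and "N * (V (join_coord 1 x) - V (join_coord ((N - 1) / N) x)) \<le>
      measure lebesgue (R + Q + cball 0 (C / N))"
    using N unfolding slab by (simp_all add: power_divide pos_divide_le_eq mult.commute)
qed

text \<open>The difference quotients with step -1/N lie between ((N - 1) / N)^n vol (R + Q) and the
  volume of a shrinking parallel body of R + Q; both bounds have the same limit.\<close>

lemma partial_deriv_V_eq_measure:
  assumes R: "R \<in> S_P P"
  shows "partial_deriv None V (join_coord 1 (pc R + pc P)) = measure lebesgue (R + Q)"
proof -
  let ?x = "pc R + pc P"
  let ?N = "\<lambda>m. real (Suc (Suc m))"
  let ?a = "\<lambda>m. ?N m * (V (join_coord 1 ?x) - V (join_coord ((?N m - 1) / ?N m) ?x))"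
  obtain B where B: "\<And>z. z \<in> P \<union> Q \<Longrightarrow> norm z \<le> B"
    using compact_imp_bounded[OF compact_Un[OF S_PD(4)[OF P_S_P] compact_Q]] by (auto simp: bounded_iff)
  then have C: "norm (p - q) \<le> 2 * B" if "p \<in> P" "q \<in> Q" for p q
  proof -
    have "norm p \<le> B" "norm q \<le> B" using B that by blast+
    then show ?thesis using norm_triangle_ineq4[of p q] by linarith
  qed
  obtain p0 q0 where "p0 \<in> P" "q0 \<in> Q" using polytope_P polytope_Q by blast
  then have B0: "0 \<le> 2 * B" using C norm_ge_zero by (meson order_trans)
  have h: "(\<lambda>m. - inverse (?N m)) \<longlonglongrightarrow> 0"
    using tendsto_minus[OF LIMSEQ_Suc[OF LIMSEQ_inverse_real_of_nat]] by simp
  have "((\<lambda>h. (V (join_coord (1 + h) ?x) - V (join_coord 1 ?x)) / h)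
      \<longlongrightarrow> partial_deriv None V (join_coord 1 ?x)) (at 0)"
    using has_derivative_join_coord[OF V_poly, of ?x 1] unfolding DERIV_def .
  then have "(\<lambda>m. (V (join_coord (1 + - inverse (?N m)) ?x) - V (join_coord 1 ?x)) / - inverse (?N m))
      \<longlonglongrightarrow> partial_deriv None V (join_coord 1 ?x)"
    using h unfolding tendsto_at_iff_sequentially
    by (elim allE[of _ "\<lambda>m. - inverse (?N m)"]) (simp add: o_def del: of_nat_Suc)
  moreover have "(V (join_coord (1 + - inverse (?N m)) ?x) - V (join_coord 1 ?x)) / - inverse (?N m) = ?a m" for m
  proof -
    have "1 + - inverse (?N m) = (?N m - 1) / ?N m" by (simp add: field_simps)
    then show ?thesis by (simp add: field_simps)
  qed
  ultimately have "?a \<longlonglongrightarrow> partial_deriv None V (join_coord 1 ?x)" by simp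
  moreover have "?a \<longlonglongrightarrow> measure lebesgue (R + Q)"
  proof (rule real_tendsto_sandwich)
    show "\<forall>\<^sub>F m in sequentially. ((?N m - 1) / ?N m) ^ CARD('n) * measure lebesgue (R + Q) \<le> ?a m"
      using slab_bounds(1)[OF R C] by (intro always_eventually allI)
    show "\<forall>\<^sub>F m in sequentially. ?a m \<le> measure lebesgue (R + Q + cball 0 ((2 * B) / ?N m))"
      using slab_bounds(2)[OF R C] by (intro always_eventually allI)
    show "(\<lambda>m. measure lebesgue (R + Q + cball 0 ((2 * B) / ?N m))) \<longlonglongrightarrow> measure lebesgue (R + Q)"
      using S_PD[OF R] compact_Q polytope_Q B0
      by (intro LIMSEQ_Suc measure_cball_plus_tendsto compact_set_plus set_plus_nonempty)
    have "(\<lambda>m. (1 + - inverse (?N m)) ^ CARD('n) * measure lebesgue (R + Q)) \<longlonglongrightarrow>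
        (1 + 0) ^ CARD('n) * measure lebesgue (R + Q)"
      by (intro tendsto_intros h)
    moreover have "1 + - inverse (?N m) = (?N m - 1) / ?N m" for m by (simp add: field_simps)
    ultimately show "(\<lambda>m. ((?N m - 1) / ?N m) ^ CARD('n) * measure lebesgue (R + Q)) \<longlonglongrightarrow>
        measure lebesgue (R + Q)" by simp
  qed
  ultimately show ?thesis by (rule LIMSEQ_unique)
qed

text \<open>Height 0 does not occur in the semigroup, so the value is a limit. By homogeneity V(1/N,
  x) is N^-(n+1) times the volume of a polytope of height 1 whose slices are O(N^n), hence it is
  O(1/N).\<close>

lemma V_join_coord_0: "V (join_coord 0 p) = 0"
proof (rule density[OF real_polynomial_function_join_coord[OF V_poly]])
  fix R assume R: "R \<in> S_P P"
  let ?x = "pc P + pc R" and ?N = "\<lambda>m. real (Suc (Suc m))"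
  obtain B where B: "\<And>z. z \<in> R \<union> (P \<union> Q) \<Longrightarrow> norm z \<le> B"
    using compact_imp_bounded[OF compact_Un[OF S_PD(4)[OF R] compact_Un[OF S_PD(4)[OF P_S_P] compact_Q]]]
    by (auto simp: bounded_iff)
  have B0: "0 \<le> B" using B polytope_P(2) norm_ge_zero by (meson UnCI ex_in_conv order_trans)
  let ?c = "measure lebesgue (cball (0 :: real^'n) (3 * B))"
  have bd: "0 \<le> V (join_coord (inverse (?N m)) ?x) \<and> V (join_coord (inverse (?N m)) ?x) \<le> ?c * inverse (?N m)" for m
  proof -
    \<comment> \<open>N - 1 copies of P here and one from the push-pull construction make the
      coordinates N (pc R + pc P).\<close>
    let ?R = "scale (?N m) R + scale (real (Suc m)) P"
    have R': "?R \<in> S_P P" by (intro S_P_add scale_S_P R P_S_P)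
    let ?D = "push_pull 1 (?R + scale 1 P) (?R + scale 1 Q)"
    have "pc ?R = ?N m *\<^sub>R pc R + real (Suc m) *\<^sub>R pc P"
      unfolding pc_add[OF scale_S_P[OF R, of "Suc m"] scale_S_P[OF P_S_P, of m]]
        pc_scale[OF R, of "Suc m"] pc_scale[OF P_S_P, of m] ..
    moreover have "?N m *\<^sub>R pc P = real (Suc m) *\<^sub>R pc P + 1 *\<^sub>R pc P"
      unfolding scaleR_add_left[symmetric] by (simp add: add.commute)
    ultimately have "pc ?R + 1 *\<^sub>R pc P = ?N m *\<^sub>R ?x"
      unfolding scaleR_add_right by (simp only: ac_simps)
    then have "V (join_coord 1 (?N m *\<^sub>R ?x)) = measure lebesgue ?D"
      using V_push_pull[OF R', of 0] by simp
    moreover have "join_coord 1 (?N m *\<^sub>R ?x) = ?N m *\<^sub>R join_coord (inverse (?N m)) ?x"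
      by (simp add: join_coord_scaleR del: of_nat_Suc)
    ultimately have eq: "measure lebesgue ?D = ?N m ^ CARD('n) * (?N m * V (join_coord (inverse (?N m)) ?x))"
      using V_homogeneous[of "?N m" "join_coord (inverse (?N m)) ?x"]
      by (simp add: ac_simps del: of_nat_Suc)
    have D_iff: "(y, t) \<in> ?D \<longleftrightarrow> 0 \<le> t \<and> t \<le> 1 \<and> y \<in> ?R + scale t P + scale (1 - t) Q" for y t
      using mem_push_pull_slice[OF R', of 1] by simp
    have cD: "compact ?D"
      using S_PD[OF R] S_PD[OF P_S_P] compact_Q
      by (intro compact_push_pull compact_set_plus compact_scaling)
    have slice: "measure lebesgue {y. (y, t) \<in> ?D} \<le> ?N m ^ CARD('n) * ?c" if t: "0 \<le> t" "t \<le> 1" for t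
    proof -
      have "{y. (y, t) \<in> ?D} \<subseteq> scale (?N m) (cball 0 (3 * B))"
      proof
        fix y assume "y \<in> {y. (y, t) \<in> ?D}"
        then obtain r p' p q where y: "y = ?N m *\<^sub>R r + real (Suc m) *\<^sub>R p' + t *\<^sub>R p + (1 - t) *\<^sub>R q"
          and m: "r \<in> R" "p' \<in> P" "p \<in> P" "q \<in> Q"
          unfolding D_iff mem_Collect_eq by (auto elim!: set_plus_elim)
        \<comment> \<open>One share N B each for N R, for (N - 1) P and for the convex combination
          of P and Q; this explains the radius 3 B.\<close>
        have "norm y \<le> ?N m * B + ?N m * B + ?N m * B"
        proof -
          have "norm (?N m *\<^sub>R r) \<le> ?N m * B"
            using B[of r] m by (simp add: mult_left_mono del: of_nat_Suc)
          moreover have "norm (real (Suc m) *\<^sub>R p') \<le> ?N m * B"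
            unfolding norm_scaleR using B[of p'] m by (intro mult_mono) auto
          moreover have "norm (t *\<^sub>R p + (1 - t) *\<^sub>R q) \<le> ?N m * B"
          proof -
            have "norm (t *\<^sub>R p + (1 - t) *\<^sub>R q) \<le> t * B + (1 - t) * B"
              using B[of p] B[of q] m t
              by (intro order_trans[OF norm_triangle_ineq] add_mono) (auto intro: mult_left_mono)
            also have "\<dots> = 1 * B" by (simp add: algebra_simps)
            also have "\<dots> \<le> ?N m * B" using B0 by (intro mult_right_mono) auto
            finally show ?thesis .
          qed
          moreover have "norm y \<le> norm (?N m *\<^sub>R r) + norm (real (Suc m) *\<^sub>R p') +
              norm (t *\<^sub>R p + (1 - t) *\<^sub>R q)"
            unfolding y add.assoc by (metis add.assoc add_left_mono norm_triangle_le norm_triangle_ineq)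
          ultimately show ?thesis by linarith
        qed
        then have "inverse (?N m) *\<^sub>R y \<in> cball 0 (3 * B)"
          by (simp add: field_simps del: of_nat_Suc)
        moreover have "y = ?N m *\<^sub>R (inverse (?N m) *\<^sub>R y)" by (simp del: of_nat_Suc)
        ultimately show "y \<in> scale (?N m) (cball 0 (3 * B))" by blast
      qed
      moreover have "{y. (y, t) \<in> ?D} \<in> sets lebesgue"
      proof -
        have "{y. (y, t) \<in> ?D} = ?R + scale t P + scale (1 - t) Q"
          unfolding D_iff using t by simp
        moreover have "compact (?R + scale t P + scale (1 - t) Q)"
          using S_PD[OF R] S_PD[OF P_S_P] compact_Q by (intro compact_set_plus compact_scaling)
        ultimately show ?thesis using lmeasurable_compact fmeasurableD by metis
      qed
      moreover have "scale (?N m) (cball (0 :: real^'n) (3 * B)) \<in> lmeasurable"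
        by (intro lmeasurable_compact compact_scaling compact_cball)
      ultimately have "measure lebesgue {y. (y, t) \<in> ?D} \<le>
          measure lebesgue (scale (?N m) (cball (0 :: real^'n) (3 * B)))"
        by (rule measure_mono_fmeasurable)
      then show ?thesis by (simp add: measure_scale del: of_nat_Suc)
    qed
    have "measure lebesgue ?D \<le> ?N m ^ CARD('n) * ?c"
    proof (rule measure_slab_bounds(2)[OF cD])
      show "0 \<le> t \<and> t \<le> 1" if "(y, t) \<in> ?D" for y t using that unfolding D_iff by blast
      show "measure lebesgue {y. (y, t) \<in> ?D} \<le> ?N m ^ CARD('n) * ?c" if "0 \<le> t" "t \<le> 1" for t
        using that by (rule slice)
      show "0 \<le> measure lebesgue {y. (y, t) \<in> ?D}" for t by simp
    qed simp
    then have "?N m * V (join_coord (inverse (?N m)) ?x) \<le> ?c"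
      unfolding eq by (simp del: of_nat_Suc)
    moreover have "0 \<le> ?N m * V (join_coord (inverse (?N m)) ?x)"
    proof -
      have "0 < ?N m ^ CARD('n)" by simp
      moreover have "0 \<le> ?N m ^ CARD('n) * (?N m * V (join_coord (inverse (?N m)) ?x))"
        unfolding eq[symmetric] by simp
      ultimately show ?thesis by (metis mult_le_cancel_left_pos mult_zero_right)
    qed
    ultimately show ?thesis
      by (simp add: zero_le_mult_iff field_simps del: of_nat_Suc)
  qed
  have inv: "(\<lambda>m. inverse (?N m)) \<longlonglongrightarrow> 0" using LIMSEQ_Suc[OF LIMSEQ_inverse_real_of_nat] .
  have "isCont (\<lambda>t. V (join_coord t ?x)) 0"
    using has_derivative_join_coord[OF V_poly] by (rule DERIV_isCont)
  then have "(\<lambda>m. V (join_coord (inverse (?N m)) ?x)) \<longlonglongrightarrow> V (join_coord 0 ?x)"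
    using inv by (rule isCont_tendsto_compose)
  moreover have "(\<lambda>m. V (join_coord (inverse (?N m)) ?x)) \<longlonglongrightarrow> 0"
  proof (rule real_tendsto_sandwich)
    show "\<forall>\<^sub>F m in sequentially. 0 \<le> V (join_coord (inverse (?N m)) ?x)"
      and "\<forall>\<^sub>F m in sequentially. V (join_coord (inverse (?N m)) ?x) \<le> ?c * inverse (?N m)"
      using bd by (simp_all only: eventually_sequentially) blast+
    show "(\<lambda>m. ?c * inverse (?N m)) \<longlonglongrightarrow> 0" by (rule tendsto_mult_right_zero[OF inv])
  qed simp
  ultimately show "V (join_coord 0 (pc P + pc R)) = 0" by (rule LIMSEQ_unique)
qed

section \<open>The s-derivative of V, from s = 1 to arbitrary s\<close>

lemma partial_deriv_V_homogeneous:
  assumes "t > 0"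
  shows "partial_deriv None V (t *\<^sub>R x) = t ^ CARD('n) * partial_deriv None V x"
proof -
  have "((\<lambda>h. V (t *\<^sub>R x + h *\<^sub>R axis None 1)) has_real_derivative
      t ^ Suc CARD('n) * (partial_deriv None V x * (1 / t))) (at 0)"
  proof -
    have "((\<lambda>h. V (x + h *\<^sub>R axis None 1)) has_real_derivative partial_deriv None V x) (at (0 * (1 / t)))"
      using has_dir_deriv_0[OF V_poly] by (simp add: partial_deriv_eq)
    then have "((\<lambda>h. V (x + (h * (1 / t)) *\<^sub>R axis None 1)) has_real_derivative
        partial_deriv None V x * (1 / t)) (at 0)"
      by (rule DERIV_chain2) (use assms in \<open>auto intro!: derivative_eq_intros\<close>)
    then have "((\<lambda>h. t ^ Suc CARD('n) * V (x + (h * (1 / t)) *\<^sub>R axis None 1)) has_real_derivative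
        t ^ Suc CARD('n) * (partial_deriv None V x * (1 / t))) (at 0)"
      by (rule DERIV_cmult)
    moreover have "t ^ Suc CARD('n) * V (x + (h * (1 / t)) *\<^sub>R axis None 1) = V (t *\<^sub>R x + h *\<^sub>R axis None 1)" for h
      using assms by (simp add: V_homogeneous[symmetric] scaleR_add_right del: power_Suc)
    ultimately show ?thesis by simp
  qed
  then show ?thesis
    using assms by (simp add: partial_deriv_def DERIV_imp_deriv)
qed

text \<open>Homogeneity reduces s = 1/N to s = 1 on the N-fold dilate. With R = N A + (N - 1) Phat,
  the sum R + Q is N times the truncated sum of \<open>measure_truncation\<close>; N = m + 2 keeps
  the coefficient of Phat positive.\<close>

lemma partial_deriv_V_cut_off:
  fixes m :: nat
  assumes A: "A \<in> S_P P"
  defines "N \<equiv> real (Suc (Suc m))" and "w \<equiv> pc Phat + pc A"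
  shows "partial_deriv None V (join_coord (1 / N) (w - (1 / N) *\<^sub>R (pc Phat - pc P))) =
    volP w - measure lebesgue (cut_off P Phat k F \<psi> c (A + Phat) (1 / N))"
proof -
  have N: "N > 1" and M: "real (Suc m) = N - 1" by (simp_all add: N_def)
  let ?R = "scale N A + scale (N - 1) Phat"
  have R: "?R \<in> S_P P"
    unfolding M[symmetric] unfolding N_def by (intro S_P_add scale_S_P A Phat_S_P)
  let ?z = "w - (1 / N) *\<^sub>R (pc Phat - pc P)"
  have "pc ?R + pc P = N *\<^sub>R pc A + (N - 1) *\<^sub>R pc Phat + pc P"
    using pc_add[OF scale_S_P[OF A, of "Suc m"] scale_S_P[OF Phat_S_P, of m]]
      pc_scale[OF A, of "Suc m"] pc_scale[OF Phat_S_P, of m]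
    unfolding M N_def[symmetric] by simp
  also have "\<dots> = N *\<^sub>R ?z"
    using N by (simp add: w_def algebra_simps)
  finally have "join_coord 1 (pc ?R + pc P) = N *\<^sub>R join_coord (1 / N) ?z"
    using N by (simp add: join_coord_scaleR)
  then have "N ^ CARD('n) * partial_deriv None V (join_coord (1 / N) ?z) = measure lebesgue (?R + Q)"
    using partial_deriv_V_eq_measure[OF R] partial_deriv_V_homogeneous[of N] N by simp
  also have "?R + Q = scale N (A + scale (1 - 1 / N) Phat + scale (1 / N) Q)"
    using N by (simp add: scale_set_plus scale_scale right_diff_distrib)
  also have "measure lebesgue \<dots> =
      N ^ CARD('n) * measure lebesgue (A + scale (1 - 1 / N) Phat + scale (1 / N) Q)"
    using N by (simp add: measure_scale)
  finally have "partial_deriv None V (join_coord (1 / N) ?z) =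
      measure lebesgue (A + scale (1 - 1 / N) Phat + scale (1 / N) Q)"
    using N by simp
  moreover have "volP w = measure lebesgue (A + Phat)"
    using volP_eq[OF S_P_add[OF A Phat_S_P]] pc_add[OF A Phat_S_P] by (simp add: w_def add.commute)
  ultimately show ?thesis
    using measure_truncation[OF S_PD(1)[OF A], of "1 / N"] N by simp
qed

text \<open>The substitution w = p + s \<delta> separates the variables. For fixed w = pc Phat + pc
  A both sides are polynomials in s that agree at 1/N for all large N, where the expansion of the
  cut-off volume is valid; then for fixed s both are polynomials in w that agree on a Zariski dense
  set.\<close>

lemma partial_deriv_V_eq:
  assumes vg: "truncation_polynomials P Phat k F \<psi> c b a volF g"
  shows "partial_deriv None V (join_coord s p) =
    volP (p + s *\<^sub>R (pc Phat - pc P)) - q_poly CARD('n) volF g s (p + s *\<^sub>R (pc Phat - pc P))"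
proof -
  define \<delta> where "\<delta> = pc Phat - pc P"
  let ?U = "partial_deriv None V"
  let ?f = "\<lambda>s w. ?U (join_coord s (w - s *\<^sub>R \<delta>)) - volP w + q_poly CARD('n) volF g s w"
  have U: "real_polynomial_function ?U" using V_poly by (rule real_polynomial_function_partial_deriv)
  have gj: "real_polynomial_function (g j)" if "j \<in> {3..CARD('n)}" for j
    using vg that unfolding truncation_polynomials_def by blast+
  have vF: "real_polynomial_function volF"
    using vg unfolding truncation_polynomials_def by blast
  have *: "?f s (pc Phat + pc A) = 0" if A: "A \<in> S_P P" for A s
  proof (rule real_polynomial_function_eq_0[where f = "\<lambda>s. ?f s (pc Phat + pc A)"])
    let ?w = "pc Phat + pc A"
    have "real_polynomial_function (\<lambda>s. ?U (join_coord 0 ?w + s *\<^sub>R join_coord 1 (- \<delta>)))"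
      by (rule real_polynomial_function_line[OF U])
    then have "real_polynomial_function (\<lambda>s. ?U (join_coord s (?w - s *\<^sub>R \<delta>)))"
      by (simp add: join_coord_scaleR join_coord_add)
    moreover have "real_polynomial_function (\<lambda>s. q_poly CARD('n) volF g s ?w)"
      unfolding q_poly_def
      by (intro real_polynomial_function.intros(2-4) real_polynomial_function_sum
          real_polynomial_function_divide real_polynomial_function_power
          real_polynomial_function.intros(1) bounded_linear_ident) auto
    ultimately show "real_polynomial_function (\<lambda>s. ?f s ?w)"
      by (intro real_polynomial_function_diff real_polynomial_function.intros(2-3))
    have AP: "A + Phat \<in> S_P P" "pc (A + Phat) = ?w"
      using S_P_add[OF A Phat_S_P] pc_add[OF A Phat_S_P] by (simp_all add: add.commute)
    have "\<forall>\<^sub>F s in at_right 0. measure lebesgue (cut_off P Phat k F \<psi> c (A + Phat) s) =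
        q_poly CARD('n) volF g s ?w"
      using vg AP unfolding truncation_polynomials_def by metis
    then obtain e where e: "e > 0" "\<And>s. 0 < s \<Longrightarrow> s < e \<Longrightarrow>
        measure lebesgue (cut_off P Phat k F \<psi> c (A + Phat) s) = q_poly CARD('n) volF g s ?w"
      unfolding eventually_at_right_field by auto
    obtain m0 where m0: "1 / real (Suc m0) < e"
      using e(1) reals_Archimedean by (metis inverse_eq_divide)
    have "?f (1 / real (Suc (Suc (m + m0)))) ?w = 0" for m
    proof -
      have "1 / real (Suc (Suc (m + m0))) \<le> 1 / real (Suc m0)" by (intro divide_left_mono) auto
      then have "1 / real (Suc (Suc (m + m0))) < e" using m0 by linarith
      then show ?thesis
        using partial_deriv_V_cut_off[OF A, of "m + m0"] e(2)[of "1 / real (Suc (Suc (m + m0)))"]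
        by (simp add: \<delta>_def)
    qed
    then have "range (\<lambda>m. 1 / real (Suc (Suc (m + m0)))) \<subseteq> {s. ?f s ?w = 0}" by blast
    moreover have "inj (\<lambda>m. 1 / real (Suc (Suc (m + m0))))" by (auto simp: inj_def)
    ultimately show "infinite {s. ?f s ?w = 0}"
      by (rule infinite_super[OF _ range_inj_infinite])
  qed
  have "?f s (p + s *\<^sub>R \<delta>) = 0"
  proof (rule density[where f = "?f s" and p = "pc Phat"])
    show "?f s (pc Phat + pc A) = 0" if "A \<in> S_P P" for A using that by (rule *)
    have "real_polynomial_function (\<lambda>w. ?U (join_coord s (w + - (s *\<^sub>R \<delta>))))"
      by (rule real_polynomial_function_translate[OF real_polynomial_function_join_coord[OF U]])
    moreover have "real_polynomial_function (q_poly CARD('n) volF g s)"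
      unfolding q_poly_def
      by (intro real_polynomial_function.intros(3,4,2) real_polynomial_function_sum vF gj) auto
    ultimately show "real_polynomial_function (?f s)"
      using volP_poly by (intro real_polynomial_function_diff real_polynomial_function.intros(3)) simp_all
  qed
  then show ?thesis by (simp add: \<delta>_def)
qed

lemma apply_diffop_poly_diffop_diff:
  assumes "real_polynomial_function h"
  shows "apply_diffop (poly_diffop (S_P P) b Phat - poly_diffop (S_P P) b P) h =
    dir_deriv (pc Phat - pc P) h"
proof -
  have eq: "apply_diffop (poly_diffop (S_P P) b A) h = dir_deriv (pc A) h" if "A \<in> S_P P" for A
  proof -
    have "(\<chi> i. of_int \<lfloor>pc A $ i\<rfloor>) = pc A"
      by (simp add: vec_eq_iff floor_poly_coords[OF basis that])
    then show ?thesis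
      unfolding poly_diffop_def using apply_diffop_linear_form[OF assms, of "\<lambda>i. \<lfloor>pc A $ i\<rfloor>"] by simp
  qed
  have "dir_deriv (pc Phat) h x = dir_deriv (pc Phat - pc P) h x + dir_deriv (pc P) h x" for x
    using dir_deriv_add_left[OF assms, of "pc Phat - pc P" "pc P" x] by simp
  then show ?thesis
    by (auto simp: apply_diffop_diff eq Phat_S_P P_S_P)
qed

end

theorem theorem4p1:
  fixes P Phat Q :: "(real^'n) set"
    and k :: nat
    and F :: "nat \<Rightarrow> (real^'n) set"
    and \<psi> :: "nat \<Rightarrow> real^'n \<Rightarrow> real"
    and c a :: "nat \<Rightarrow> real"
    and b :: "'l::finite \<Rightarrow> ((real^'n) set \<times> (real^'n) set) set"
    and E :: "'l option \<Rightarrow> (((real^'n) \<times> real) set \<times> ((real^'n) \<times> real) set) set"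
    and volP volF :: "real^'l \<Rightarrow> real"
    and g :: "nat \<Rightarrow> real^'l \<Rightarrow> real"
    and volDelta :: "real^('l option) \<Rightarrow> real"
    and DF c1 :: "'l diffop"
    and Dj :: "nat \<Rightarrow> 'l diffop"
    and \<delta> :: "real^'l"
  assumes P: "lattice_polytope P"
    and Phat: "Phat \<in> S_P P"
    and Q: "codim_two_truncation P Phat k F \<psi> c Q"
    and b: "lattice_basis (grothendieck (S_P P)) b"
    and volP: "volume_polynomial (S_P P) b volP"
    and E: "push_pull_basis P Q b E"
    and volDelta: "volume_polynomial (S_Delta P Q) E volDelta"
    and volF_g: "truncation_polynomials P Phat k F \<psi> c b a volF g"
    and DF: "homogeneous_diffop 2 DF" "apply_diffop DF volP = volF"
    and Dj: "\<And>j. j \<in> {3..CARD('n)} \<Longrightarrow> homogeneous_diffop j (Dj j)"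
            "\<And>j. j \<in> {3..CARD('n)} \<Longrightarrow> apply_diffop (Dj j) volP = g j"
    and c1: "c1 = poly_diffop (S_P P) b Phat - poly_diffop (S_P P) b P"
    and \<delta>: "\<delta> = poly_coords (S_P P) b Phat - poly_coords (S_P P) b P"
    and q: "\<And>s p.
        deriv (deriv (\<lambda>t. q_poly CARD('n) volF g t (p + t *\<^sub>R \<delta>))) s
        - apply_diffop c1 (\<lambda>p'. deriv (\<lambda>t. q_poly CARD('n) volF g t (p' + t *\<^sub>R \<delta>)) s) p
        + apply_diffop DF (\<lambda>p'. q_poly CARD('n) volF g s (p' + s *\<^sub>R \<delta>)) p
        = volF (p + s *\<^sub>R \<delta>)"
  shows "KP_ring volDelta \<simeq>
           quadratic_extension (KP_ring volP) (KP_class volP c1) (KP_class volP DF)"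
proof -
  interpret geom: push_pull_setup P Phat Q k F \<psi> c b E volP volDelta
    by unfold_locales (use P Phat Q b volP E volDelta in \<open>auto simp: S_P_def\<close>)
  interpret push_pull_volumes volP volF g "CARD('n)" volDelta c1 DF Dj \<delta>
  proof
    show "real_polynomial_function volP" by (rule geom.volP_poly)
    show "real_polynomial_function volDelta" by (rule geom.V_poly)
    show "apply_diffop DF volP = volF" by (rule DF)
    show "\<And>j. j \<in> {3..CARD('n)} \<Longrightarrow> apply_diffop (Dj j) volP = g j" by (rule Dj)
    show "\<And>h. real_polynomial_function h \<Longrightarrow> apply_diffop c1 h = dir_deriv \<delta> h"
      unfolding c1 \<delta> by (rule geom.apply_diffop_poly_diffop_diff)
    show "\<And>p. volDelta (join_coord 0 p) = 0" by (rule geom.V_join_coord_0)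
    show "\<And>s p. partial_deriv None volDelta (join_coord s p) =
        volP (p + s *\<^sub>R \<delta>) - q_poly CARD('n) volF g s (p + s *\<^sub>R \<delta>)"
      unfolding \<delta> by (rule geom.partial_deriv_V_eq[OF volF_g])
  qed (rule q)
  show ?thesis by (rule KP_ring_iso)
qed

end
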